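(* Let $f\in\mathbb{C}[x]$ be a post-critically finite quadratic polynomial. Then the following are equivalent: (i) $\mathrm{IMG}(f)$ has property $\mathrm{(LR)}$; (ii) $\mathrm{IMG}(f)$ is virtually abelian; (iii) $f$ is linearly conjugate (up to a sign) to the powering map $z^2$ or to the Chebyshev polynomial $2x^2-1$.
   Context: $f$ is regarded as a map of the Riemann sphere $\widehat{\mathbb{C}}$. Let $C_f$ be its set of critical points and $P_f=\bigcup_{n\ge1}f^n(C_f)$ its post-critical set; $f$ is post-critically finite if $P_f$ is finite. Iterated monodromy group: fix $z\in\widehat{\mathbb{C}}\setminus P_f$ and let $T$ be the tree of preimages, with vertex set $\{z\}\sqcup\bigsqcup_{n\ge1}f^{-n}(z)$, where $x\in f^{-(n+1)}(z)$ is a child of $f(x)\in f^{-n}(z)$ (this is the $d$-adic rooted tree, $d=\deg f$). The fundamental group $\pi_1(\widehat{\mathbb{C}}\setminus P_f,z)$ acts on $T$ by tree automorphisms: for a loop $\gamma$ at $z$ and $x\in f^{-n}(z)$, $x^\gamma$ is the endpoint of the unique lift of $\gamma$ under $f^n$ starting at $x$. $\mathrm{IMG}(f)$ is the quotient of $\pi_1(\widehat{\mathbb{C}}\setminus P_f,z)$ by the kernel of this action, viewed as a subgroup of $\mathrm{Aut}~T$ (well defined up to conjugation). A subgroup $H\le G$ is a virtual retract of $G$ if there is a finite-index subgroup $K\le G$ containing $H$ and a homomorphism $K\to H$ restricting to the identity on $H$; $G$ has property $\mathrm{(LR)}$ if every finitely generated subgroup of $G$ is a virtual retract of $G$. *)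

theory Defs
  imports "HOL-Analysis.Analysis" "HOL-Computational_Algebra.Polynomial" "HOL-Algebra.Coset" "HOL-Algebra.Generated_Groups"
begin

text \<open>Critical points (in the finite plane) and post-critical set of a complex polynomial.
  For a polynomial, infinity is a (totally invariant) critical point, so the post-critical
  set on the Riemann sphere is P_f (below) together with infinity; the complement of the
  post-critical set in the sphere is thus the complement of P_f in the plane.\<close>

definition crit_points :: "complex poly \<Rightarrow> complex set" where
  "crit_points p = {c. poly (pderiv p) c = 0}"

definition postcrit :: "complex poly \<Rightarrow> complex set" where
  "postcrit p = (\<Union>n\<in>{1..}. (poly p ^^ n) ` crit_points p)"

definition pcf :: "complex poly \<Rightarrow> bool" where
  "pcf p \<longleftrightarrow> finite (postcrit p)"

definition pc_loops :: "complex poly \<Rightarrow> complex \<Rightarrow> (real \<Rightarrow> complex) set" where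
  "pc_loops p z = {\<gamma>. path \<gamma> \<and> path_image \<gamma> \<subseteq> - postcrit p \<and>
                        pathstart \<gamma> = z \<and> pathfinish \<gamma> = z}"

definition preimage_tree :: "complex poly \<Rightarrow> complex \<Rightarrow> (nat \<times> complex) set" where
  "preimage_tree p z = {(n, x). (poly p ^^ n) x = z}"

definition lift_end :: "complex poly \<Rightarrow> nat \<Rightarrow> (real \<Rightarrow> complex) \<Rightarrow> complex \<Rightarrow> complex" where
  "lift_end p n \<gamma> x = (THE y. \<exists>\<delta>. path \<delta> \<and> pathstart \<delta> = x \<and> pathfinish \<delta> = y \<and>
                           (\<forall>t\<in>{0..1}. (poly p ^^ n) (\<delta> t) = \<gamma> t))"

definition loop_action :: "complex poly \<Rightarrow> complex \<Rightarrow> (real \<Rightarrow> complex)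
                           \<Rightarrow> (nat \<times> complex) \<Rightarrow> (nat \<times> complex)" where
  "loop_action p z \<gamma> v = (if v \<in> preimage_tree p z then (fst v, lift_end p (fst v) \<gamma> (snd v)) else v)"

text \<open>The iterated monodromy group, realised as the group of tree permutations induced by
  loops (fundamental group modulo the kernel of the action).  The action is a right action
  (x^{\<gamma>\<delta>} = (x^\<gamma>)^\<delta>), hence the product g \<otimes> h is h \<circ> g.\<close>
definition IMG :: "complex poly \<Rightarrow> complex \<Rightarrow> ((nat \<times> complex) \<Rightarrow> (nat \<times> complex)) monoid" where
  "IMG p z = \<lparr> carrier = loop_action p z ` pc_loops p z,
               mult = (\<lambda>g h. h \<circ> g),
               one = id \<rparr>"

definition finite_index :: "('a, 'b) monoid_scheme \<Rightarrow> 'a set \<Rightarrow> bool" where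
  "finite_index G K \<longleftrightarrow> subgroup K G \<and> finite (rcosets\<^bsub>G\<^esub> K)"

definition virtual_retract :: "('a, 'b) monoid_scheme \<Rightarrow> 'a set \<Rightarrow> bool" where
  "virtual_retract G H \<longleftrightarrow> subgroup H G \<and>
     (\<exists>K. finite_index G K \<and> H \<subseteq> K \<and>
          (\<exists>\<rho> \<in> hom (G\<lparr>carrier := K\<rparr>) (G\<lparr>carrier := H\<rparr>). \<forall>h\<in>H. \<rho> h = h))"

definition has_LR :: "('a, 'b) monoid_scheme \<Rightarrow> bool" where
  "has_LR G \<longleftrightarrow> (\<forall>S. finite S \<and> S \<subseteq> carrier G \<longrightarrow> virtual_retract G (generate G S))"

definition virtually_abelian :: "('a, 'b) monoid_scheme \<Rightarrow> bool" where
  "virtually_abelian G \<longleftrightarrow>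
     (\<exists>A. finite_index G A \<and> (\<forall>x\<in>A. \<forall>y\<in>A. x \<otimes>\<^bsub>G\<^esub> y = y \<otimes>\<^bsub>G\<^esub> x))"

definition lin_conj_up_to_sign :: "(complex \<Rightarrow> complex) \<Rightarrow> (complex \<Rightarrow> complex) \<Rightarrow> bool" where
  "lin_conj_up_to_sign f g \<longleftrightarrow>
     (\<exists>a b \<epsilon>. a \<noteq> 0 \<and> (\<epsilon> = 1 \<or> \<epsilon> = -1) \<and>
        (\<forall>w. a * f w + b = \<epsilon> * g (a * w + b)))"

end

theory Submission
  imports Defs
begin

text \<open>
  Write \<open>f(w) = a(w - c)\<^sup>2 + v\<close> and let \<open>p\<^sub>1 = v, \<dots>, p\<^sub>N\<close> be the post-critical points, \<open>f(p\<^sub>i) = p\<^sub>i\<^sub>+\<^sub>1\<close> and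
  \<open>f(p\<^sub>N) = p\<^sub>r\<close>. Condition (iii) means \<open>(r, N) = (1, 1)\<close> (powering map) or \<open>(r, N) = (2, 2)\<close> (Chebyshev map).

  In these two cases \<open>exp\<close> or \<open>cos\<close> conjugates \<open>f\<close> to doubling, so each loop translates or reflects the lattice that
  indexes the tree, and such a group has (LR) and is virtually abelian.

  In all other cases, lifting a tuple of lassos around the \<open>p\<^sub>i\<close> level by level gives a wreath recursion, and hence a
  subgroup of the iterated monodromy group generated by a kneading automaton; both properties pass to subgroups.
  This subgroup is weakly branch, which excludes virtual commutativity: commuting with large powers would kill
  the nontrivial rigid stabilisers. To refute (LR):

  \<^item> If \<open>c\<close> is periodic (\<open>r = 1\<close>), take \<open>D\<close> generated by the first generator, its commutators with the others, and a
    commutator \<open>l\<close> of two elements supported in a subtree, chosen such that \<open>D\<close> contains a nontrivial normal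
    subgroup \<open>M\<close> of the group. The kernel of a retraction onto \<open>D\<close> centralizes \<open>M\<close>, hence vanishes, so \<open>D\<close> would
    have finite index, contradicting the exponent sum of the second generator.

  \<^item> Otherwise take the cyclic group of the odometer (the product of all generators). A retraction kills commutators
    of elements of disjoint support, and a power of the odometer is a product of such commutators, although
    the odometer has infinite order.
\<close>

text \<open>The lassos produced by lifting are not the ones started from, so the labels of the
  automaton change from level to level: in place of one self-similar group there is a sequence
  \<open>G k\<close>, with the sections of \<open>G k\<close> in \<open>G (Suc k)\<close>.

  The two cases need different witnesses against (LR). If \<open>c\<close> is periodic, exponent
  sums are well defined on \<open>G k\<close> and can detect infinite index. Otherwise all
  generators are involutions and this invariant is lost; torsion takes its place. Let
  \<open>R\<close> be the group of elements that can be planted below every vertex of a given level,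
  and \<open>Y\<close> the commutator subgroup of \<open>R\<close> with the group \<open>G\<close>
  of that level. Then \<open>G\<close> modulo \<open>Y\<close> has exponent dividing
  \<open>4 * 2 ^ (r - 1)\<close>: the generators before the cycle contribute the power of two, those
  on the cycle are involutions whose commutators lie in \<open>R\<close>, which is central modulo
  \<open>Y\<close>. Hence this multiple of every odometer of the level falls into \<open>Y\<close>,
  and planted elements of \<open>Y\<close> are built from commutators that a retraction must
  kill.\<close>

section \<open>Finite index, and the passage of both properties to subgroups\<close>

lemma virtual_retractI:
  assumes "subgroup H G" "finite_index G K" "H \<subseteq> K"
    and "\<rho> \<in> hom (G\<lparr>carrier := K\<rparr>) (G\<lparr>carrier := H\<rparr>)" "\<forall>h\<in>H. \<rho> h = h"
  shows "virtual_retract G H"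
  unfolding virtual_retract_def using assms by (intro conjI exI[of _ K] bexI[of _ \<rho>])

text \<open>Pigeonhole: among the cosets \<open>K #> (x \<otimes> g [^] i)\<close> with
  \<open>i \<le> d\<close>, \<open>d\<close> being the index, two coincide, which puts
  \<open>x \<otimes> g [^] e \<otimes> inv x\<close> into \<open>K\<close> for some positive
  \<open>e \<le> d\<close>. As \<open>e\<close> divides \<open>fact d\<close>, one exponent serves
  all \<open>g\<close> and all conjugates at once.\<close>

lemma group_pow_coset_return:
  fixes G (structure)
  assumes "group G" and K: "finite_index G K"
  shows "\<exists>J>0. \<forall>g\<in>carrier G. \<forall>x\<in>carrier G. x \<otimes> g [^] (J::nat) \<otimes> inv x \<in> K"
proof -
  interpret group G by fact
  have sub: "subgroup K G" and fin: "finite (rcosets K)" using K unfolding finite_index_def by auto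
  define d where "d = card (rcosets K)"
  have "x \<otimes> g [^] (fact d :: nat) \<otimes> inv x \<in> K" if g: "g \<in> carrier G" and x: "x \<in> carrier G" for g x
  proof -
    let ?c = "\<lambda>i::nat. K #> (x \<otimes> g [^] i)"
    have im: "?c ` {0..d} \<subseteq> rcosets K"
    proof (intro image_subsetI)
      fix i :: nat
      have "x \<otimes> g [^] i \<in> carrier G" using g x by simp
      then show "?c i \<in> rcosets K" unfolding RCOSETS_def by blast
    qed
    have "\<not> inj_on ?c {0..d}"
    proof
      assume "inj_on ?c {0..d}"
      then have "card (?c ` {0..d}) = Suc d" by (simp add: card_image)
      moreover have "card (?c ` {0..d}) \<le> d" using card_mono[OF fin im] d_def by simp
      ultimately show False by simp
    qed
    then obtain i j where ij: "i < j" "j \<le> d" "?c i = ?c j"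
      unfolding inj_on_def by (metis atLeastAtMost_iff linorder_neqE_nat)
    define e where "e = j - i"
    have e: "0 < e" "e \<le> d" "j = e + i" using ij by (auto simp: e_def)
    have "x \<otimes> g [^] j \<in> K #> (x \<otimes> g [^] i)"
      using ij(3) rcos_self[OF _ sub, of "x \<otimes> g [^] j"] g x by simp
    then obtain k where k: "k \<in> K" "x \<otimes> g [^] j = k \<otimes> (x \<otimes> g [^] i)"
      unfolding r_coset_def by auto
    have kc: "k \<in> carrier G" using k sub subgroup.mem_carrier by metis
    have "x \<otimes> g [^] e \<otimes> inv x \<otimes> (x \<otimes> g [^] i) = x \<otimes> g [^] j"
      using g x by (simp add: e(3) nat_pow_mult[symmetric] m_assoc) (simp add: m_assoc[symmetric])
    also have "\<dots> = k \<otimes> (x \<otimes> g [^] i)" by (rule k)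
    finally have "x \<otimes> g [^] e \<otimes> inv x = k"
      using g x kc by (metis inv_closed m_closed nat_pow_closed right_cancel)
    then have 1: "x \<otimes> g [^] e \<otimes> inv x \<in> K" using k by simp
    have "e dvd fact d" using e by (simp add: dvd_fact)
    then obtain t where t: "fact d = e * t" by auto
    have pw: "(x \<otimes> h \<otimes> inv x) [^] (n::nat) = x \<otimes> h [^] n \<otimes> inv x" if h: "h \<in> carrier G" for h n
    proof (induction n)
      case 0
      then show ?case using x by simp
    next
      case (Suc n)
      then show ?case using x h by (simp add: m_assoc) (simp add: m_assoc[symmetric])
    qed
    have "(x \<otimes> g [^] e \<otimes> inv x) [^] t = x \<otimes> g [^] (fact d :: nat) \<otimes> inv x"
      using pw[of "g [^] e" t] g by (simp add: t nat_pow_pow)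
    moreover have "(x \<otimes> g [^] e \<otimes> inv x) [^] t \<in> K"
    proof (induction t)
      case 0
      then show ?case using subgroup.one_closed[OF sub] by simp
    next
      case (Suc t)
      then show ?case using 1 subgroup.m_closed[OF sub] by simp
    qed
    ultimately show ?thesis by simp
  qed
  then show ?thesis by (intro exI[of _ "fact d"]) auto
qed

lemma finite_index_preimage:
  assumes "group G" "group A" and h: "h \<in> hom A G" and K: "finite_index G K"
  shows "finite_index A {a \<in> carrier A. h a \<in> K}"
proof -
  interpret G: group G by fact
  interpret A: group A by fact
  interpret hh: group_hom A G h by unfold_locales (rule h)
  have sub: "subgroup K G" and fin: "finite (rcosets\<^bsub>G\<^esub> K)" using K unfolding finite_index_def by auto
  let ?K = "{a \<in> carrier A. h a \<in> K}"
  have subA: "subgroup ?K A"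
    using subgroup.m_closed[OF sub] subgroup.m_inv_closed[OF sub] subgroup.one_closed[OF sub]
    by unfold_locales auto
  have "rcosets\<^bsub>A\<^esub> ?K \<subseteq> (\<lambda>C. {a \<in> carrier A. h a \<in> C}) ` (rcosets\<^bsub>G\<^esub> K)"
  proof
    fix X assume "X \<in> rcosets\<^bsub>A\<^esub> ?K"
    then obtain a where a: "a \<in> carrier A" "X = ?K #>\<^bsub>A\<^esub> a" unfolding RCOSETS_def by auto
    have "X = {b \<in> carrier A. h b \<in> K #>\<^bsub>G\<^esub> h a}"
    proof (intro equalityI subsetI)
      fix b assume "b \<in> X"
      then obtain k where "k \<in> carrier A" "h k \<in> K" "b = k \<otimes>\<^bsub>A\<^esub> a" using a unfolding r_coset_def by auto
      then show "b \<in> {b \<in> carrier A. h b \<in> K #>\<^bsub>G\<^esub> h a}" using a unfolding r_coset_def by auto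
    next
      fix b assume "b \<in> {b \<in> carrier A. h b \<in> K #>\<^bsub>G\<^esub> h a}"
      then obtain k where k: "b \<in> carrier A" "k \<in> K" "h b = k \<otimes>\<^bsub>G\<^esub> h a" unfolding r_coset_def by auto
      have kc: "k \<in> carrier G" using k sub subgroup.mem_carrier by metis
      have "h (b \<otimes>\<^bsub>A\<^esub> inv\<^bsub>A\<^esub> a) = k" using k a kc by (simp add: G.m_assoc)
      then have "b \<otimes>\<^bsub>A\<^esub> inv\<^bsub>A\<^esub> a \<in> ?K" using k a by auto
      moreover have "b = (b \<otimes>\<^bsub>A\<^esub> inv\<^bsub>A\<^esub> a) \<otimes>\<^bsub>A\<^esub> a" using k a by (simp add: A.m_assoc)
      ultimately show "b \<in> X" using a unfolding r_coset_def by blast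
    qed
    moreover have "K #>\<^bsub>G\<^esub> h a \<in> rcosets\<^bsub>G\<^esub> K" using a unfolding RCOSETS_def by auto
    ultimately show "X \<in> (\<lambda>C. {a \<in> carrier A. h a \<in> C}) ` (rcosets\<^bsub>G\<^esub> K)" by auto
  qed
  then show ?thesis unfolding finite_index_def using subA fin finite_surj by blast
qed

text \<open>A retraction onto the image of \<open>H\<close> takes values in that image, where
  \<open>h\<close> can be inverted; composing the three maps gives a retraction onto
  \<open>H\<close> defined on the preimage of \<open>K\<close>.\<close>

lemma has_LR_inj_hom:
  assumes "group G" "group A" and h: "h \<in> hom A G" and inj: "inj_on h (carrier A)" and LR: "has_LR G"
  shows "has_LR A"
  unfolding has_LR_def
proof (intro allI impI)
  interpret G: group G by fact
  interpret A: group A by fact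
  interpret hh: group_hom A G h by unfold_locales (rule h)
  fix S assume S: "finite S \<and> S \<subseteq> carrier A"
  define H where "H = generate A S"
  have gi: "generate G (h ` S) = h ` H" unfolding H_def using hh.generate_img S by simp
  have Hsub: "subgroup H A" unfolding H_def using A.generate_is_subgroup S by simp
  have Hc: "H \<subseteq> carrier A" using Hsub subgroup.subset by blast
  have "virtual_retract G (h ` H)"
  proof -
    have "finite (h ` S) \<and> h ` S \<subseteq> carrier G" using S hh.hom_closed by auto
    then show ?thesis using LR gi unfolding has_LR_def by metis
  qed
  then obtain K \<rho> where K: "finite_index G K" "h ` H \<subseteq> K"
    and \<rho>: "\<rho> \<in> hom (G\<lparr>carrier := K\<rparr>) (G\<lparr>carrier := h ` H\<rparr>)" "\<forall>x\<in>h ` H. \<rho> x = x"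
    unfolding virtual_retract_def by auto
  let ?K = "{a \<in> carrier A. h a \<in> K}"
  let ?r = "\<lambda>a. inv_into (carrier A) h (\<rho> (h a))"
  have im: "\<exists>b\<in>H. \<rho> (h a) = h b" if "a \<in> ?K" for a
    using \<rho>(1) that unfolding hom_def by auto
  have r: "?r a \<in> H" "h (?r a) = \<rho> (h a)" if a: "a \<in> ?K" for a
  proof -
    obtain b where b: "b \<in> H" "\<rho> (h a) = h b" using im[OF a] by auto
    then have "?r a = b" using inj Hc by (simp add: inv_into_f_f subset_eq)
    then show "?r a \<in> H" "h (?r a) = \<rho> (h a)" using b by auto
  qed
  have "?r \<in> hom (A\<lparr>carrier := ?K\<rparr>) (A\<lparr>carrier := H\<rparr>)"
  proof (rule homI)
    fix x assume "x \<in> carrier (A\<lparr>carrier := ?K\<rparr>)"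
    then show "?r x \<in> carrier (A\<lparr>carrier := H\<rparr>)" using r by simp
  next
    fix x y assume "x \<in> carrier (A\<lparr>carrier := ?K\<rparr>)" "y \<in> carrier (A\<lparr>carrier := ?K\<rparr>)"
    then have x: "x \<in> ?K" and y: "y \<in> ?K" by auto
    have xy: "x \<otimes>\<^bsub>A\<^esub> y \<in> ?K" using x y K(1) subgroup.m_closed unfolding finite_index_def by fastforce
    have "h (?r (x \<otimes>\<^bsub>A\<^esub> y)) = \<rho> (h x \<otimes>\<^bsub>G\<^esub> h y)" using r(2)[OF xy] x y by simp
    also have "\<dots> = \<rho> (h x) \<otimes>\<^bsub>G\<^esub> \<rho> (h y)" using \<rho>(1) x y unfolding hom_def by auto
    also have "\<dots> = h (?r x \<otimes>\<^bsub>A\<^esub> ?r y)" using r x y Hc by (simp add: subset_eq)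
    finally have "?r (x \<otimes>\<^bsub>A\<^esub> y) = ?r x \<otimes>\<^bsub>A\<^esub> ?r y"
      using inj r(1)[OF x] r(1)[OF y] r(1)[OF xy] Hc unfolding inj_on_def by (meson A.m_closed subsetD)
    then show "?r (x \<otimes>\<^bsub>A\<lparr>carrier := ?K\<rparr>\<^esub> y) = ?r x \<otimes>\<^bsub>A\<lparr>carrier := H\<rparr>\<^esub> ?r y" by simp
  qed
  moreover have "\<forall>a\<in>H. ?r a = a" using \<rho>(2) Hc inj by (auto simp: inv_into_f_f subset_eq)
  moreover have "finite_index A ?K" by (rule finite_index_preimage) fact+
  moreover have "H \<subseteq> ?K" using K(2) Hc by auto
  ultimately show "virtual_retract A H" using Hsub by (intro virtual_retractI)
qed

lemma virtually_abelian_inj_hom: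
  assumes "group G" "group A" and h: "h \<in> hom A G" and inj: "inj_on h (carrier A)" and va: "virtually_abelian G"
  shows "virtually_abelian A"
proof -
  interpret G: group G by fact
  interpret A: group A by fact
  interpret hh: group_hom A G h by unfold_locales (rule h)
  obtain B where B: "finite_index G B" "\<forall>x\<in>B. \<forall>y\<in>B. x \<otimes>\<^bsub>G\<^esub> y = y \<otimes>\<^bsub>G\<^esub> x"
    using va unfolding virtually_abelian_def by auto
  have "x \<otimes>\<^bsub>A\<^esub> y = y \<otimes>\<^bsub>A\<^esub> x" if "x \<in> carrier A" "h x \<in> B" "y \<in> carrier A" "h y \<in> B" for x y
    using inj B(2) that unfolding inj_on_def by (metis A.m_closed hh.hom_mult)
  then show ?thesis unfolding virtually_abelian_def
    using finite_index_preimage[OF assms(1,2) h B(1)] by blast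
qed

section \<open>Groups that act by translations and reflections\<close>

text \<open>\<open>T g m\<close> says that \<open>g\<close> translates by \<open>m\<close>; all other elements of the group behave like reflections.\<close>

locale dihedral_like = group G for G (structure) +
  fixes T :: "'a \<Rightarrow> int \<Rightarrow> bool"
  assumes T_one: "T \<one> 0"
    and T_mult: "\<And>g h m n. \<lbrakk>g \<in> carrier G; h \<in> carrier G; T g m; T h n\<rbrakk> \<Longrightarrow> T (g \<otimes> h) (m + n)"
    and T_inv: "\<And>g m. \<lbrakk>g \<in> carrier G; T g m\<rbrakk> \<Longrightarrow> T (inv g) (- m)"
    and T_inj: "\<And>g h m. \<lbrakk>g \<in> carrier G; h \<in> carrier G; T g m; T h m\<rbrakk> \<Longrightarrow> g = h"
    and T_refl: "\<And>g h. \<lbrakk>g \<in> carrier G; h \<in> carrier G; \<nexists>m. T g m; \<nexists>m. T h m\<rbrakk> \<Longrightarrow> \<exists>m. T (g \<otimes> h) m"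
begin

definition trans where "trans = {g \<in> carrier G. \<exists>m. T g m}"

lemma trans_subgroup: "subgroup trans G"
  unfolding trans_def using T_one T_mult T_inv by unfold_locales blast+

lemma finite_indexI:
  assumes K: "subgroup K G" and "finite R" and cov: "\<And>g. g \<in> carrier G \<Longrightarrow> \<exists>r\<in>R. \<exists>k\<in>K. r \<in> carrier G \<and> g = k \<otimes> r"
  shows "finite_index G K"
proof -
  have "rcosets K \<subseteq> (\<lambda>r. K #> r) ` R"
  proof
    fix X assume "X \<in> rcosets K"
    then obtain g where g: "g \<in> carrier G" "X = K #> g" unfolding RCOSETS_def by auto
    obtain r k where r: "r \<in> R" "k \<in> K" "r \<in> carrier G" "g = k \<otimes> r" using cov[OF g(1)] by auto
    have "K #> g = K #> r"
      using r K repr_independence[of g K r] unfolding r_coset_def by blast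
    then show "X \<in> (\<lambda>r. K #> r) ` R" using g r by auto
  qed
  then show ?thesis unfolding finite_index_def using K \<open>finite R\<close> finite_surj by blast
qed

lemma nontrans_decomp:
  assumes s: "s \<in> carrier G" "s \<notin> trans" and g: "g \<in> carrier G" "g \<notin> trans"
  shows "\<exists>t\<in>trans. g = t \<otimes> s"
proof -
  have "inv s \<notin> trans" using s trans_subgroup subgroup.m_inv_closed by fastforce
  then have "g \<otimes> inv s \<in> trans" using T_refl[of g "inv s"] s g unfolding trans_def by auto
  moreover have "g = (g \<otimes> inv s) \<otimes> s" using s g by (simp add: m_assoc)
  ultimately show ?thesis by blast
qed

text \<open>The translations have index at most two, so representatives for them are enough: a
  single element \<open>s\<close> outside \<open>trans\<close>, if there is one, adds only the
  representatives \<open>r \<otimes> s\<close>.\<close>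

lemma trans_index:
  assumes H: "subgroup H G" and fin: "finite R" "R \<subseteq> carrier G"
    and cov: "\<And>g. g \<in> trans \<Longrightarrow> \<exists>r\<in>R. \<exists>k\<in>H. g = k \<otimes> r"
  shows "finite_index G H"
proof -
  have Hc: "H \<subseteq> carrier G" using H subgroup.subset by blast
  show ?thesis
  proof (cases "carrier G \<subseteq> trans")
    case True
    show ?thesis
      by (rule finite_indexI[OF H, of R]) (use fin cov True in blast)+
  next
    case False
    then obtain s where s: "s \<in> carrier G" "s \<notin> trans" by auto
    show ?thesis
    proof (rule finite_indexI[OF H, of "R \<union> (\<lambda>r. r \<otimes> s) ` R"])
      show "finite (R \<union> (\<lambda>r. r \<otimes> s) ` R)" using fin by simp
      fix g assume g: "g \<in> carrier G"
      show "\<exists>r\<in>R \<union> (\<lambda>r. r \<otimes> s) ` R. \<exists>k\<in>H. r \<in> carrier G \<and> g = k \<otimes> r"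
      proof (cases "g \<in> trans")
        case True
        then show ?thesis using cov fin by blast
      next
        case False
        then obtain t where t: "t \<in> trans" "g = t \<otimes> s" using nontrans_decomp[OF s g] by auto
        obtain r k where r: "r \<in> R" "k \<in> H" "t = k \<otimes> r" using cov[OF t(1)] by auto
        have "g = k \<otimes> (r \<otimes> s)" using t r fin s Hc by (simp add: m_assoc subset_eq)
        then show ?thesis using r fin s by (intro bexI[of _ "r \<otimes> s"] bexI[of _ k]) auto
      qed
    qed
  qed
qed

lemma virtually_abelian: "virtually_abelian G"
proof -
  have "finite_index G trans"
    by (rule trans_index[OF trans_subgroup, of "{\<one>}"]) (auto simp: trans_def)
  moreover have "x \<otimes> y = y \<otimes> x" if "x \<in> trans" "y \<in> trans" for x y
    using that T_inj[of "x \<otimes> y" "y \<otimes> x"] T_mult[of x y] T_mult[of y x] unfolding trans_def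
    by (smt (verit) mem_Collect_eq m_closed add.commute)
  ultimately show ?thesis unfolding virtually_abelian_def by blast
qed

lemma T_pow: "g \<in> carrier G \<Longrightarrow> T g m \<Longrightarrow> T (g [^] (n::nat)) (int n * m)"
proof (induction n)
  case 0
  then show ?case by (simp add: T_one)
next
  case (Suc n)
  have "T (g [^] n \<otimes> g) (int n * m + m)" by (rule T_mult) (use Suc in auto)
  then show ?case by (simp add: algebra_simps)
qed

lemma T_int_pow:
  assumes g: "g \<in> carrier G" "T g m"
  shows "T (g [^] (n::int)) (n * m)"
proof (cases n rule: int_cases2)
  case (nonneg k)
  then show ?thesis using T_pow[OF g, of k] by (simp add: int_pow_int)
next
  case (nonpos k)
  then show ?thesis using T_inv[OF _ T_pow[OF g, of k]] g by (simp add: int_pow_neg int_pow_int)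
qed

text \<open>Division with remainder by \<open>m\<close>: a power of \<open>h\<close> is split off
  and a translation by at most \<open>\<bar>m\<bar>\<close> in absolute value remains. A translation
  is determined by its amount, so each \<open>Q i\<close> has at most one element.\<close>

lemma finite_index_of_trans:
  assumes H: "subgroup H G" and h: "h \<in> H" "T h m" "m \<noteq> 0"
  shows "finite_index G H"
proof -
  have Hc: "H \<subseteq> carrier G" using H subgroup.subset by blast
  define Q where "Q = (\<lambda>i. {g \<in> carrier G. T g i})"
  have fin: "finite (Q i)" for i
  proof (cases "Q i = {}")
    case False
    then obtain g where "g \<in> Q i" by auto
    then have "Q i \<subseteq> {g}" using T_inj unfolding Q_def by blast
    then show ?thesis using finite_subset by auto
  qed simp
  show ?thesis
  proof (rule trans_index[OF H, of "\<Union>i\<in>{-\<bar>m\<bar>..\<bar>m\<bar>}. Q i"])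
    show "finite (\<Union>i\<in>{-\<bar>m\<bar>..\<bar>m\<bar>}. Q i)" using fin by simp
    show "(\<Union>i\<in>{-\<bar>m\<bar>..\<bar>m\<bar>}. Q i) \<subseteq> carrier G" unfolding Q_def by auto
    fix g assume "g \<in> trans"
    then obtain j where g: "g \<in> carrier G" "T g j" unfolding trans_def by auto
    define q where "q = j div m"
    have hc: "h \<in> carrier G" using h Hc by auto
    define k where "k = h [^] q"
    have k: "k \<in> H" "k \<in> carrier G" unfolding k_def
      using H h Hc hc by (auto intro: subgroup_int_pow_closed)
    have "T (inv k \<otimes> g) (- (q * m) + j)"
      using T_mult[OF _ _ T_inv] T_int_pow[OF hc h(2)] k g unfolding k_def by simp
    moreover have "- (q * m) + j = j mod m" unfolding q_def by (simp add: minus_div_mult_eq_mod)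
    moreover have "j mod m \<in> {-\<bar>m\<bar>..\<bar>m\<bar>}"
      using h(3) by (smt (verit) atLeastAtMost_iff neg_mod_bound neg_mod_sign pos_mod_bound pos_mod_sign)
    ultimately have "inv k \<otimes> g \<in> (\<Union>i\<in>{-\<bar>m\<bar>..\<bar>m\<bar>}. Q i)" unfolding Q_def using k g by auto
    moreover have "g = k \<otimes> (inv k \<otimes> g)" using k g by (simp add: m_assoc[symmetric])
    ultimately show "\<exists>r\<in>\<Union>i\<in>{-\<bar>m\<bar>..\<bar>m\<bar>}. Q i. \<exists>k\<in>H. g = k \<otimes> r" using k by blast
  qed
qed

text \<open>A subgroup of finite index is retracted onto by its own identity map. A subgroup of
  infinite index contains no nonzero translation, so it has at most two elements, and the whole
  group maps onto it: trivially, or by the parity that separates translations from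
  reflections.\<close>

lemma virtual_retract:
  assumes H: "subgroup H G"
  shows "virtual_retract G H"
proof (cases "finite_index G H")
  case True
  have "(\<lambda>x. x) \<in> hom (G\<lparr>carrier := H\<rparr>) (G\<lparr>carrier := H\<rparr>)" by (simp add: hom_def)
  then show ?thesis using H True by (intro virtual_retractI[of _ _ H "\<lambda>x. x"]) auto
next
  case False
  have one: "h = \<one>" if "h \<in> H" "h \<in> trans" for h
  proof -
    obtain m where "T h m" using \<open>h \<in> trans\<close> unfolding trans_def by auto
    then have "T h 0" using finite_index_of_trans[OF H \<open>h \<in> H\<close>] False by metis
    then show ?thesis using T_inj[of h \<one> 0] T_one that unfolding trans_def by auto
  qed
  have whole: "finite_index G (carrier G)"
    by (rule trans_index[OF subgroup_self, of "{\<one>}"]) (auto simp: trans_def)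
  have Hc: "H \<subseteq> carrier G" and oneH: "\<one> \<in> H" using H subgroup.subset subgroup.one_closed by blast+
  show ?thesis
  proof (cases "H \<subseteq> trans")
    case True
    have "(\<lambda>x. \<one>) \<in> hom (G\<lparr>carrier := carrier G\<rparr>) (G\<lparr>carrier := H\<rparr>)" using oneH by (simp add: hom_def)
    moreover have "\<forall>h\<in>H. \<one> = h" using one True by auto
    ultimately show ?thesis using H whole Hc by (intro virtual_retractI)
  next
    case False
    then obtain s where s: "s \<in> H" "s \<notin> trans" by auto
    have sc: "s \<in> carrier G" using s Hc by auto
    have tr_mult: "x \<otimes> y \<in> trans \<longleftrightarrow> (x \<in> trans \<longleftrightarrow> y \<in> trans)" if "x \<in> carrier G" "y \<in> carrier G" for x y
    proof -
      have a: "x \<otimes> y \<in> trans" if "x \<in> trans" "y \<in> trans" using that subgroup.m_closed[OF trans_subgroup] by auto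
      have b: "x \<otimes> y \<in> trans" if "x \<notin> trans" "y \<notin> trans"
        using that T_refl \<open>x \<in> _\<close> \<open>y \<in> _\<close> unfolding trans_def by auto
      have c: "y \<in> trans" if "x \<otimes> y \<in> trans" "x \<in> trans"
      proof -
        have "inv x \<otimes> (x \<otimes> y) \<in> trans"
          using that subgroup.m_closed[OF trans_subgroup] subgroup.m_inv_closed[OF trans_subgroup] by auto
        then show ?thesis using \<open>x \<in> carrier G\<close> \<open>y \<in> carrier G\<close> by (simp add: m_assoc[symmetric])
      qed
      have d: "x \<in> trans" if "x \<otimes> y \<in> trans" "y \<in> trans"
      proof -
        have "(x \<otimes> y) \<otimes> inv y \<in> trans"
          using that subgroup.m_closed[OF trans_subgroup] subgroup.m_inv_closed[OF trans_subgroup] by auto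
        then show ?thesis using \<open>x \<in> carrier G\<close> \<open>y \<in> carrier G\<close> by (simp add: m_assoc)
      qed
      show ?thesis using a b c d by blast
    qed
    have ss: "s \<otimes> s = \<one>"
      using tr_mult[OF sc sc] s subgroup.m_closed[OF H] one by auto
    have Hs: "h = s" if "h \<in> H" "h \<notin> trans" for h
    proof -
      have "h \<otimes> s = \<one>" using tr_mult[of h s] that s Hc subgroup.m_closed[OF H] one by auto
      then show ?thesis using that sc Hc ss by (metis right_cancel subsetD)
    qed
    let ?r = "\<lambda>x. if x \<in> trans then \<one> else s"
    have "?r \<in> hom (G\<lparr>carrier := carrier G\<rparr>) (G\<lparr>carrier := H\<rparr>)"
      unfolding hom_def using tr_mult ss sc s oneH by auto
    moreover have "\<forall>h\<in>H. ?r h = h" using one Hs by auto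
    ultimately show ?thesis using H whole Hc by (intro virtual_retractI)
  qed
qed

lemma has_LR: "has_LR G"
  unfolding has_LR_def using virtual_retract generate_is_subgroup by blast

end

section \<open>Subgroups in additive notation\<close>

text \<open>The class \<open>group_add\<close> does not assume commutativity. Additive notation
  makes its rewriting rules available for the automorphism group of the tree; \<open>gr\<close>
  leads back to the group structures in which (LR) is expressed.\<close>

definition subgp :: "'a::group_add set \<Rightarrow> bool" where
  "subgp S \<longleftrightarrow> 0 \<in> S \<and> (\<forall>x\<in>S. \<forall>y\<in>S. x + y \<in> S) \<and> (\<forall>x\<in>S. - x \<in> S)"

inductive_set gen :: "'a::group_add set \<Rightarrow> 'a set" for S where
  gen_zero: "0 \<in> gen S"
| gen_incl: "x \<in> S \<Longrightarrow> x \<in> gen S"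
| gen_add: "x \<in> gen S \<Longrightarrow> y \<in> gen S \<Longrightarrow> x + y \<in> gen S"
| gen_minus: "x \<in> gen S \<Longrightarrow> - x \<in> gen S"

definition cj :: "'a::group_add \<Rightarrow> 'a \<Rightarrow> 'a" where
  "cj g h = - h + g + h"

primrec mul :: "nat \<Rightarrow> 'a::monoid_add \<Rightarrow> 'a" where
  "mul 0 x = 0"
| "mul (Suc n) x = mul n x + x"

definition gr :: "'a::group_add set \<Rightarrow> 'a monoid" where
  "gr S = \<lparr>carrier = S, mult = (+), one = 0\<rparr>"

lemma subgpD: "subgp S \<Longrightarrow> 0 \<in> S" "subgp S \<Longrightarrow> x \<in> S \<Longrightarrow> y \<in> S \<Longrightarrow> x + y \<in> S"
  "subgp S \<Longrightarrow> x \<in> S \<Longrightarrow> - x \<in> S" "subgp S \<Longrightarrow> x \<in> S \<Longrightarrow> y \<in> S \<Longrightarrow> x - y \<in> S"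
  "subgp S \<Longrightarrow> x \<in> S \<Longrightarrow> y \<in> S \<Longrightarrow> cj x y \<in> S" "subgp S \<Longrightarrow> x \<in> S \<Longrightarrow> mul n x \<in> S"
proof -
  assume S: "subgp S"
  show m: "x \<in> S \<Longrightarrow> y \<in> S \<Longrightarrow> x - y \<in> S"
    using S unfolding subgp_def by (metis diff_conv_add_uminus)
  show "x \<in> S \<Longrightarrow> mul n x \<in> S" using S unfolding subgp_def by (induction n) auto
qed (auto simp: subgp_def cj_def)

lemma subgp_gen: "subgp (gen S)"
  unfolding subgp_def by (auto intro: gen.intros)

lemma gen_least: "subgp T \<Longrightarrow> S \<subseteq> T \<Longrightarrow> gen S \<subseteq> T"
proof
  fix x assume "subgp T" "S \<subseteq> T" "x \<in> gen S"
  from this(3) show "x \<in> T" by induction (use \<open>subgp T\<close> \<open>S \<subseteq> T\<close> in \<open>auto simp: subgp_def\<close>)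
qed

lemma cj_simps: "cj 0 h = 0" "cj g 0 = g" "cj (a + b) h = cj a h + cj b h" "cj (- a) h = - cj a h"
  "cj (cj a g) h = cj a (g + h)" "cj a a = a"
  unfolding cj_def by (simp_all add: add.assoc minus_add diff_conv_add_uminus del: add_uminus_conv_diff)

lemma cj_cancel: "cj (cj a h) (- h) = a" "cj (cj a (- h)) h = a"
  by (simp_all add: cj_simps)

lemma cj_mul: "cj (mul n a) h = mul n (cj a h)"
  by (induction n) (simp_all add: cj_simps)

lemma cj_eq_iff: "cj a b = a \<longleftrightarrow> a + b = b + a"
  unfolding cj_def by (metis add.assoc add_minus_cancel minus_add_cancel)

lemma mul_comm: "x + y = y + x \<Longrightarrow> mul n x + y = y + mul n x" for x y :: "'a::group_add"
  by (induction n) (simp_all add: add.assoc, metis add.assoc)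

lemma mul_add: "mul (m + n) x = mul m x + mul n (x::'a::group_add)"
  by (induction n) (simp_all add: add.assoc[symmetric])

lemma mul_mult: "mul (m * n) x = mul m (mul n (x::'a::group_add))"
  by (induction m) (simp_all add: mul_add add.commute[of n])

lemma mul_distrib: "x + y = y + x \<Longrightarrow> mul n (x + y) = mul n x + mul n (y::'a::group_add)"
proof (induction n)
  case (Suc n)
  have "mul n y + x = x + mul n y" using mul_comm[of y x n] Suc(2) by simp
  then show ?case using Suc by (simp add: add.assoc) (metis add.assoc)
qed simp

lemma mul_minus: "mul n (- x) = - mul n (x::'a::group_add)"
proof (induction n)
  case (Suc n)
  have "mul n (- x) + - x = - x + mul n (- x)" by (rule mul_comm) simp
  then show ?case using Suc by (simp add: minus_add)
qed simp

lemma group_gr: "subgp S \<Longrightarrow> group (gr S)"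
proof (rule groupI)
  fix x assume "subgp S" "x \<in> carrier (gr S)"
  then show "\<exists>y\<in>carrier (gr S). y \<otimes>\<^bsub>gr S\<^esub> x = \<one>\<^bsub>gr S\<^esub>"
    by (intro bexI[of _ "- x"]) (auto simp: gr_def subgp_def)
qed (auto simp: gr_def subgp_def add.assoc)

lemma gr_simps: "carrier (gr S) = S" "x \<otimes>\<^bsub>gr S\<^esub> y = x + y" "\<one>\<^bsub>gr S\<^esub> = 0"
  by (simp_all add: gr_def)

lemma gr_inv: "subgp S \<Longrightarrow> x \<in> S \<Longrightarrow> inv\<^bsub>gr S\<^esub> x = - x"
  by (rule group.inv_equality[OF group_gr]) (auto simp: gr_def subgp_def)

lemma gr_pow: "x [^]\<^bsub>gr S\<^esub> (n::nat) = mul n x"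
proof (induction n)
  case 0
  then show ?case by (simp add: nat_pow_def gr_def)
next
  case (Suc n)
  then show ?case by (simp add: nat_pow_def gr_def)
qed

lemma gr_subgroup: "subgp S \<Longrightarrow> subgroup K (gr S) \<longleftrightarrow> subgp K \<and> K \<subseteq> S"
proof
  assume S: "subgp S" and K: "subgroup K (gr S)"
  have KS: "K \<subseteq> S" using subgroup.subset[OF K] by (simp add: gr_def)
  moreover have "- x \<in> K" if "x \<in> K" for x
    using subgroup.m_inv_closed[OF K that] gr_inv[OF S] KS that by auto
  ultimately show "subgp K \<and> K \<subseteq> S"
    using subgroup.one_closed[OF K] subgroup.m_closed[OF K] unfolding subgp_def by (auto simp: gr_def)
next
  assume S: "subgp S" and K: "subgp K \<and> K \<subseteq> S"
  show "subgroup K (gr S)"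
    using K gr_inv[OF S] unfolding subgp_def by unfold_locales (auto simp: gr_def subset_eq)
qed

lemma gr_generate:
  assumes S: "subgp S" and T: "T \<subseteq> S" shows "generate (gr S) T = gen T"
proof
  have "x \<in> gen T" if "x \<in> generate (gr S) T" for x
    using that
  proof induction
    case one then show ?case by (simp add: gr_simps gen_zero)
  next
    case (inv h) then show ?case using gr_inv[OF S, of h] T by (metis gen_incl gen_minus subsetD)
  qed (auto simp: gr_simps intro: gen.intros)
  then show "generate (gr S) T \<subseteq> gen T" by auto
  have sg: "subgroup (generate (gr S) T) (gr S)"
    using group.generate_is_subgroup[OF group_gr[OF S]] T by (simp add: gr_simps)
  show "gen T \<subseteq> generate (gr S) T"
    by (rule gen_least) (use sg gr_subgroup[OF S] generate.incl in auto)
qed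

text \<open>\<open>K0\<close> is the normal core of \<open>K\<close>. The common exponent of the
  pigeonhole argument also covers conjugates, so the multiples \<open>mul J g\<close> lie in the
  core and not merely in \<open>K\<close>.\<close>

lemma gr_core:
  assumes S: "subgp S" and K: "finite_index (gr S) K"
  obtains J K0 where "J > 0" "K0 \<subseteq> K" "subgp K0" "\<And>k g. k \<in> K0 \<Longrightarrow> g \<in> S \<Longrightarrow> cj k g \<in> K0"
    "\<And>g. g \<in> S \<Longrightarrow> mul J g \<in> K0"
proof -
  obtain J :: nat where J: "J > 0" "\<And>g x. g \<in> S \<Longrightarrow> x \<in> S \<Longrightarrow> x + mul J g + - x \<in> K"
    using group_pow_coset_return[OF group_gr[OF S] K] by (auto simp: gr_simps gr_pow gr_inv[OF S])
  have Ks: "subgp K" "K \<subseteq> S" using K gr_subgroup[OF S] unfolding finite_index_def by auto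
  define K0 where "K0 = {k. \<forall>g\<in>S. cj k g \<in> K}"
  show ?thesis
  proof
    show "J > 0" by fact
    show "K0 \<subseteq> K"
    proof
      fix k assume "k \<in> K0"
      then have "cj k 0 \<in> K" using subgpD(1)[OF S] unfolding K0_def by blast
      then show "k \<in> K" by (simp only: cj_simps(2))
    qed
    show "subgp K0" unfolding subgp_def K0_def mem_Collect_eq
    proof (intro conjI ballI)
      show "cj 0 g \<in> K" for g using subgpD(1)[OF Ks(1)] by (simp only: cj_simps(1))
      show "cj (x + y) g \<in> K" if "x \<in> {k. \<forall>g\<in>S. cj k g \<in> K}" "y \<in> {k. \<forall>g\<in>S. cj k g \<in> K}" "g \<in> S" for x y g
        using that subgpD(2)[OF Ks(1)] by (simp only: cj_simps(3) mem_Collect_eq)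
      show "cj (- x) g \<in> K" if "x \<in> {k. \<forall>g\<in>S. cj k g \<in> K}" "g \<in> S" for x g
        using that subgpD(3)[OF Ks(1)] by (simp only: cj_simps(4) mem_Collect_eq)
    qed
    show "cj k g \<in> K0" if "k \<in> K0" "g \<in> S" for k g
      using that subgpD(2)[OF S \<open>g \<in> S\<close>] unfolding K0_def by (simp only: cj_simps(5) mem_Collect_eq) blast
    show "mul J g \<in> K0" if "g \<in> S" for g
    proof -
      have "cj (mul J g) x \<in> K" if "x \<in> S" for x
        using J(2)[OF \<open>g \<in> S\<close>, of "- x"] that subgpD(3)[OF S] by (simp add: cj_def)
      then show ?thesis unfolding K0_def by simp
    qed
  qed
qed

section \<open>Automorphisms of the binary tree\<close>

definition tree_aut :: "(bool list \<Rightarrow> bool list) \<Rightarrow> bool" where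
  "tree_aut f \<longleftrightarrow> inj f \<and> (\<forall>w. length (f w) = length w) \<and> (\<forall>n w. take n (f w) = f (take n w))"

text \<open>Each level is finite and mapped injectively into itself, so surjectivity holds level by
  level.\<close>

lemma tree_aut_bij: "tree_aut f \<Longrightarrow> bij f"
proof -
  assume f: "tree_aut f"
  have "\<exists>v. f v = w" for w
  proof -
    let ?L = "{v::bool list. length v = length w}"
    have fin: "finite ?L" using finite_lists_length_eq[of "UNIV::bool set" "length w"] by simp
    have "f ` ?L \<subseteq> ?L" "inj_on f ?L" using f unfolding tree_aut_def by (auto intro: inj_on_subset)
    then have "f ` ?L = ?L" using fin by (simp add: endo_inj_surj)
    moreover have "w \<in> ?L" by simp
    ultimately show ?thesis by (metis imageE)
  qed
  then show ?thesis using f unfolding tree_aut_def bij_def surj_def by metis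
qed

typedef taut = "{f. tree_aut f}" morphisms app Abs_taut
  by (rule exI[of _ id]) (simp add: tree_aut_def)

lemma tree_aut_app: "tree_aut (app f)"
  using app by auto

lemma app_length [simp]: "length (app f w) = length w"
  using tree_aut_app[of f] unfolding tree_aut_def by auto

lemma app_take: "take n (app f w) = app f (take n w)"
  using tree_aut_app[of f] unfolding tree_aut_def by auto

lemma app_inj [simp]: "app f v = app f w \<longleftrightarrow> v = w"
  using tree_aut_app[of f] unfolding tree_aut_def by (auto dest: injD)

lemma app_Nil [simp]: "app f [] = []"
  by (metis app_length length_0_conv)

lemma taut_eqI: "(\<And>w. app f w = app g w) \<Longrightarrow> f = g"
  using app_inject[of f g] by auto

lemma tree_aut_comp: "tree_aut f \<Longrightarrow> tree_aut g \<Longrightarrow> tree_aut (f \<circ> g)"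
  unfolding tree_aut_def by (auto intro: inj_compose)

lemma tree_aut_inv: assumes f: "tree_aut f" shows "tree_aut (inv_into UNIV f)"
proof -
  have b: "bij f" using tree_aut_bij[OF f] .
  have l: "length (inv_into UNIV f w) = length w" for w
    using f b unfolding tree_aut_def by (metis bij_inv_eq_iff)
  have "take n (inv_into UNIV f w) = inv_into UNIV f (take n w)" for n w
    using f b unfolding tree_aut_def by (metis bij_inv_eq_iff)
  then show ?thesis using l b unfolding tree_aut_def by (auto simp: bij_imp_bij_inv bij_is_inj)
qed

instantiation taut :: group_add
begin

definition "0 = Abs_taut id"
text \<open>The sum applies \<open>f\<close> first, in agreement with the right action of loops,
  where the first loop acts first.\<close>

definition "f + g = Abs_taut (app g \<circ> app f)"
definition "- f = Abs_taut (inv_into UNIV (app f))"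
definition "f - g = f + - (g::taut)"

lemma app_zero [simp]: "app 0 w = w"
  unfolding zero_taut_def by (subst Abs_taut_inverse) (simp_all add: tree_aut_def)

lemma app_plus [simp]: "app (f + g) w = app g (app f w)"
  unfolding plus_taut_def by (subst Abs_taut_inverse) (auto simp: tree_aut_app tree_aut_comp)

lemma app_uminus: "app (- f) = inv_into UNIV (app f)"
  unfolding uminus_taut_def by (subst Abs_taut_inverse) (auto simp: tree_aut_app tree_aut_inv)

lemma app_uminus_app [simp]: "app (- f) (app f w) = w"
  unfolding app_uminus by (simp add: bij_is_inj[OF tree_aut_bij[OF tree_aut_app]])

instance
proof
  fix a b c :: taut
  show "a + b + c = a + (b + c)" by (rule taut_eqI) simp
  show "0 + a = a" by (rule taut_eqI) simp
  show "a + 0 = a" by (rule taut_eqI) simp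
  show "- a + a = 0"
  proof (rule taut_eqI)
    fix w obtain v where "w = app a v" using tree_aut_bij[OF tree_aut_app, of a] by (metis bij_pointE)
    then show "app (- a + a) w = app 0 w" by simp
  qed
  show "a + - b = a - b" by (simp add: minus_taut_def)
qed

end

lemma app_app_uminus [simp]: "app f (app (- f) w) = w"
  by (metis app_plus app_zero left_minus)

text \<open>The section (or state) of \<open>f\<close> at \<open>y\<close> in the language of
  self-similar groups: the action of \<open>f\<close> from the subtree below \<open>y\<close> to the
  one below \<open>app f y\<close>, both identified with the whole tree.\<close>

definition sec :: "taut \<Rightarrow> bool list \<Rightarrow> taut" where
  "sec f y = Abs_taut (\<lambda>w. drop (length y) (app f (y @ w)))"

lemma app_split: "app f (y @ w) = app f y @ drop (length y) (app f (y @ w))"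
  by (metis app_take append_eq_conv_conj append_take_drop_id)

lemma app_append: "app f (y @ w) = app f y @ app (sec f y) w"
proof -
  have "tree_aut (\<lambda>w. drop (length y) (app f (y @ w)))"
    unfolding tree_aut_def
  proof (intro conjI allI injI)
    fix v w assume "drop (length y) (app f (y @ v)) = drop (length y) (app f (y @ w))"
    then have "app f (y @ v) = app f (y @ w)" by (metis app_split)
    then show "v = w" by simp
  next
    fix n w
    show "take n (drop (length y) (app f (y @ w))) = drop (length y) (app f (y @ take n w))"
      using app_take[of "length y + n" f "y @ w"] by (simp add: take_drop add.commute)
  qed simp
  then have "app (sec f y) w = drop (length y) (app f (y @ w))"
    unfolding sec_def by (subst Abs_taut_inverse) auto
  then show ?thesis using app_split by simp
qed

lemma sec_unique: "(\<And>w. app f (y @ w) = app f y @ app g w) \<Longrightarrow> sec f y = g"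
  by (rule taut_eqI) (metis app_append same_append_eq)

lemma sec_Nil [simp]: "sec f [] = f"
  by (rule sec_unique) simp

lemma sec_plus: "sec (f + g) y = sec f y + sec g (app f y)"
  by (rule sec_unique) (metis app_plus app_append)

lemma sec_append: "sec f (y @ z) = sec (sec f y) z"
  by (rule sec_unique) (metis app_append append_assoc)

lemma sec_zero [simp]: "sec 0 y = 0"
  by (rule sec_unique) simp

lemma sec_minus: "sec (- f) (app f y) = - sec f y"
  by (metis add_eq_0_iff2 add.right_inverse sec_plus sec_zero neg_eq_iff_add_eq_0)


definition swap :: taut where
  "swap = Abs_taut (\<lambda>w. case w of [] \<Rightarrow> [] | b # v \<Rightarrow> (\<not> b) # v)"

definition node :: "taut \<Rightarrow> taut \<Rightarrow> taut" where
  "node a b = Abs_taut (\<lambda>w. case w of [] \<Rightarrow> [] | c # v \<Rightarrow> c # app (if c then b else a) v)"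

lemma app_swap [simp]: "app swap (b # w) = (\<not> b) # w"
proof -
  have "tree_aut (\<lambda>w. case w of [] \<Rightarrow> [] | b # v \<Rightarrow> (\<not> b) # v)"
    unfolding tree_aut_def
  proof (intro conjI allI injI)
    fix n :: nat and w :: "bool list"
    show "take n (case w of [] \<Rightarrow> [] | b # v \<Rightarrow> (\<not> b) # v) = (case take n w of [] \<Rightarrow> [] | b # v \<Rightarrow> (\<not> b) # v)"
      by (cases n; cases w) auto
  qed (auto split: list.splits)
  then show ?thesis unfolding swap_def by (subst Abs_taut_inverse) auto
qed

lemma app_node [simp]: "app (node a b) (c # w) = c # app (if c then b else a) w"
proof -
  have "tree_aut (\<lambda>w. case w of [] \<Rightarrow> [] | c # v \<Rightarrow> c # app (if c then b else a) v)"
    unfolding tree_aut_def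
  proof (intro conjI allI injI)
    fix n :: nat and w :: "bool list"
    show "take n (case w of [] \<Rightarrow> [] | c # v \<Rightarrow> c # app (if c then b else a) v) = (case take n w of [] \<Rightarrow> [] | c # v \<Rightarrow> c # app (if c then b else a) v)"
      by (cases n; cases w) (auto simp: app_take)
  qed (auto split: list.splits if_splits)
  then show ?thesis unfolding node_def by (subst Abs_taut_inverse) auto
qed

lemma taut_eqI_Cons: "(\<And>c w. app f (c # w) = app g (c # w)) \<Longrightarrow> f = g"
  by (rule taut_eqI) (metis app_Nil neq_Nil_conv)

lemma node_plus: "node a b + node a' b' = node (a + a') (b + b')"
  by (rule taut_eqI_Cons) simp

lemma node_zero: "node 0 0 = 0"
  by (rule taut_eqI_Cons) simp

lemma node_minus: "- node a b = node (- a) (- b)"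
  by (metis node_plus node_zero left_minus add.right_inverse minus_unique)

lemma swap_swap: "swap + swap = 0"
  by (rule taut_eqI_Cons) simp

lemma swap_minus: "- swap = swap"
  using swap_swap by (simp add: minus_unique)

lemma swap_node: "swap + node a b = node b a + swap"
  by (rule taut_eqI_Cons) simp

lemma swap_swap': "swap + (swap + x) = x"
  by (simp add: swap_swap flip: add.assoc)

lemma swap_node': "swap + (node a b + x) = node b a + (swap + x)"
  by (simp add: swap_node flip: add.assoc)

lemma node_plus': "node a b + (node a' b' + x) = node (a + a') (b + b') + x"
  by (simp add: node_plus flip: add.assoc)

text \<open>A normal form for sums of \<open>node\<close> and \<open>swap\<close>: swaps travel to
  the right, where pairs cancel, and adjacent nodes merge.\<close>

lemmas wreath = add.assoc node_plus node_plus' node_zero node_minus swap_swap swap_swap' swap_node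
  swap_node' swap_minus minus_add

lemma node_inject: "node a b = node a' b' \<longleftrightarrow> a = a' \<and> b = b'"
proof
  assume eq: "node a b = node a' b'"
  have "app a w = app a' w" for w using arg_cong[OF eq, of "\<lambda>f. app f (False # w)"] by simp
  moreover have "app b w = app b' w" for w using arg_cong[OF eq, of "\<lambda>f. app f (True # w)"] by simp
  ultimately show "a = a' \<and> b = b'" by (auto intro: taut_eqI)
qed simp

lemma node_eq_zero: "node a b = 0 \<longleftrightarrow> a = 0 \<and> b = 0"
  using node_inject[of a b 0 0] by (simp add: node_zero)

lemma node_swap_neq: "node a b + swap \<noteq> node a' b'"
proof
  assume eq: "node a b + swap = node a' b'"
  show False using arg_cong[OF eq, of "\<lambda>f. app f [False]"] by simp
qed

text \<open>This is the decomposition of the automorphism group as a wreath product with the group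
  of order two: the letter to which \<open>False\<close> is sent decides whether a swap occurs, and
  the sections at the two letters are the coordinates.\<close>

lemma taut_cases:
  obtains a b where "f = node a b" | a b where "f = node a b + swap"
proof -
  obtain c where c: "app f [False] = [c]" using app_length[of f "[False]"] by (cases "app f [False]") auto
  have d: "app f [True] = [\<not> c]"
  proof -
    obtain d where "app f [True] = [d]" using app_length[of f "[True]"] by (cases "app f [True]") auto
    moreover have "app f [True] \<noteq> app f [False]" by simp
    ultimately show ?thesis using c by auto
  qed
  have F: "app f (False # w) = c # app (sec f [False]) w" for w
    using app_append[of f "[False]" w] c by simp
  have T: "app f (True # w) = (\<not> c) # app (sec f [True]) w" for w
    using app_append[of f "[True]" w] d by simp
  have "f = (if c then node (sec f [False]) (sec f [True]) + swap else node (sec f [False]) (sec f [True]))"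
  proof (rule taut_eqI_Cons)
    fix b w show "app f (b # w) = app (if c then node (sec f [False]) (sec f [True]) + swap else node (sec f [False]) (sec f [True])) (b # w)"
      by (cases b; cases c) (simp_all add: F T)
  qed
  then show ?thesis using that by (metis (full_types))
qed

lemma sec_node: "sec (node a b) [c] = (if c then b else a)"
  by (rule sec_unique) simp

lemma sec_node_swap: "sec (node a b + swap) [c] = (if c then b else a)"
  by (rule sec_unique) simp

lemma sec_Cons: "sec f (c # y) = sec (sec f [c]) y"
  using sec_append[of f "[c]" y] by simp

text \<open>Plants \<open>u\<close> in the subtree below the given vertex and fixes everything else;
  these elements form the rigid stabiliser of the vertex.\<close>

primrec rig :: "bool list \<Rightarrow> taut \<Rightarrow> taut" where
  "rig [] u = u"
| "rig (c # y) u = (if c then node 0 (rig y u) else node (rig y u) 0)"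

lemma rig_append: "rig (y @ z) u = rig y (rig z u)"
  by (induction y) auto

lemma rig_plus: "rig y (u + v) = rig y u + rig y v"
  by (induction y) (auto simp: node_plus)

lemma rig_zero [simp]: "rig y 0 = 0"
  by (induction y) (auto simp: node_zero)

lemma rig_minus: "rig y (- u) = - rig y u"
  by (induction y) (auto simp: node_minus)

lemma rig_cj: "rig y (cj u v) = cj (rig y u) (rig y v)"
  by (simp add: cj_def rig_plus rig_minus)

lemma rig_inject: "rig y u = rig y v \<longleftrightarrow> u = v"
  by (induction y) (auto simp: node_inject)

lemma rig_eq_zero: "rig y u = 0 \<longleftrightarrow> u = 0"
  using rig_inject[of y u 0] by simp

lemma app_rig: "app (rig y u) (y @ w) = y @ app u w"
  by (induction y) auto

lemma app_rig_other: "(\<nexists>v. w = y @ v) \<Longrightarrow> app (rig y u) w = w"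
proof (induction y arbitrary: w)
  case (Cons c y)
  then show ?case
  proof (cases w)
    case (Cons d v)
    then show ?thesis using Cons.IH[of v] Cons.prems by (cases c; cases d) auto
  qed simp
qed simp

text \<open>Words outside the subtree below \<open>app g y\<close> come from words outside the
  subtree below \<open>y\<close>, where \<open>rig y u\<close> is the identity; inside, the section
  of \<open>g\<close> does the conjugation. This reduces the commutator computations with planted
  elements to a comparison of vertices.\<close>

lemma cj_rig: "cj (rig y u) g = rig (app g y) (cj u (sec g y))"
proof (rule taut_eqI)
  fix w
  define v where "v = app (- g) w"
  have w: "w = app g v" by (simp add: v_def)
  show "app (cj (rig y u) g) w = app (rig (app g y) (cj u (sec g y))) w"
  proof (cases "\<exists>v'. v = y @ v'")
    case True
    then obtain v' where v': "v = y @ v'" by auto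
    have "app (cj (rig y u) g) w = app g (y @ app u v')"
      unfolding cj_def w v' by (simp add: app_rig)
    also have "\<dots> = app g y @ app (sec g y) (app u v')" by (rule app_append)
    also have "\<dots> = app (rig (app g y) (cj u (sec g y))) (app g y @ app (sec g y) v')"
      by (simp add: app_rig cj_def)
    also have "app g y @ app (sec g y) v' = w" unfolding w v' by (rule app_append[symmetric])
    finally show ?thesis .
  next
    case False
    have "\<nexists>v'. w = app g y @ v'"
    proof
      assume "\<exists>v'. w = app g y @ v'"
      then have "take (length y) w = app g y" by auto
      then have "app g (take (length y) v) = app g y" unfolding w by (simp add: app_take)
      then have "take (length y) v = y" by simp
      then show False using False by (metis append_take_drop_id)
    qed
    then have "app (rig (app g y) (cj u (sec g y))) w = w" by (rule app_rig_other)
    moreover have "app (cj (rig y u) g) w = w"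
      unfolding cj_def w using app_rig_other[OF False] by simp
    ultimately show ?thesis by simp
  qed
qed

lemma app_rig_level: "length y = length y' \<Longrightarrow> y \<noteq> y' \<Longrightarrow> app (rig y u) (y' @ w) = y' @ w"
  by (rule app_rig_other) auto

lemma sec_rig_other: "length y = length y' \<Longrightarrow> y \<noteq> y' \<Longrightarrow> sec (rig y u) y' = 0"
  by (rule sec_unique) (use app_rig_level[of y y' u "[]"] app_rig_level in auto)

lemma rig_commute: "length y = length y' \<Longrightarrow> y \<noteq> y' \<Longrightarrow> rig y u + rig y' v = rig y' v + rig y u"
  using cj_rig[of y u "rig y' v"] app_rig_level[of y' y v "[]"] sec_rig_other[of y' y v] cj_eq_iff
  by (metis append_Nil2 cj_simps(2))

lemma rig_neq: "length y = length y' \<Longrightarrow> y \<noteq> y' \<Longrightarrow> u \<noteq> 0 \<Longrightarrow> rig y u \<noteq> rig y' v"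
proof
  assume l: "length y = length y'" "y \<noteq> y'" "u \<noteq> 0" and eq: "rig y u = rig y' v"
  have "app u w = w" for w
    using arg_cong[OF eq, of "\<lambda>f. app f (y @ w)"] app_rig_level[of y' y v w] l by (simp add: app_rig)
  then have "u = 0" by (auto intro: taut_eqI)
  then show False using l by simp
qed

lemma nonzero_moves: "f \<noteq> 0 \<Longrightarrow> \<exists>y. app f y \<noteq> y"
  by (metis app_zero taut_eqI)

lemma moves_append: "app f y \<noteq> y \<Longrightarrow> app f (y @ z) \<noteq> y @ z"
  by (metis app_length app_append append_eq_append_conv)

text \<open>Take the shortest prefix of \<open>y\<close> that is moved. Its parent is fixed, and
  since the tree is binary its last letter can only be exchanged.\<close>

lemma first_swap:
  assumes "app f y \<noteq> y"
  obtains q c z where "y = q @ c # z" "app f q = q" "app f (q @ [c]) = q @ [\<not> c]"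
proof -
  have "\<exists>q c z. y = q @ c # z \<and> app f q = q \<and> app f (q @ [c]) = q @ [\<not> c]"
    using assms
  proof (induction y rule: rev_induct)
    case (snoc c y)
    show ?case
    proof (cases "app f y = y")
      case True
      have "app f (y @ [c]) = y @ app (sec f y) [c]" using app_append[of f y "[c]"] True by simp
      moreover obtain d where "app (sec f y) [c] = [d]"
        using app_length[of "sec f y" "[c]"] by (cases "app (sec f y) [c]") auto
      ultimately have "app f (y @ [c]) = y @ [\<not> c]" using snoc.prems by (cases c; cases d) auto
      then show ?thesis using True by blast
    next
      case False
      then show ?thesis using snoc.IH by fastforce
    qed
  qed simp
  then show ?thesis using that by blast
qed

section \<open>Groups of kneading automata\<close>

text \<open>The action of the loop around the \<open>i\<close>-th post-critical point \<open>p\<^sub>i\<close> on the words that label the tree above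
  level \<open>k\<close>; \<open>\<epsilon> k i\<close> tells which of the two lifts surrounds \<open>p\<^sub>i\<^sub>-\<^sub>1\<close>, and \<open>f p\<^sub>N = p\<^sub>r\<close>.\<close>

fun knead :: "nat \<Rightarrow> nat \<Rightarrow> (nat \<Rightarrow> nat \<Rightarrow> bool) \<Rightarrow> nat \<Rightarrow> nat \<Rightarrow> bool list \<Rightarrow> bool list" where
  "knead N r \<epsilon> k i [] = []"
| "knead N r \<epsilon> k i (b # w) =
    (if i = 1 then (\<not> b) # (if b \<and> r = 1 then knead N r \<epsilon> (Suc k) N w else w)
     else b # (if b = \<epsilon> k i then knead N r \<epsilon> (Suc k) (i - 1) w
               else if i = r then knead N r \<epsilon> (Suc k) N w else w))"

lemma knead_length [simp]: "length (knead N r \<epsilon> k i w) = length w"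
  by (induction N r \<epsilon> k i w rule: knead.induct) auto

lemma knead_inject: "length v = length w \<Longrightarrow> knead N r \<epsilon> k i v = knead N r \<epsilon> k i w \<Longrightarrow> v = w"
proof (induction v w arbitrary: k i rule: list_induct2)
  case (Cons a v b w)
  then show ?case by (auto split: if_splits)
qed simp

lemma knead_take: "take n (knead N r \<epsilon> k i w) = knead N r \<epsilon> k i (take n w)"
proof (induction w arbitrary: k i n)
  case (Cons b w)
  then show ?case by (cases n) auto
qed simp

lemma tree_aut_knead: "tree_aut (knead N r \<epsilon> k i)"
  unfolding tree_aut_def
proof (intro conjI allI injI)
  fix v w assume e: "knead N r \<epsilon> k i v = knead N r \<epsilon> k i w"
  then have "length v = length w" by (metis knead_length)
  then show "v = w" using e by (rule knead_inject)
qed (auto simp: knead_take)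

locale kneading =
  fixes N r :: nat and \<epsilon> :: "nat \<Rightarrow> nat \<Rightarrow> bool"
  assumes r1: "1 \<le> r" and rN: "r \<le> N"
begin

definition per :: bool where "per \<longleftrightarrow> r = Suc 0"

definition g :: "nat \<Rightarrow> nat \<Rightarrow> taut" where "g k i = Abs_taut (knead N r \<epsilon> k i)"

definition G :: "nat \<Rightarrow> taut set" where "G k = gen (g k ` {1..N})"

text \<open>The square of the loop around the critical value \<open>p\<^sub>1\<close> lifts to a
  loop around \<open>c\<close>. This is a post-critical point only if \<open>c\<close> is periodic,
  and then it is \<open>p\<^sub>N\<close>.\<close>

definition h1 :: "nat \<Rightarrow> taut" where "h1 k = (if per then g (Suc k) N else 0)"

text \<open>The preimage of \<open>p\<^sub>i\<close> other than the predecessor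
  \<open>p\<^sub>i\<^sub>-\<^sub>1\<close>: it is post-critical only for \<open>i = r\<close>, where
  it is \<open>p\<^sub>N\<close>.\<close>

definition sib :: "nat \<Rightarrow> nat \<Rightarrow> taut" where "sib k i = (if i = r then g (Suc k) N else 0)"

lemma app_g: "app (g k i) w = knead N r \<epsilon> k i w"
  unfolding g_def by (subst Abs_taut_inverse) (auto simp: tree_aut_knead)

lemma app_h1: "app (h1 k) w = (if per then knead N r \<epsilon> (Suc k) N w else w)"
  by (simp add: h1_def app_g)

lemma app_sib: "app (sib k i) w = (if i = r then knead N r \<epsilon> (Suc k) N w else w)"
  by (simp add: sib_def app_g)

lemma g_one: "g k 1 = node 0 (h1 k) + swap"
  by (rule taut_eqI_Cons) (simp add: app_g app_h1 per_def[symmetric])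

lemma g_other: "i \<noteq> 1 \<Longrightarrow> g k i = (if \<epsilon> k i then node (sib k i) (g (Suc k) (i - 1)) else node (g (Suc k) (i - 1)) (sib k i))"
  by (rule taut_eqI_Cons) (simp add: app_g app_sib)

lemma subgp_G: "subgp (G k)"
  unfolding G_def by (rule subgp_gen)

lemmas G_intros = subgpD[OF subgp_G]

lemma g_in_G: "1 \<le> i \<Longrightarrow> i \<le> N \<Longrightarrow> g k i \<in> G k"
  unfolding G_def by (auto intro: gen_incl)

lemma h1_in_G: "h1 k \<in> G (Suc k)"
  unfolding h1_def using g_in_G[of N "Suc k"] r1 rN G_intros(1) by auto

lemma sib_in_G: "sib k i \<in> G (Suc k)"
  unfolding sib_def using g_in_G[of N "Suc k"] r1 rN G_intros(1) by auto

lemma G_split: "x \<in> G k \<Longrightarrow> \<exists>a\<in>G (Suc k). \<exists>b\<in>G (Suc k). x = node a b \<or> x = node a b + swap"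
proof -
  let ?W = "{x. \<exists>a\<in>G (Suc k). \<exists>b\<in>G (Suc k). x = node a b \<or> x = node a b + swap}"
  have "subgp ?W"
    unfolding subgp_def
  proof (intro conjI ballI)
    show "0 \<in> ?W" using G_intros(1)[of "Suc k"] node_zero by force
    fix x assume "x \<in> ?W"
    then obtain a b where x: "a \<in> G (Suc k)" "b \<in> G (Suc k)" "x = node a b \<or> x = node a b + swap" by auto
    have "- x = node (- a) (- b) \<or> - x = node (- b) (- a) + swap" using x(3) by (auto simp: wreath)
    then show "- x \<in> ?W" using x G_intros(3)[of _ "Suc k"] by blast
    fix y assume "y \<in> ?W"
    then obtain c d where y: "c \<in> G (Suc k)" "d \<in> G (Suc k)" "y = node c d \<or> y = node c d + swap" by auto
    have "x + y = node (a + c) (b + d) \<or> x + y = node (a + d) (b + c) \<or> x + y = node (a + c) (b + d) + swap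
      \<or> x + y = node (a + d) (b + c) + swap"
      using x(3) y(3) by (auto simp: wreath)
    then show "x + y \<in> ?W" using x y G_intros(2)[of _ "Suc k"] by blast
  qed
  moreover have "g k ` {1..N} \<subseteq> ?W"
  proof (clarify)
    fix i assume i: "i \<in> {1..N}"
    show "\<exists>a\<in>G (Suc k). \<exists>b\<in>G (Suc k). g k i = node a b \<or> g k i = node a b + swap"
    proof (cases "i = 1")
      case True
      then show ?thesis using g_one h1_in_G G_intros(1)[of "Suc k"] by blast
    next
      case False
      then have "g (Suc k) (i - 1) \<in> G (Suc k)" using i g_in_G by auto
      then show ?thesis using g_other[OF False, of k] sib_in_G[of k i] by (metis (full_types))
    qed
  qed
  ultimately have "G k \<subseteq> ?W" unfolding G_def by (rule gen_least)
  then show "x \<in> G k \<Longrightarrow> ?thesis" by blast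
qed

lemma G_sec1: "x \<in> G k \<Longrightarrow> sec x [c] \<in> G (Suc k)"
  using G_split[of x k] by (auto simp: sec_node sec_node_swap)

lemma G_sec: "x \<in> G k \<Longrightarrow> sec x y \<in> G (k + length y)"
proof (induction y arbitrary: x k)
  case (Cons c y)
  then show ?case using Cons.IH[OF G_sec1[OF Cons.prems, of c]] by (simp add: sec_Cons[of x c y])
qed simp

lemma G_node: "node a b \<in> G k \<Longrightarrow> a \<in> G (Suc k) \<and> b \<in> G (Suc k)"
  using G_sec1[of "node a b" k False] G_sec1[of "node a b" k True] by (simp add: sec_node)

lemma cj_node: "cj (node a b) (node c d) = node (cj a c) (cj b d)"
  by (simp add: cj_def wreath diff_conv_add_uminus del: add_uminus_conv_diff)

lemma cj_node_g1: "cj (node a b) (g k 1) = node (cj b (h1 k)) a"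
  by (simp add: cj_def g_one[unfolded One_nat_def] wreath diff_conv_add_uminus del: add_uminus_conv_diff)

lemma cj_node_g1': "cj (node a b) (- g k 1) = node b (cj a (- h1 k))"
  by (simp add: cj_def g_one[unfolded One_nat_def] wreath diff_conv_add_uminus del: add_uminus_conv_diff)

lemma g_in_G1: "g k 1 \<in> G k"
  using g_in_G r1 rN by simp

lemma G_flip: assumes "node a b \<in> G k" shows "node (cj b (h1 k)) a \<in> G k" "node b (cj a (- h1 k)) \<in> G k"
proof -
  show "node (cj b (h1 k)) a \<in> G k"
    using G_intros(5)[OF assms g_in_G1] by (simp only: cj_node_g1)
  show "node b (cj a (- h1 k)) \<in> G k"
    using G_intros(5)[OF assms G_intros(3)[OF g_in_G1]] by (simp only: cj_node_g1')
qed

text \<open>The generator \<open>g (Suc k) j\<close> is a section of \<open>g k (j + 1)\<close> if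
  \<open>j < N\<close>. For \<open>j = N\<close> it is a section of \<open>g k r\<close>, or of the
  square of \<open>g k 1\<close> when \<open>r = 1\<close>.\<close>

lemma lift_gen:
  assumes "1 \<le> j" "j \<le> N" shows "\<exists>a b. a = g (Suc k) j \<and> (node a b \<in> G k \<or> node b a \<in> G k)"
proof (cases "j = N \<and> per")
  case True
  have "g k 1 + g k 1 = node (h1 k) (h1 k)" by (simp add: g_one[unfolded One_nat_def] wreath)
  then have "node (h1 k) (h1 k) \<in> G k" using G_intros(2)[OF g_in_G1 g_in_G1] by metis
  then show ?thesis using True by (auto simp: h1_def)
next
  case False
  have "\<exists>i. 1 < i \<and> i \<le> N \<and> (i - 1 = j \<or> i = r \<and> j = N)"
  proof (cases "j = N")
    case True
    then show ?thesis using False r1 rN by (intro exI[of _ r]) (auto simp: per_def)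
  next
    case F: False
    then show ?thesis using assms by (intro exI[of _ "Suc j"]) auto
  qed
  then obtain i where i: "1 < i" "i \<le> N" "i - 1 = j \<or> i = r \<and> j = N" by blast
  have gi: "g k i \<in> G k" using i g_in_G by auto
  then have "node (sib k i) (g (Suc k) (i - 1)) \<in> G k \<or> node (g (Suc k) (i - 1)) (sib k i) \<in> G k"
    using g_other[of i k] i by (metis less_irrefl)
  then show ?thesis using i(3) by (auto simp: sib_def)
qed

text \<open>The group is self-replicating: a stabiliser of a vertex of the first level projects onto
  all of the next group. Conjugation by \<open>g k 1\<close> exchanges the halves, so it does not
  matter in which half a generator turns up.\<close>

lemma lift1: "a \<in> G (Suc k) \<Longrightarrow> (\<exists>b. node a b \<in> G k) \<and> (\<exists>b. node b a \<in> G k)"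
proof -
  let ?A = "{a. \<exists>b. node a b \<in> G k}"
  have "subgp ?A"
    unfolding subgp_def
  proof (intro conjI ballI)
    have "node 0 0 \<in> G k" using G_intros(1)[of k] by (simp only: node_zero)
    then show "0 \<in> ?A" by blast
    fix x assume "x \<in> ?A"
    then obtain b where b: "node x b \<in> G k" by auto
    then show "- x \<in> ?A" using G_intros(3)[OF b] by (auto simp: node_minus)
    fix y assume "y \<in> ?A"
    then obtain c where "node y c \<in> G k" by auto
    then show "x + y \<in> ?A" using G_intros(2)[OF b, of "node y c"] by (auto simp: node_plus)
  qed
  moreover have "g (Suc k) ` {1..N} \<subseteq> ?A"
  proof clarify
    fix j assume "j \<in> {1..N}"
    then obtain b where "node (g (Suc k) j) b \<in> G k \<or> node b (g (Suc k) j) \<in> G k" using lift_gen[of j k] by auto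
    then show "\<exists>b. node (g (Suc k) j) b \<in> G k" using G_flip(2) by blast
  qed
  ultimately have "G (Suc k) \<subseteq> ?A" unfolding G_def[of "Suc k"] by (rule gen_least)
  then show "a \<in> G (Suc k) \<Longrightarrow> ?thesis" using G_flip(1) by blast
qed

lemma lift1_at: "a \<in> G (Suc k) \<Longrightarrow> \<exists>x\<in>G k. app x [c] = [c] \<and> sec x [c] = a"
proof -
  assume "a \<in> G (Suc k)"
  then obtain b b' where b: "node a b \<in> G k" "node b' a \<in> G k" using lift1 by blast
  show ?thesis
  proof (cases c)
    case True
    then show ?thesis using b by (intro bexI[of _ "node b' a"]) (auto simp: sec_node)
  next
    case False
    then show ?thesis using b by (intro bexI[of _ "node a b"]) (auto simp: sec_node)
  qed
qed

lemma lift: "a \<in> G (k + length y) \<Longrightarrow> \<exists>x\<in>G k. app x y = y \<and> sec x y = a"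
proof (induction y arbitrary: k)
  case (Cons c y)
  have "a \<in> G (Suc k + length y)" using Cons.prems by simp
  then obtain x where x: "x \<in> G (Suc k)" "app x y = y" "sec x y = a" using Cons.IH[of "Suc k"] by blast
  obtain x' where x': "x' \<in> G k" "app x' [c] = [c]" "sec x' [c] = x" using lift1_at[OF x(1), of c] by auto
  have "app x' (c # y) = c # y" using app_append[of x' "[c]" y] x x' by simp
  moreover have "sec x' (c # y) = a" using sec_Cons[of x' c y] x x' by simp
  ultimately show ?case using x' by blast
qed auto

lemma transitive: "length y = length y' \<Longrightarrow> \<exists>x\<in>G k. app x y = y'"
proof (induction y y' arbitrary: k rule: list_induct2)
  case Nil
  then show ?case using G_intros(1) by auto
next
  case (Cons c y c' y')
  obtain s where s: "s \<in> G k" "app s [c] = [c']"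
  proof (cases "c = c'")
    case True
    then show ?thesis using that[of 0] G_intros(1) by auto
  next
    case False
    have "app (g k 1) [c] = [c']" using False by (cases c; cases c') (auto simp: app_g)
    then show ?thesis using that g_in_G1 by blast
  qed
  obtain a where a: "a \<in> G (Suc k)" "app a y = y'" using Cons.IH by blast
  have "a - sec s [c] \<in> G (Suc k)" using a G_sec1[OF s(1)] G_intros(4) by blast
  then obtain x where x: "x \<in> G k" "app x [c] = [c]" "sec x [c] = a - sec s [c]" using lift1_at by blast
  have "app (x + s) (c # y) = c' # y'"
  proof -
    have "app (x + s) ([c] @ y) = app (x + s) [c] @ app (sec (x + s) [c]) y" by (rule app_append)
    also have "sec (x + s) [c] = a" by (simp add: sec_plus x)
    finally show ?thesis using x s a by simp
  qed
  moreover have "x + s \<in> G k" using x s G_intros(2) by blast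
  ultimately show ?case by blast
qed

lemma mover:
  assumes "length y = length y'" "a \<in> G (k + length y)"
  shows "\<exists>x\<in>G k. app x y = y' \<and> sec x y = a"
proof -
  obtain s where s: "s \<in> G k" "app s y = y'" using transitive[OF assms(1)] by blast
  have "a - sec s y \<in> G (k + length y)" using assms G_sec[OF s(1)] G_intros(4) by blast
  then obtain x where x: "x \<in> G k" "app x y = y" "sec x y = a - sec s y" using lift by blast
  show ?thesis using x s G_intros(2)[OF x(1) s(1)] by (intro bexI[of _ "x + s"]) (auto simp: sec_plus)
qed

definition R :: "nat \<Rightarrow> nat \<Rightarrow> taut set" where
  "R k m = {u. \<forall>y. length y = m \<longrightarrow> rig y u \<in> G k}"

lemma sec_rig: "sec (rig y u) y = u"
  by (rule sec_unique) (metis app_rig app_Nil append_Nil2)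

text \<open>Two vertices of a level are joined by an element whose section there is
  \<open>0\<close>; conjugating by it moves the planted element without altering it. Membership at
  one vertex thus gives membership at all vertices of its level.\<close>

lemma rig_in_R: "rig y u \<in> G k \<Longrightarrow> u \<in> R k (length y)"
proof -
  assume u: "rig y u \<in> G k"
  have "rig y' u \<in> G k" if l: "length y' = length y" for y'
  proof -
    obtain x where x: "x \<in> G k" "app x y = y'" "sec x y = 0"
      using mover[OF l[symmetric] G_intros(1)] by blast
    have "cj (rig y u) x = rig y' u" using x by (simp add: cj_rig cj_simps)
    then show ?thesis using G_intros(5)[OF u x(1)] by simp
  qed
  then show ?thesis unfolding R_def by blast
qed

lemma R_D: "u \<in> R k (length y) \<Longrightarrow> rig y u \<in> G k"
  unfolding R_def by simp

lemma R_sub_G: "u \<in> R k m \<Longrightarrow> u \<in> G (k + m)"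
proof -
  assume "u \<in> R k m"
  then have "rig (replicate m False) u \<in> G k" unfolding R_def by simp
  from G_sec[OF this, where y = "replicate m False"] show ?thesis by (simp add: sec_rig)
qed

lemma subgp_R: "subgp (R k m)"
  unfolding subgp_def R_def using G_intros(1-3) by (auto simp: rig_plus rig_minus)

lemma R_normal: assumes "u \<in> R k m" "v \<in> G (k + m)" shows "cj u v \<in> R k m"
proof -
  let ?y = "replicate m False"
  obtain x where x: "x \<in> G k" "app x ?y = ?y" "sec x ?y = v" using lift[of v k ?y] assms(2) by auto
  have "rig ?y (cj u v) \<in> G k"
    using G_intros(5)[OF R_D[where k=k and u=u and y="?y"] x(1)] assms(1) x by (simp add: cj_rig)
  then show ?thesis using rig_in_R by fastforce
qed

text \<open>Weakly branch.\<close>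

definition wb :: "nat \<Rightarrow> bool" where
  "wb k \<longleftrightarrow> (\<forall>m. \<exists>u\<in>R k m. u \<noteq> 0)"

definition nrm :: "nat \<Rightarrow> taut set \<Rightarrow> bool" where
  "nrm k M \<longleftrightarrow> subgp M \<and> M \<subseteq> G k \<and> (\<forall>x\<in>M. \<forall>y\<in>G k. cj x y \<in> M)"

text \<open>If \<open>u\<close> moves the vertex \<open>v\<close>, conjugation by \<open>u\<close>
  carries anything planted at \<open>v\<close> to a different vertex, so it cannot commute with
  \<open>u\<close>.\<close>

lemma R_noncommuting:
  assumes "wb k" shows "\<exists>t\<in>R k m. \<exists>t'\<in>R k m. cj t t' \<noteq> t"
proof -
  obtain u where u: "u \<in> R k m" "u \<noteq> 0" using assms unfolding wb_def by blast
  obtain v where v: "app u v \<noteq> v" using nonzero_moves[OF u(2)] by blast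
  obtain s where s: "s \<in> R k (m + length v)" "s \<noteq> 0" using assms unfolding wb_def by blast
  define t where "t = rig v s"
  have "rig (replicate m False @ v) s \<in> G k" using s(1) unfolding R_def by simp
  then have "rig (replicate m False) t \<in> G k" by (simp add: t_def rig_append)
  then have t: "t \<in> R k m" using rig_in_R by fastforce
  have "cj t u = rig (app u v) (cj s (sec u v))" unfolding t_def by (rule cj_rig)
  then have "cj t u \<noteq> t" unfolding t_def using rig_neq[of v "app u v" s] v s(2) by (metis app_length)
  then show ?thesis using t u by blast
qed

text \<open>The double commutator argument. For \<open>n'\<close> in \<open>M\<close> that moves
  \<open>z1\<close>, the commutator of \<open>T\<close>, planted at \<open>z1\<close>, with
  \<open>n'\<close> is \<open>- T\<close> together with a conjugate \<open>U\<close> of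
  \<open>T\<close> living elsewhere. A second commutator with \<open>T'\<close>, planted at
  \<open>z1\<close>, removes \<open>U\<close> and leaves the commutator of \<open>t\<close> and
  \<open>t'\<close> planted below \<open>y\<close>, still in \<open>M\<close>.\<close>

lemma normal_rigid:
  assumes wb: "wb k" and M: "nrm k M" and n: "n \<in> M" "n \<noteq> 0"
  shows "\<exists>t. t \<noteq> 0 \<and> rig y t \<in> M"
proof -
  have Ms: "subgp M" "M \<subseteq> G k" and Mc: "\<And>x g. x \<in> M \<Longrightarrow> g \<in> G k \<Longrightarrow> cj x g \<in> M"
    using M unfolding nrm_def by auto
  obtain y0 where y0: "app n y0 \<noteq> y0" using nonzero_moves[OF n(2)] by blast
  \<comment> \<open>Both words have the same length, one extending the moved vertex
    \<open>y0\<close> and the other extending \<open>y\<close>; transitivity then provides a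
    conjugate of \<open>n\<close> that moves a vertex below \<open>y\<close>.\<close>
  define z0 where "z0 = y0 @ y"
  define z1 where "z1 = y @ y0"
  have "length z0 = length z1" by (simp add: z0_def z1_def)
  then obtain x where x: "x \<in> G k" "app x z0 = z1" using transitive by blast
  define n' where "n' = cj n x"
  have n': "n' \<in> M" using Mc n x n'_def by blast
  have mz: "app n' z1 \<noteq> z1"
  proof
    assume "app n' z1 = z1"
    then have "app x (app n z0) = app x z0" unfolding n'_def cj_def using x(2) by (metis app_plus app_uminus_app)
    then show False using moves_append[OF y0, of y] by (simp add: z0_def)
  qed
  obtain t t' where t: "t \<in> R k (length z1)" "t' \<in> R k (length z1)" "cj t t' \<noteq> t"
    using R_noncommuting[OF wb] by blast
  define T where "T = rig z1 t"
  define T' where "T' = rig z1 t'"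
  have TG: "T \<in> G k" "T' \<in> G k" using t R_D T_def T'_def by auto
  define U where "U = cj T n'"
  have UT': "cj U T' = U"
  proof -
    have "U = rig (app n' z1) (cj t (sec n' z1))" unfolding U_def T_def by (rule cj_rig)
    then show ?thesis unfolding T'_def cj_eq_iff using rig_commute[of "app n' z1" z1] mz by simp
  qed
  define e where "e = - T + U"
  have "e = cj (- n') T + n'" unfolding e_def U_def cj_def by (simp add: add.assoc diff_conv_add_uminus del: add_uminus_conv_diff)
  then have e: "e \<in> M" using Mc[OF subgpD(3)[OF Ms(1) n'] TG(1)] subgpD(2)[OF Ms(1) _ n'] by simp
  have "cj e T' - e \<in> M" using Mc[OF e TG(2)] e subgpD(4)[OF Ms(1)] by blast
  moreover have "cj e T' - e = rig z1 (- cj t t' + t)"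
    unfolding e_def by (simp add: cj_simps UT'[unfolded T'_def] T_def T'_def rig_plus rig_minus rig_cj minus_add add.assoc diff_conv_add_uminus del: add_uminus_conv_diff)
  moreover have "- cj t t' + t \<noteq> 0" using t(3) by (metis add.right_neutral add_minus_cancel)
  ultimately have "rig y (rig y0 (- cj t t' + t)) \<in> M" "rig y0 (- cj t t' + t) \<noteq> 0"
    by (auto simp: z1_def rig_append rig_eq_zero)
  then show ?thesis by blast
qed

text \<open>If \<open>c\<close> moves \<open>y\<close>, it carries an element of \<open>M\<close>
  planted at \<open>y\<close> to a different vertex and so fails to centralise it.\<close>

lemma centralizer_trivial:
  assumes "\<And>y. \<exists>t. t \<noteq> 0 \<and> rig y t \<in> M" and "\<And>x. x \<in> M \<Longrightarrow> cj x c = x"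
  shows "c = 0"
proof (rule ccontr)
  assume "c \<noteq> 0"
  then obtain y where y: "app c y \<noteq> y" using nonzero_moves by blast
  obtain t where t: "t \<noteq> 0" "rig y t \<in> M" using assms(1) by blast
  have "cj (rig y t) c = rig (app c y) (cj t (sec c y))" by (rule cj_rig)
  then show False using assms(2)[OF t(2)] rig_neq[of y "app c y" t] y t by auto
qed

lemma not_virtually_abelian:
  assumes wb: "wb k" and b: "b \<in> G k" "\<And>n. n > 0 \<Longrightarrow> mul n b \<noteq> 0"
  shows "\<not> virtually_abelian (gr (G k))"
proof
  assume "virtually_abelian (gr (G k))"
  then obtain A where A: "finite_index (gr (G k)) A" "\<And>x y. x \<in> A \<Longrightarrow> y \<in> A \<Longrightarrow> x + y = y + x"
    unfolding virtually_abelian_def by (auto simp: gr_simps)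
  obtain J K0 where K0: "J > 0" "K0 \<subseteq> A" "subgp K0" "\<And>k' g. k' \<in> K0 \<Longrightarrow> g \<in> G k \<Longrightarrow> cj k' g \<in> K0"
    "\<And>g. g \<in> G k \<Longrightarrow> mul J g \<in> K0" using gr_core[OF subgp_G A(1)] by metis
  have "A \<subseteq> G k" using A(1) gr_subgroup[OF subgp_G] unfolding finite_index_def by auto
  then have nr: "nrm k K0" unfolding nrm_def using K0 by auto
  define n where "n = mul J b"
  have n: "n \<in> K0" "n \<noteq> 0" using K0 b n_def by auto
  have "n = 0"
  proof (rule centralizer_trivial)
    show "\<exists>t. t \<noteq> 0 \<and> rig y t \<in> K0" for y using normal_rigid[OF wb nr n] .
    show "cj x n = x" if "x \<in> K0" for x using A(2)[of x n] that n K0(2) cj_eq_iff by blast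
  qed
  then show False using n by simp
qed

end

section \<open>Retractions, commutators and conjugacy classes in additive notation\<close>

definition retr :: "'a::group_add set \<Rightarrow> 'a set \<Rightarrow> 'a set \<Rightarrow> ('a \<Rightarrow> 'a) \<Rightarrow> bool" where
  "retr S D K \<rho> \<longleftrightarrow> finite_index (gr S) K \<and> subgp K \<and> K \<subseteq> S \<and> D \<subseteq> K \<and>
    (\<forall>x\<in>K. \<forall>y\<in>K. \<rho> (x + y) = \<rho> x + \<rho> y) \<and> (\<forall>x\<in>K. \<rho> (- x) = - \<rho> x) \<and> (\<forall>x\<in>K. \<rho> x \<in> D) \<and> (\<forall>x\<in>D. \<rho> x = x)"

lemma retrD:
  assumes "retr S D K \<rho>"
  shows "finite_index (gr S) K" "subgp K" "K \<subseteq> S" "D \<subseteq> K"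
    "\<And>x y. x \<in> K \<Longrightarrow> y \<in> K \<Longrightarrow> \<rho> (x + y) = \<rho> x + \<rho> y" "\<And>x. x \<in> K \<Longrightarrow> \<rho> (- x) = - \<rho> x"
    "\<And>x. x \<in> K \<Longrightarrow> \<rho> x \<in> D" "\<And>x. x \<in> D \<Longrightarrow> \<rho> x = x"
  using assms unfolding retr_def by blast+

lemma gr_LR_retract:
  assumes S: "subgp S" and LR: "has_LR (gr S)" and T: "finite T" "T \<subseteq> S"
  shows "\<exists>K \<rho>. retr S (gen T) K \<rho>"
proof -
  have "virtual_retract (gr S) (gen T)"
    using LR T gr_generate[OF S T(2)] unfolding has_LR_def by (auto simp: gr_simps)
  then obtain K \<rho> where K: "finite_index (gr S) K" "gen T \<subseteq> K"
    and \<rho>: "\<rho> \<in> hom ((gr S)\<lparr>carrier := K\<rparr>) ((gr S)\<lparr>carrier := gen T\<rparr>)" "\<forall>h\<in>gen T. \<rho> h = h"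
    unfolding virtual_retract_def by auto
  have Ks: "subgp K" "K \<subseteq> S" using K gr_subgroup[OF S] unfolding finite_index_def by auto
  have add: "\<rho> (x + y) = \<rho> x + \<rho> y" if "x \<in> K" "y \<in> K" for x y
    using \<rho>(1) that unfolding hom_def gr_def by auto
  have zero: "\<rho> 0 = 0" using \<rho>(2) gen_zero by blast
  have "\<rho> (- x) = - \<rho> x" if "x \<in> K" for x
    using add[of x "- x"] that subgpD(3)[OF Ks(1)] zero by (simp add: minus_unique)
  moreover have "\<rho> x \<in> gen T" if "x \<in> K" for x
    using \<rho>(1) that unfolding hom_def gr_def by auto
  ultimately show ?thesis unfolding retr_def using K Ks add \<rho>(2) by (intro exI[of _ K] exI[of _ \<rho>]) simp
qed

definition comm :: "'a::group_add \<Rightarrow> 'a \<Rightarrow> 'a" where "comm a b = - a + cj a b"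

lemma comm_zero [simp]: "comm 0 b = 0" "comm a 0 = 0"
  by (simp_all add: comm_def cj_simps)

lemma comm_eq_zero: "comm a b = 0 \<longleftrightarrow> cj a b = a"
  unfolding comm_def by (metis add.right_neutral add_minus_cancel left_minus)

lemma comm_node: "comm (node a b) (node c d) = node (comm a c) (comm b d)"
  by (simp add: comm_def cj_def wreath diff_conv_add_uminus del: add_uminus_conv_diff)

context kneading
begin

lemma comm_in_G: "a \<in> G k \<Longrightarrow> b \<in> G k \<Longrightarrow> comm a b \<in> G k"
  unfolding comm_def using G_intros(2,3,5) by blast

definition Lam :: "nat \<Rightarrow> nat \<Rightarrow> taut set" where "Lam k i = (\<lambda>h. cj (g k i) h) ` G k"

lemma Lam_cj: "x \<in> Lam k i \<Longrightarrow> h \<in> G k \<Longrightarrow> cj x h \<in> Lam k i"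
  unfolding Lam_def using G_intros(2) by (auto simp: cj_simps(5))

lemma g_in_Lam: "g k i \<in> Lam k i"
  unfolding Lam_def using G_intros(1)[of k] cj_simps(2) by (metis image_eqI)

lemma Lam_in_G: "1 \<le> i \<Longrightarrow> i \<le> N \<Longrightarrow> x \<in> Lam k i \<Longrightarrow> x \<in> G k"
  unfolding Lam_def using g_in_G G_intros(5) by blast

lemma Lam_flip:
  assumes "node a b \<in> Lam k i" shows "node (cj b (h1 k)) a \<in> Lam k i" "node b (cj a (- h1 k)) \<in> Lam k i"
  using Lam_cj[OF assms g_in_G1] Lam_cj[OF assms G_intros(3)[OF g_in_G1]]
  by (simp_all only: cj_node_g1 cj_node_g1')

end

section \<open>The periodic case\<close>

locale periodic_kneading = kneading +
  assumes per: per and N2: "2 \<le> N"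
begin

lemma h1_per: "h1 k = g (Suc k) N"
  by (simp add: h1_def per)

lemma sib_per: "i \<noteq> 1 \<Longrightarrow> sib k i = 0"
  using per unfolding per_def sib_def by (metis One_nat_def)

text \<open>Some word in the generators with exponent sums \<open>e\<close> has the value
  \<open>x\<close>. This has to be a relation at first, because an element has many words; that the
  exponent sums depend on the element alone is \<open>ex_unique\<close>.\<close>

inductive ex :: "nat \<Rightarrow> taut \<Rightarrow> (nat \<Rightarrow> int) \<Rightarrow> bool" where
  ex_zero: "ex k 0 (\<lambda>_. 0)"
| ex_plus: "ex k x e \<Longrightarrow> 1 \<le> i \<Longrightarrow> i \<le> N \<Longrightarrow> ex k (x + g k i) (e(i := e i + 1))"
| ex_minus: "ex k x e \<Longrightarrow> 1 \<le> i \<Longrightarrow> i \<le> N \<Longrightarrow> ex k (x - g k i) (e(i := e i - 1))"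

lemma ex_add: "ex k y e' \<Longrightarrow> ex k x e \<Longrightarrow> ex k (x + y) (\<lambda>j. e j + e' j)"
proof (induction rule: ex.induct)
  case (ex_zero k)
  then show ?case by simp
next
  case (ex_plus k y e' i)
  have "(\<lambda>j. e j + (e'(i := e' i + 1)) j) = (\<lambda>j. e j + e' j)(i := (e i + e' i) + 1)" by auto
  then show ?case using ex.ex_plus[OF ex_plus.IH[OF ex_plus.prems] ex_plus.hyps(2,3)] by (simp only: add.assoc)
next
  case (ex_minus k y e' i)
  have "(\<lambda>j. e j + (e'(i := e' i - 1)) j) = (\<lambda>j. e j + e' j)(i := (e i + e' i) - 1)" by auto
  moreover have "x + (y - g k i) = x + y - g k i" by (simp add: add_diff_eq)
  ultimately show ?case using ex.ex_minus[OF ex_minus.IH[OF ex_minus.prems] ex_minus.hyps(2,3)] by (simp only:)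
qed

lemma ex_g: "1 \<le> i \<Longrightarrow> i \<le> N \<Longrightarrow> ex k (g k i) ((\<lambda>_. 0)(i := 1))"
  using ex_plus[OF ex_zero, of i k] by simp

lemma ex_neg_g: "1 \<le> i \<Longrightarrow> i \<le> N \<Longrightarrow> ex k (- g k i) ((\<lambda>_. 0)(i := - 1))"
  using ex_minus[OF ex_zero, of i k] by simp

lemma ex_neg: "ex k x e \<Longrightarrow> ex k (- x) (\<lambda>j. - e j)"
proof (induction rule: ex.induct)
  case (ex_zero k)
  then show ?case using ex.ex_zero by simp
next
  case (ex_plus k x e i)
  have "(\<lambda>j. ((\<lambda>_. 0)(i := - 1)) j + - e j) = (\<lambda>j. - (e(i := e i + 1)) j)" by auto
  then show ?case using ex_add[OF ex_plus.IH ex_neg_g[OF ex_plus.hyps(2,3)]] 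
    by (simp add: minus_add del: add_uminus_conv_diff)
next
  case (ex_minus k x e i)
  have "(\<lambda>j. ((\<lambda>_. 0)(i := 1)) j + - e j) = (\<lambda>j. - (e(i := e i - 1)) j)" by auto
  then show ?case using ex_add[OF ex_minus.IH ex_g[OF ex_minus.hyps(2,3)]]
    by (simp add: minus_diff_eq diff_conv_add_uminus minus_add del: add_uminus_conv_diff)
qed

lemma ex_exists: "x \<in> G k \<Longrightarrow> \<exists>e. ex k x e"
proof -
  have "subgp {x. \<exists>e. ex k x e}" unfolding subgp_def using ex_zero ex_add ex_neg by blast
  moreover have "g k ` {1..N} \<subseteq> {x. \<exists>e. ex k x e}" using ex_g by fastforce
  ultimately have "G k \<subseteq> {x. \<exists>e. ex k x e}" unfolding G_def by (rule gen_least)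
  then show "x \<in> G k \<Longrightarrow> ?thesis" by blast
qed

text \<open>Index \<open>N\<close> enters the sections only through \<open>g k 1\<close>, and
  successive factors of this kind contribute alternately to the two halves. Hence
  \<open>e0 N\<close> and \<open>e1 N\<close> agree, or differ by one when a swap is left over; this
  balance is the whole point of the definition.\<close>

definition split :: "nat \<Rightarrow> taut \<Rightarrow> (nat \<Rightarrow> int) \<Rightarrow> taut \<Rightarrow> taut \<Rightarrow> (nat \<Rightarrow> int) \<Rightarrow> (nat \<Rightarrow> int) \<Rightarrow> bool" where
  "split k x e a b e0 e1 \<longleftrightarrow> ex (Suc k) a e0 \<and> ex (Suc k) b e1 \<and> (\<forall>i. 2 \<le> i \<and> i \<le> N \<longrightarrow> e i = e0 (i - 1) + e1 (i - 1))
    \<and> e 1 = e0 N + e1 N \<and> (x = node a b \<and> e0 N = e1 N \<or> x = node a b + swap \<and> e1 N = e0 N + 1)"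

lemma upd_simps:
  "2 \<le> i \<and> i \<le> N \<Longrightarrow> ((f :: nat \<Rightarrow> int)(N := c)) (i - 1) = f (i - 1)"
  "2 \<le> i \<and> i \<le> N \<Longrightarrow> (f(1 := c)) i = f i"
  "2 \<le> i \<Longrightarrow> i \<le> N \<Longrightarrow> (f(i - 1 := c)) N = f N"
  "2 \<le> i \<Longrightarrow> (f(i := c)) 1 = f 1"
  by auto

lemma upd_pred:
  fixes e e0 e1 :: "nat \<Rightarrow> int"
  assumes "\<forall>i. 2 \<le> i \<and> i \<le> N \<longrightarrow> e i = e0 (i - 1) + e1 (i - 1)" "2 \<le> j" "d' = e j + c" "d = e0 (j - 1) + c"
  shows "\<forall>i. 2 \<le> i \<and> i \<le> N \<longrightarrow> (e(j := d')) i = (e0(j - 1 := d)) (i - 1) + e1 (i - 1)"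
  using assms by auto

lemma ex_split: "ex k x e \<Longrightarrow> \<exists>a b e0 e1. split k x e a b e0 e1"
proof (induction rule: ex.induct)
  case (ex_zero k)
  have "split k 0 (\<lambda>_. 0) 0 0 (\<lambda>_. 0) (\<lambda>_. 0)"
    unfolding split_def using ex.ex_zero by (simp add: node_zero)
  then show ?case by blast
next
  case (ex_plus k x e i)
  then obtain a b e0 e1 where "split k x e a b e0 e1" by blast
  then have IH: "ex (Suc k) a e0" "ex (Suc k) b e1" "\<forall>i. 2 \<le> i \<and> i \<le> N \<longrightarrow> e i = e0 (i - 1) + e1 (i - 1)"
    "e 1 = e0 N + e1 N" "x = node a b \<and> e0 N = e1 N \<or> x = node a b + swap \<and> e1 N = e0 N + 1"
    unfolding split_def by blast+
  have N: "1 \<le> N" "N \<le> N" using N2 by auto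
  show ?case
  proof (cases "i = 1")
    case True
    have gi: "g k i = node 0 (g (Suc k) N) + swap" using True g_one[of k] by (simp add: h1_per)
    have e1: "(e(i := e i + 1)) 1 = e0 N + e1 N + 1" using IH(4) True by simp
    have ej: "\<forall>j. 2 \<le> j \<and> j \<le> N \<longrightarrow> (e(i := e i + 1)) j = e0 (j - 1) + e1 (j - 1)" using IH(3) True by simp
    show ?thesis
    proof (cases "x = node a b \<and> e0 N = e1 N")
      case A: True
      \<comment> \<open>If \<open>x\<close> has no swap, the new section falls into the second half,
        otherwise into the first; this keeps \<open>e0 N\<close> and \<open>e1 N\<close>
        balanced.\<close>
      have "x + g k i = node (a) (b + g (Suc k) N) + swap" using A gi by (simp add: wreath )
      then have "split k (x + g k i) (e(i := e i + 1)) (a) (b + g (Suc k) N) (e0) (e1(N := e1 N + 1))"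
        unfolding split_def using IH(1,2) ex.ex_plus[OF IH(2) N] e1 ej A by (simp add: upd_simps) auto
      then show ?thesis by blast
    next
      case False
      then have A: "x = node a b + swap" "e1 N = e0 N + 1" using IH(5) by auto
      have "x + g k i = node (a + g (Suc k) N) (b)" using A gi by (simp add: wreath )
      then have "split k (x + g k i) (e(i := e i + 1)) (a + g (Suc k) N) (b) (e0(N := e0 N + 1)) (e1)"
        unfolding split_def using IH(1,2) ex.ex_plus[OF IH(1) N] e1 ej A by (simp add: upd_simps) auto
      then show ?thesis by blast
    qed
  next
    case False
    then have i: "1 \<le> i - 1" "i - 1 \<le> N" "2 \<le> i" "i \<le> N" using ex_plus.hyps by auto
    define u where "u = g (Suc k) (i - 1)"
    have gi: "g k i = node u 0 \<or> g k i = node 0 u" using g_other[OF False, of k] sib_per[OF False] unfolding u_def by auto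
    have cases: "x + g k i = node (a + u) b \<and> e0 N = e1 N \<or> x + g k i = node (a + u) b + swap \<and> e1 N = e0 N + 1
      \<or> x + g k i = node a (b + u) \<and> e0 N = e1 N \<or> x + g k i = node a (b + u) + swap \<and> e1 N = e0 N + 1"
      using IH(5) gi by (auto simp: wreath )
    have e1: "(e(i := e i + 1)) 1 = e0 N + e1 N" using IH(4) i by simp
    show ?thesis
    proof (cases "x + g k i = node (a + u) b \<and> e0 N = e1 N \<or> x + g k i = node (a + u) b + swap \<and> e1 N = e0 N + 1")
      case A: True
      have "split k (x + g k i) (e(i := e i + 1)) (a + u) b (e0(i - 1 := e0 (i - 1) + 1)) e1"
        unfolding split_def
      proof (intro conjI)
        show "ex (Suc k) (a + u) (e0(i - 1 := e0 (i - 1) + 1))" unfolding u_def by (rule ex.ex_plus[OF IH(1) i(1,2)])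
        show "\<forall>j. 2 \<le> j \<and> j \<le> N \<longrightarrow> (e(i := e i + 1)) j = (e0(i - 1 := e0 (i - 1) + 1)) (j - 1) + e1 (j - 1)"
          by (rule upd_pred[OF IH(3) i(3), of _ "1"]) simp_all
      qed (use IH(2) e1 A upd_simps(3)[OF i(3,4)] in simp_all)
      then show ?thesis by blast
    next
      case A: False
      have "split k (x + g k i) (e(i := e i + 1)) a (b + u) e0 (e1(i - 1 := e1 (i - 1) + 1))"
        unfolding split_def
      proof (intro conjI)
        show "ex (Suc k) (b + u) (e1(i - 1 := e1 (i - 1) + 1))" unfolding u_def by (rule ex.ex_plus[OF IH(2) i(1,2)])
        have "\<forall>i. 2 \<le> i \<and> i \<le> N \<longrightarrow> e i = e1 (i - 1) + e0 (i - 1)" using IH(3) by (simp add: add.commute)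
        from upd_pred[OF this i(3), of "e i + 1" "1" "e1 (i - 1) + 1"]
        show "\<forall>j. 2 \<le> j \<and> j \<le> N \<longrightarrow> (e(i := e i + 1)) j = e0 (j - 1) + (e1(i - 1 := e1 (i - 1) + 1)) (j - 1)"
          by (simp add: add.commute)
        show "x + g k i = node a (b + u) \<and> e0 N = (e1(i - 1 := e1 (i - 1) + 1)) N \<or>
          x + g k i = node a (b + u) + swap \<and> (e1(i - 1 := e1 (i - 1) + 1)) N = e0 N + 1"
          using A cases upd_simps(3)[OF i(3,4), of e1] by auto
      qed (use IH(1) e1 upd_simps(3)[OF i(3,4)] in simp_all)
      then show ?thesis by blast
    qed
  qed
next
  case (ex_minus k x e i)
  then obtain a b e0 e1 where "split k x e a b e0 e1" by blast
  then have IH: "ex (Suc k) a e0" "ex (Suc k) b e1" "\<forall>i. 2 \<le> i \<and> i \<le> N \<longrightarrow> e i = e0 (i - 1) + e1 (i - 1)"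
    "e 1 = e0 N + e1 N" "x = node a b \<and> e0 N = e1 N \<or> x = node a b + swap \<and> e1 N = e0 N + 1"
    unfolding split_def by blast+
  have N: "1 \<le> N" "N \<le> N" using N2 by auto
  show ?case
  proof (cases "i = 1")
    case True
    \<comment> \<open>The inverse of \<open>g k 1\<close> carries its section in the other half, so
      the two halves exchange roles.\<close>
    have gi: "- g k i = node (- g (Suc k) N) 0 + swap" using True g_one[of k] by (simp add: h1_per wreath)
    have e1: "(e(i := e i - 1)) 1 = e0 N + e1 N - 1" using IH(4) True by simp
    have ej: "\<forall>j. 2 \<le> j \<and> j \<le> N \<longrightarrow> (e(i := e i - 1)) j = e0 (j - 1) + e1 (j - 1)" using IH(3) True by simp
    show ?thesis
    proof (cases "x = node a b \<and> e0 N = e1 N")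
      case A: True
      have "x - g k i = node (a - g (Suc k) N) (b) + swap" using A gi by (simp add: wreath diff_conv_add_uminus del: add_uminus_conv_diff)
      then have "split k (x - g k i) (e(i := e i - 1)) (a - g (Suc k) N) (b) (e0(N := e0 N - 1)) (e1)"
        unfolding split_def using IH(1,2) ex.ex_minus[OF IH(1) N] e1 ej A by (simp add: upd_simps) auto
      then show ?thesis by blast
    next
      case False
      then have A: "x = node a b + swap" "e1 N = e0 N + 1" using IH(5) by auto
      have "x - g k i = node (a) (b - g (Suc k) N)" using A gi by (simp add: wreath diff_conv_add_uminus del: add_uminus_conv_diff)
      then have "split k (x - g k i) (e(i := e i - 1)) (a) (b - g (Suc k) N) (e0) (e1(N := e1 N - 1))"
        unfolding split_def using IH(1,2) ex.ex_minus[OF IH(2) N] e1 ej A by (simp add: upd_simps) auto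
      then show ?thesis by blast
    qed
  next
    case False
    then have i: "1 \<le> i - 1" "i - 1 \<le> N" "2 \<le> i" "i \<le> N" using ex_minus.hyps by auto
    define u where "u = g (Suc k) (i - 1)"
    have gi: "g k i = node u 0 \<or> g k i = node 0 u" using g_other[OF False, of k] sib_per[OF False] unfolding u_def by auto
    have cases: "x - g k i = node (a - u) b \<and> e0 N = e1 N \<or> x - g k i = node (a - u) b + swap \<and> e1 N = e0 N + 1
      \<or> x - g k i = node a (b - u) \<and> e0 N = e1 N \<or> x - g k i = node a (b - u) + swap \<and> e1 N = e0 N + 1"
      using IH(5) gi by (auto simp: wreath diff_conv_add_uminus simp del: add_uminus_conv_diff)
    have e1: "(e(i := e i - 1)) 1 = e0 N + e1 N" using IH(4) i by simp
    show ?thesis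
    proof (cases "x - g k i = node (a - u) b \<and> e0 N = e1 N \<or> x - g k i = node (a - u) b + swap \<and> e1 N = e0 N + 1")
      case A: True
      have "split k (x - g k i) (e(i := e i - 1)) (a - u) b (e0(i - 1 := e0 (i - 1) - 1)) e1"
        unfolding split_def
      proof (intro conjI)
        show "ex (Suc k) (a - u) (e0(i - 1 := e0 (i - 1) - 1))" unfolding u_def by (rule ex.ex_minus[OF IH(1) i(1,2)])
        show "\<forall>j. 2 \<le> j \<and> j \<le> N \<longrightarrow> (e(i := e i - 1)) j = (e0(i - 1 := e0 (i - 1) - 1)) (j - 1) + e1 (j - 1)"
          by (rule upd_pred[OF IH(3) i(3), of _ "- 1"]) simp_all
      qed (use IH(2) e1 A upd_simps(3)[OF i(3,4)] in simp_all)
      then show ?thesis by blast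
    next
      case A: False
      have "split k (x - g k i) (e(i := e i - 1)) a (b - u) e0 (e1(i - 1 := e1 (i - 1) - 1))"
        unfolding split_def
      proof (intro conjI)
        show "ex (Suc k) (b - u) (e1(i - 1 := e1 (i - 1) - 1))" unfolding u_def by (rule ex.ex_minus[OF IH(2) i(1,2)])
        have "\<forall>i. 2 \<le> i \<and> i \<le> N \<longrightarrow> e i = e1 (i - 1) + e0 (i - 1)" using IH(3) by (simp add: add.commute)
        from upd_pred[OF this i(3), of "e i - 1" "- 1" "e1 (i - 1) - 1"]
        show "\<forall>j. 2 \<le> j \<and> j \<le> N \<longrightarrow> (e(i := e i - 1)) j = e0 (j - 1) + (e1(i - 1 := e1 (i - 1) - 1)) (j - 1)"
          by (simp add: add.commute)
        show "x - g k i = node a (b - u) \<and> e0 N = (e1(i - 1 := e1 (i - 1) - 1)) N \<or>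
          x - g k i = node a (b - u) + swap \<and> (e1(i - 1 := e1 (i - 1) - 1)) N = e0 N + 1"
          using A cases upd_simps(3)[OF i(3,4), of e1] by auto
      qed (use IH(1) e1 upd_simps(3)[OF i(3,4)] in simp_all)
      then show ?thesis by blast
    qed
  qed
qed

text \<open>The identity has no swap, so \<open>e 1\<close> is twice \<open>e0 N\<close> and gains a
  factor two over the next level. The other entries are sums of entries of smaller index at the next
  level, whence the induction on the index inside the one on \<open>j\<close>.\<close>

lemma ex_zero_dvd: "ex k 0 e \<Longrightarrow> 1 \<le> i \<Longrightarrow> i \<le> N \<Longrightarrow> 2 ^ j dvd e i"
proof (induction j arbitrary: k e i)
  case (Suc j)
  have split: "\<exists>e0 e1. ex (Suc k) 0 e0 \<and> ex (Suc k) 0 e1 \<and> (\<forall>i. 2 \<le> i \<and> i \<le> N \<longrightarrow> e i = e0 (i - 1) + e1 (i - 1))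
    \<and> e 1 = e0 N + e1 N \<and> e0 N = e1 N" if ex0: "ex k 0 e" for k e
  proof -
    obtain a b e0 e1 where *: "ex (Suc k) a e0" "ex (Suc k) b e1" "\<forall>i. 2 \<le> i \<and> i \<le> N \<longrightarrow> e i = e0 (i - 1) + e1 (i - 1)"
      "e 1 = e0 N + e1 N" "0 = node a b \<and> e0 N = e1 N \<or> 0 = node a b + swap \<and> e1 N = e0 N + 1"
      using ex_split[OF ex0] unfolding split_def by blast
    have "0 \<noteq> node a b + swap" using node_swap_neq[of a b 0 0] by (simp add: node_zero)
    then have "a = 0" "b = 0" using *(5) node_eq_zero[of a b] by auto
    then show ?thesis using * \<open>0 \<noteq> node a b + swap\<close> by blast
  qed
  have "\<forall>k e. ex k 0 e \<longrightarrow> 2 ^ Suc j dvd e i" if "1 \<le> i" "i \<le> N" for i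
    using that
  proof (induction i rule: nat_induct_at_least)
    case base
    show ?case
    proof (intro allI impI)
      fix k e assume "ex k 0 e"
      then obtain e0 e1 where "ex (Suc k) 0 e0" "e 1 = e0 N + e1 N" "e0 N = e1 N" using split by blast
      moreover have "2 ^ j dvd e0 N" using Suc.IH[OF \<open>ex (Suc k) 0 e0\<close>] N2 by simp
      ultimately show "2 ^ Suc j dvd e 1" by (simp add: mult_2[symmetric])
    qed
  next
    case (Suc i)
    show ?case
    proof (intro allI impI)
      fix k e assume "ex k 0 e"
      then obtain e0 e1 where "ex (Suc k) 0 e0" "ex (Suc k) 0 e1" "\<forall>i. 2 \<le> i \<and> i \<le> N \<longrightarrow> e i = e0 (i - 1) + e1 (i - 1)" using split by blast
      then show "2 ^ Suc j dvd e (Suc i)" using Suc by simp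
    qed
  qed
  then show ?case using Suc.prems by blast
qed simp

text \<open>The difference of two exponent vectors of \<open>x\<close> belongs to the identity, so
  it is divisible by every power of two.\<close>

lemma ex_unique: assumes "ex k x e" "ex k x e'" "1 \<le> i" "i \<le> N" shows "e i = e' i"
proof -
  have "ex k 0 (\<lambda>j. - e j + e' j)" using ex_add[OF assms(2) ex_neg[OF assms(1)]] by simp
  then have d: "2 ^ j dvd - e i + e' i" for j :: nat using ex_zero_dvd[OF _ assms(3,4)] by simp
  have "\<bar>- e i + e' i\<bar> < 2 ^ nat \<bar>- e i + e' i\<bar>"
    by (metis abs_ge_zero int_nat_eq of_nat_less_two_power)
  then have "- e i + e' i = 0" using d[of "nat \<bar>- e i + e' i\<bar>"] by (metis abs_numeral power_abs zdvd_imp_le abs_dvd_iff dvd_abs_iff linorder_not_less zero_less_abs_iff)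
  then show ?thesis by simp
qed

lemma ex_mul: "1 \<le> i \<Longrightarrow> i \<le> N \<Longrightarrow> ex k (mul n (g k i)) ((\<lambda>_. 0)(i := int n))"
proof (induction n)
  case 0
  then show ?case using ex_zero[of k] by (simp add: fun_upd_idem)
next
  case (Suc n)
  have "((\<lambda>_. 0)(i := int n))(i := ((\<lambda>_. 0)(i := int n)) i + 1) = (\<lambda>_. 0)(i := int (Suc n))" by auto
  then show ?case using ex_plus[OF Suc.IH[OF Suc.prems] Suc.prems] by (simp only: mul.simps)
qed

definition A :: "nat \<Rightarrow> nat \<Rightarrow> taut set" where "A k i = gen (Lam k i)"

text \<open>The index of a generator that has \<open>g (Suc k) i\<close> among its sections; for
  \<open>i = N\<close> this is \<open>1\<close>, because \<open>g k 1\<close> has the section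
  \<open>g (Suc k) N\<close>.\<close>

definition nx :: "nat \<Rightarrow> nat" where "nx i = (if i < N then Suc i else 1)"

lemma nx: "1 \<le> i \<Longrightarrow> i \<le> N \<Longrightarrow> 1 \<le> nx i \<and> nx i \<le> N" "1 \<le> i \<Longrightarrow> i \<le> N \<Longrightarrow> 1 \<le> j \<Longrightarrow> j \<le> N \<Longrightarrow> nx i = nx j \<longleftrightarrow> i = j"
  using N2 by (auto simp: nx_def)

lemma A_sub_G: "1 \<le> i \<Longrightarrow> i \<le> N \<Longrightarrow> A k i \<subseteq> G k"
  unfolding A_def by (rule gen_least[OF subgp_G]) (use Lam_in_G in blast)

lemma push_g:
  assumes "1 \<le> i" "i \<le> N"
  shows "\<exists>\<nu>. node (g (Suc k) i) \<nu> \<in> A k (nx i) \<and> (i < N \<longrightarrow> \<nu> = 0)"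
    and "\<exists>\<nu>. node \<nu> (g (Suc k) i) \<in> A k (nx i) \<and> (i < N \<longrightarrow> \<nu> = 0)"
proof -
  have "(\<exists>\<nu>. node (g (Suc k) i) \<nu> \<in> A k (nx i) \<and> (i < N \<longrightarrow> \<nu> = 0)) \<and> (\<exists>\<nu>. node \<nu> (g (Suc k) i) \<in> A k (nx i) \<and> (i < N \<longrightarrow> \<nu> = 0))"
  proof (cases "i < N")
    case True
    let ?u = "g (Suc k) i"
    have "g k (Suc i) = node ?u 0 \<or> g k (Suc i) = node 0 ?u"
      using g_other[of "Suc i" k] sib_per[of "Suc i" k] assms by auto
    then have 1: "node ?u 0 \<in> Lam k (Suc i) \<or> node 0 ?u \<in> Lam k (Suc i)" using g_in_Lam by metis
    have "node ?u 0 \<in> Lam k (Suc i)" using 1 Lam_flip(2)[of 0 ?u k "Suc i"] by (auto simp: cj_simps)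
    moreover have "node 0 ?u \<in> Lam k (Suc i)" using 1 Lam_flip(1)[of ?u 0 k "Suc i"] by (auto simp: cj_simps)
    ultimately show ?thesis using True unfolding A_def nx_def by (auto intro: gen_incl)
  next
    case False
    then have i: "i = N" "nx i = 1" using assms by (auto simp: nx_def)
    have "g k 1 + g k 1 = node (h1 k) (h1 k)" unfolding g_one by (simp add: wreath)
    moreover have "g k 1 + g k 1 \<in> A k 1" unfolding A_def by (intro gen_add gen_incl g_in_Lam)
    ultimately show ?thesis using i by (auto simp: h1_per)
  qed
  then show "\<exists>\<nu>. node (g (Suc k) i) \<nu> \<in> A k (nx i) \<and> (i < N \<longrightarrow> \<nu> = 0)"
    and "\<exists>\<nu>. node \<nu> (g (Suc k) i) \<in> A k (nx i) \<and> (i < N \<longrightarrow> \<nu> = 0)" by auto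
qed

lemma A_cj: "x \<in> A k i \<Longrightarrow> h \<in> G k \<Longrightarrow> cj x h \<in> A k i"
proof -
  assume h: "h \<in> G k" and x: "x \<in> A k i"
  from x[unfolded A_def] show "cj x h \<in> A k i"
    unfolding A_def by (induction) (auto simp: cj_simps intro: gen.intros Lam_cj[OF _ h])
qed

lemma push_A:
  assumes i: "1 \<le> i" "i \<le> N" and a: "a \<in> A (Suc k) i"
  shows "\<exists>\<nu>. node a \<nu> \<in> A k (nx i) \<and> (i < N \<longrightarrow> \<nu> = 0)"
    and "\<exists>\<nu>. node \<nu> a \<in> A k (nx i) \<and> (i < N \<longrightarrow> \<nu> = 0)"
proof -
  have sA: "subgp (A k (nx i))" unfolding A_def by (rule subgp_gen)
  let ?S = "{a. \<exists>\<nu>. node a \<nu> \<in> A k (nx i) \<and> (i < N \<longrightarrow> \<nu> = 0)}"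
  let ?T = "{a. \<exists>\<nu>. node \<nu> a \<in> A k (nx i) \<and> (i < N \<longrightarrow> \<nu> = 0)}"
  have z: "node 0 0 \<in> A k (nx i)" using subgpD(1)[OF sA] by (simp add: node_zero)
  have pl: "node (a + c) (b + d) \<in> A k (nx i)" if "node a b \<in> A k (nx i)" "node c d \<in> A k (nx i)" for a b c d
    using subgpD(2)[OF sA that] by (simp add: node_plus)
  have mi: "node (- a) (- b) \<in> A k (nx i)" if "node a b \<in> A k (nx i)" for a b
    using subgpD(3)[OF sA that] by (simp add: node_minus)
  have "subgp ?S"
    unfolding subgp_def
  proof (intro conjI ballI)
    show "0 \<in> ?S" using z by blast
    fix x assume "x \<in> ?S"
    then obtain \<nu> where x: "node x \<nu> \<in> A k (nx i)" "i < N \<longrightarrow> \<nu> = 0" by blast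
    show "- x \<in> ?S" using mi[OF x(1)] x(2) by force
    fix y assume "y \<in> ?S"
    then obtain \<mu> where y: "node y \<mu> \<in> A k (nx i)" "i < N \<longrightarrow> \<mu> = 0" by blast
    show "x + y \<in> ?S" using pl[OF x(1) y(1)] x(2) y(2) by force
  qed
  moreover have "Lam (Suc k) i \<subseteq> ?S"
  proof
    fix x assume "x \<in> Lam (Suc k) i"
    then obtain h where h: "h \<in> G (Suc k)" "x = cj (g (Suc k) i) h" unfolding Lam_def by auto
    obtain \<nu> where \<nu>: "node (g (Suc k) i) \<nu> \<in> A k (nx i)" "i < N \<longrightarrow> \<nu> = 0" using push_g(1)[OF i] by blast
    \<comment> \<open>Conjugation by \<open>h\<close> in the first half is realised by some
      \<open>node h h'\<close>; a second coordinate that vanishes stays zero under it.\<close>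
    obtain h' where h': "node h h' \<in> G k" using lift1[OF h(1)] by blast
    have "node x (cj \<nu> h') \<in> A k (nx i)" using A_cj[OF \<nu>(1) h'] h by (simp add: cj_node)
    then show "x \<in> ?S" using \<nu>(2) cj_simps(1) by blast
  qed
  ultimately have "A (Suc k) i \<subseteq> ?S" unfolding A_def[of "Suc k"] by (rule gen_least)
  then show "\<exists>\<nu>. node a \<nu> \<in> A k (nx i) \<and> (i < N \<longrightarrow> \<nu> = 0)" using a by blast
  have "subgp ?T"
    unfolding subgp_def
  proof (intro conjI ballI)
    show "0 \<in> ?T" using z by blast
    fix x assume "x \<in> ?T"
    then obtain \<nu> where x: "node \<nu> x \<in> A k (nx i)" "i < N \<longrightarrow> \<nu> = 0" by blast
    show "- x \<in> ?T" using mi[OF x(1)] x(2) by force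
    fix y assume "y \<in> ?T"
    then obtain \<mu> where y: "node \<mu> y \<in> A k (nx i)" "i < N \<longrightarrow> \<mu> = 0" by blast
    show "x + y \<in> ?T" using pl[OF x(1) y(1)] x(2) y(2) by force
  qed
  moreover have "Lam (Suc k) i \<subseteq> ?T"
  proof
    fix x assume "x \<in> Lam (Suc k) i"
    then obtain h where h: "h \<in> G (Suc k)" "x = cj (g (Suc k) i) h" unfolding Lam_def by auto
    obtain \<nu> where \<nu>: "node \<nu> (g (Suc k) i) \<in> A k (nx i)" "i < N \<longrightarrow> \<nu> = 0" using push_g(2)[OF i] by blast
    obtain h' where h': "node h' h \<in> G k" using lift1[OF h(1)] by blast
    have "node (cj \<nu> h') x \<in> A k (nx i)" using A_cj[OF \<nu>(1) h'] h by (simp add: cj_node)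
    then show "x \<in> ?T" using \<nu>(2) cj_simps(1) by blast
  qed
  ultimately have "A (Suc k) i \<subseteq> ?T" unfolding A_def[of "Suc k"] by (rule gen_least)
  then show "\<exists>\<nu>. node \<nu> a \<in> A k (nx i) \<and> (i < N \<longrightarrow> \<nu> = 0)" using a by blast
qed

text \<open>At most one of \<open>i\<close> and \<open>j\<close> is \<open>N\<close>, so one of the
  two lifts vanishes on the other half and the commutator of the lifts vanishes there. Working with
  the normal closures \<open>A\<close> makes the result a commutator of the same kind one level up,
  ready for iteration.\<close>

lemma push_comm:
  assumes i: "1 \<le> i" "i \<le> N" and j: "1 \<le> j" "j \<le> N" and ij: "i \<noteq> j"
    and a: "a \<in> A (Suc k) i" and b: "b \<in> A (Suc k) j"
  shows "\<exists>a'\<in>A k (nx i). \<exists>b'\<in>A k (nx j). rig [c] (comm a b) = comm a' b'"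
proof (cases c)
  case True
  obtain \<nu> \<mu> where *: "node \<nu> a \<in> A k (nx i)" "i < N \<longrightarrow> \<nu> = 0" "node \<mu> b \<in> A k (nx j)" "j < N \<longrightarrow> \<mu> = 0"
    using push_A(2)[OF i a] push_A(2)[OF j b] by blast
  have "comm \<nu> \<mu> = 0" using *(2,4) i j ij by (metis comm_zero linorder_neqE_nat not_less)
  then have "rig [c] (comm a b) = comm (node \<nu> a) (node \<mu> b)" using True by (simp add: comm_node)
  then show ?thesis using * by blast
next
  case False
  obtain \<nu> \<mu> where *: "node a \<nu> \<in> A k (nx i)" "i < N \<longrightarrow> \<nu> = 0" "node b \<mu> \<in> A k (nx j)" "j < N \<longrightarrow> \<mu> = 0"
    using push_A(1)[OF i a] push_A(1)[OF j b] by blast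
  have "comm \<nu> \<mu> = 0" using *(2,4) i j ij by (metis comm_zero linorder_neqE_nat not_less)
  then have "rig [c] (comm a b) = comm (node a \<nu>) (node b \<mu>)" using False by (simp add: comm_node)
  then show ?thesis using * by blast
qed

lemma comm_rigid:
  assumes "1 \<le> i" "i \<le> N" "1 \<le> j" "j \<le> N" "i \<noteq> j" "a \<in> A (k + length y) i" "b \<in> A (k + length y) j"
  shows "rig y (comm a b) \<in> G k"
  using assms
proof (induction y arbitrary: i j a b rule: rev_induct)
  case Nil
  then show ?case using A_sub_G comm_in_G by (auto simp: subset_eq)
next
  case (snoc c y)
  obtain a' b' where *: "a' \<in> A (k + length y) (nx i)" "b' \<in> A (k + length y) (nx j)" "rig [c] (comm a b) = comm a' b'"
    using push_comm[of i j a "k + length y" b c] snoc.prems by auto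
  have "rig y (comm a' b') \<in> G k"
    by (rule snoc.IH[OF _ _ _ _ _ *(1,2)]) (use nx snoc.prems in auto)
  then show ?case by (simp only: rig_append *(3))
qed

text \<open>The commutator of the first two generators is planted at every level by
  \<open>comm_rigid\<close>. It is nonzero because the second generator acts on one half only and
  the first exchanges the halves.\<close>

lemma wb: "wb k"
  unfolding wb_def
proof
  fix m
  let ?c = "comm (g (k + m) 2) (g (k + m) 1)"
  have "?c \<in> R k m"
    using comm_rigid[of 2 1 "g (k + m) 2" k _ "g (k + m) 1"] N2 g_in_Lam unfolding R_def A_def
    by (auto intro: gen_incl)
  moreover have "?c \<noteq> 0"
  proof
    assume "?c = 0"
    then have c: "cj (g (k + m) 2) (g (k + m) 1) = g (k + m) 2" by (simp add: comm_eq_zero)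
    define u where "u = g (Suc (k + m)) 1"
    have u: "u \<noteq> 0" using g_one[of "Suc (k + m)"] node_swap_neq[of _ _ 0 0] unfolding u_def by (metis node_zero)
    have "g (k + m) 2 = node 0 u \<or> g (k + m) 2 = node u 0"
      using g_other[of 2 "k + m"] sib_per[of 2] unfolding u_def by (auto simp: numeral_2_eq_2)
    then show False
      using c u cj_node_g1[of 0 u "k + m"] cj_node_g1[of u 0 "k + m"] by (auto simp: node_inject)
  qed
  ultimately show "\<exists>u\<in>R k m. u \<noteq> 0" by blast
qed

lemma g2_infinite: assumes "n > 0" shows "mul n (g k 2) \<noteq> 0"
proof
  assume "mul n (g k 2) = 0"
  then have "ex k 0 ((\<lambda>_. 0)(2 := int n))" using ex_mul[of 2 k n] N2 by simp
  from ex_unique[OF this ex_zero, of 2] show False using N2 assms by simp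
qed

theorem not_va: "\<not> virtually_abelian (gr (G k))"
  by (rule not_virtually_abelian[OF wb g_in_G[of 2]]) (use N2 g2_infinite in auto)

theorem not_LR: "\<not> has_LR (gr (G k))"
proof
  assume LR: "has_LR (gr (G k))"
  obtain t t' where t: "t \<in> R k 1" "t' \<in> R k 1" "cj t t' \<noteq> t" using R_noncommuting[OF wb] by blast
  define s where "s = comm t t'"
  define l where "l = comm (rig [False] t) (rig [False] t')"
  have l: "l = node s 0" "l \<noteq> 0" "l \<in> G k"
    using t comm_eq_zero[of t t'] comm_in_G[OF R_D[of t k "[False]"] R_D[of t' k "[False]"]]
    unfolding l_def s_def by (auto simp: comm_node node_eq_zero)
  \<comment> \<open>A commutator, hence invisible to exponent sums, whose coordinates still show
    \<open>g (Suc k) (i - 1)\<close> up to sign and conjugation.\<close>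
  define cc where "cc i = g k i - cj (g k i) (g k 1)" for i
  define T where "T = {g k 1, l} \<union> cc ` {2..N}"
  have T: "finite T" "T \<subseteq> G k"
    unfolding T_def cc_def using g_in_G1 l(3) g_in_G G_intros(4,5) by auto
  define D where "D = gen T"
  have Ds: "subgp D" unfolding D_def by (rule subgp_gen)
  have g1D: "g k 1 \<in> D" and lD: "l \<in> D" and ccD: "\<And>i. 2 \<le> i \<Longrightarrow> i \<le> N \<Longrightarrow> cc i \<in> D"
    unfolding D_def T_def by (auto intro: gen_incl)
  \<comment> \<open>All of \<open>G (Suc k)\<close> occurs as first coordinates of elements of
    \<open>D\<close>: index \<open>N\<close> through the square of \<open>g k 1\<close>, the other
    indices through \<open>cc\<close>, conjugated by \<open>g k 1\<close> where they sit in the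
    wrong half.\<close>
  have sections: "\<exists>b. node a b \<in> D" if "a \<in> G (Suc k)" for a
  proof -
    let ?S = "{a. \<exists>b. node a b \<in> D}"
    have "subgp ?S"
      unfolding subgp_def
    proof (intro conjI ballI)
      have "node 0 0 \<in> D" using subgpD(1)[OF Ds] by (simp add: node_zero)
      then show "0 \<in> ?S" by blast
      fix x assume "x \<in> ?S"
      then obtain b where x: "node x b \<in> D" by blast
      show "- x \<in> ?S" using subgpD(3)[OF Ds x] by (auto simp: node_minus)
      fix y assume "y \<in> ?S"
      then obtain c where y: "node y c \<in> D" by blast
      show "x + y \<in> ?S" using subgpD(2)[OF Ds x y] by (auto simp: node_plus)
    qed
    moreover have "g (Suc k) ` {1..N} \<subseteq> ?S"
    proof clarify
      fix j assume j: "j \<in> {1..N}"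
      show "\<exists>b. node (g (Suc k) j) b \<in> D"
      proof (cases "j = N")
        case True
        have "g k 1 + g k 1 = node (h1 k) (h1 k)" unfolding g_one by (simp add: wreath)
        then show ?thesis using subgpD(2)[OF Ds g1D g1D] True by (auto simp: h1_per)
      next
        case False
        let ?u = "g (Suc k) j"
        have c: "cc (Suc j) \<in> D" using ccD j False by auto
        have "g k (Suc j) = node ?u 0 \<or> g k (Suc j) = node 0 ?u"
          using g_other[of "Suc j" k] sib_per[of "Suc j" k] j by auto
        then show ?thesis
        proof
          assume e: "g k (Suc j) = node ?u 0"
          have "cc (Suc j) = node ?u (- ?u)" unfolding cc_def e cj_node_g1
            by (simp add: cj_simps wreath diff_conv_add_uminus del: add_uminus_conv_diff)
          then show ?thesis using c by metis
        next
          assume e: "g k (Suc j) = node 0 ?u"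
          have "cc (Suc j) = node (- cj ?u (h1 k)) ?u" unfolding cc_def e cj_node_g1
            by (simp add: cj_simps wreath diff_conv_add_uminus del: add_uminus_conv_diff)
          then have "cj (cc (Suc j)) (- g k 1) = node ?u (cj (- cj ?u (h1 k)) (- h1 k))"
            by (simp only: cj_node_g1')
          moreover have "cj (cc (Suc j)) (- g k 1) \<in> D" by (intro subgpD(5)[OF Ds] c subgpD(3)[OF Ds] g1D)
          ultimately show ?thesis by metis
        qed
      qed
    qed
    ultimately have "G (Suc k) \<subseteq> ?S" unfolding G_def[of "Suc k"] by (rule gen_least)
    then show ?thesis using that by blast
  qed
  \<comment> \<open>\<open>l\<close> acts on the first half only, so its conjugate by
    \<open>node a b\<close> depends on \<open>a\<close> alone, and \<open>b\<close> may be replaced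
    so that the conjugating element lies in \<open>D\<close>.\<close>
  have cl0: "cj l (node a b) \<in> D" if a: "a \<in> G (Suc k)" for a b
  proof -
    obtain b' where b': "node a b' \<in> D" using sections[OF a] by blast
    have "cj l (node a b) = cj l (node a b')" unfolding l(1) by (simp add: cj_node cj_simps)
    then show ?thesis using subgpD(5)[OF Ds lD b'] by simp
  qed
  have clD: "cj l x \<in> D" if x: "x \<in> G k" for x
  proof -
    obtain a b where ab: "a \<in> G (Suc k)" "x = node a b \<or> x = node a b + swap" using G_split[OF x] by blast
    from ab(2) show ?thesis
    proof
      assume "x = node a b" then show ?thesis using cl0[OF ab(1)] by simp
    next
      assume "x = node a b + swap"
      \<comment> \<open>An element exchanging the halves differs from one that preserves them by
        \<open>g k 1\<close>, which belongs to \<open>D\<close>.\<close>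
      then have "x = node a (b - h1 k) + g k 1"
        unfolding g_one by (simp add: wreath diff_conv_add_uminus del: add_uminus_conv_diff)
      then have "cj l x = cj (cj l (node a (b - h1 k))) (g k 1)" by (simp only: cj_simps(5))
      then show ?thesis using subgpD(5)[OF Ds cl0[OF ab(1)] g1D] by simp
    qed
  qed
  define M where "M = gen ((\<lambda>x. cj l x) ` G k)"
  have MD: "M \<subseteq> D" unfolding M_def by (rule gen_least[OF Ds]) (use clD in blast)
  have lM: "l \<in> M"
  proof -
    have "cj l 0 \<in> M" unfolding M_def using G_intros(1) by (blast intro: gen_incl)
    then show ?thesis by (simp only: cj_simps(2))
  qed
  have Ms: "subgp M" unfolding M_def by (rule subgp_gen)
  have Mcj: "cj x h \<in> M" if "x \<in> M" and h: "h \<in> G k" for x h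
    using that(1) unfolding M_def
  proof induction
    case (gen_incl x)
    then show ?case using G_intros(2)[OF _ h] by (auto simp: cj_simps(5) intro!: gen.gen_incl)
  qed (auto simp: cj_simps intro: gen.intros)
  have MG: "M \<subseteq> G k" unfolding M_def by (rule gen_least[OF subgp_G]) (use l(3) G_intros(5) in blast)
  have nM: "nrm k M" unfolding nrm_def using Ms MG Mcj by blast
  obtain K \<rho> where "retr (G k) D K \<rho>" using gr_LR_retract[OF subgp_G LR T] unfolding D_def by blast
  note K = retrD[OF this]
  have KD: "x \<in> D" if x: "x \<in> K" for x
  proof -
    define \<nu> where "\<nu> = x - \<rho> x"
    have rx: "\<rho> x \<in> K" using K(4,7) x by blast
    have \<nu>: "\<nu> \<in> K" "\<rho> \<nu> = 0"
    proof -
      show "\<nu> \<in> K" unfolding \<nu>_def using subgpD(4)[OF K(2) x rx] .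
      have "\<rho> (x + - \<rho> x) = \<rho> x + - \<rho> x" using K(5)[OF x subgpD(3)[OF K(2) rx]] K(6)[OF rx] K(8)[OF K(7)[OF x]] by simp
      then show "\<rho> \<nu> = 0" unfolding \<nu>_def by simp
    qed
    have "\<nu> = 0"
    proof (rule centralizer_trivial)
      show "\<exists>t. t \<noteq> 0 \<and> rig y t \<in> M" for y by (rule normal_rigid[OF wb nM lM l(2)])
      fix m assume m: "m \<in> M"
      have mK: "m \<in> K" using m MD K(4) by blast
      \<comment> \<open>The commutator lies in the normal subgroup \<open>M\<close>, thus in
        \<open>D\<close>, where \<open>\<rho>\<close> is the identity; yet \<open>\<rho>\<close>
        kills it because it kills \<open>\<nu>\<close>.\<close>
      have w: "comm m \<nu> \<in> D" unfolding comm_def using Ms MD m Mcj[OF m] \<nu>(1) K(3) subgpD(2,3)[OF Ms] by blast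
      have "\<rho> (- m + (- \<nu> + m + \<nu>)) = - \<rho> m + (- \<rho> \<nu> + \<rho> m + \<rho> \<nu>)"
        using K(5,6) mK \<nu>(1) subgpD(2,3)[OF K(2)] by simp
      then have "\<rho> (comm m \<nu>) = 0" unfolding comm_def cj_def using \<nu>(2) by simp
      then have "comm m \<nu> = 0" using K(8)[OF w] by simp
      then show "cj m \<nu> = m" by (simp add: comm_eq_zero)
    qed
    then have "x = \<rho> x" unfolding \<nu>_def by simp
    then show ?thesis using K(7)[OF x] by simp
  qed
  have exD: "\<exists>e. ex k x e \<and> e 2 = 0" if "x \<in> D" for x
  proof -
    have "subgp {x. \<exists>e. ex k x e \<and> e 2 = 0}"
      unfolding subgp_def
    proof (intro conjI ballI)
      show "0 \<in> {x. \<exists>e. ex k x e \<and> e 2 = 0}" using ex_zero[of k] by blast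
      fix x assume "x \<in> {x. \<exists>e. ex k x e \<and> e 2 = 0}"
      then obtain e where x: "ex k x e" "e 2 = 0" by blast
      show "- x \<in> {x. \<exists>e. ex k x e \<and> e 2 = 0}" using ex_neg[OF x(1)] x(2) by (intro CollectI exI) auto
      fix y assume "y \<in> {x. \<exists>e. ex k x e \<and> e 2 = 0}"
      then obtain e' where y: "ex k y e'" "e' 2 = 0" by blast
      show "x + y \<in> {x. \<exists>e. ex k x e \<and> e 2 = 0}" using ex_add[OF y(1) x(1)] x(2) y(2) by (intro CollectI exI) auto
    qed
    \<comment> \<open>Conjugation preserves exponent sums; hence \<open>l\<close> and every
      \<open>cc i\<close> have sum zero at index \<open>2\<close>, as has
      \<open>g k 1\<close>.\<close>
    moreover have cjx: "\<exists>e. ex k (cj a b) e \<and> e 2 = ea 2" if ea: "ex k a ea" and bG: "b \<in> G k" for a b ea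
    proof -
      obtain eb where eb: "ex k b eb" using ex_exists[OF bG] by blast
      show ?thesis unfolding cj_def using ex_add[OF eb ex_add[OF ea ex_neg[OF eb]]] by (intro exI conjI) auto
    qed
    moreover have "T \<subseteq> {x. \<exists>e. ex k x e \<and> e 2 = 0}"
    proof
      fix x assume "x \<in> T"
      then consider "x = g k 1" | "x = l" | i where "x = cc i" "2 \<le> i" "i \<le> N" unfolding T_def by auto
      then show "x \<in> {x. \<exists>e. ex k x e \<and> e 2 = 0}"
      proof cases
        case 1
        then show ?thesis using ex_g[of 1 k] N2 by (intro CollectI exI) auto
      next
        case 2
        have tG: "rig [False] t \<in> G k" "rig [False] t' \<in> G k" using t R_D[of _ k "[False]"] by auto
        obtain ea where ea: "ex k (rig [False] t) ea" using ex_exists[OF tG(1)] by blast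
        obtain e where e: "ex k (cj (rig [False] t) (rig [False] t')) e" "e 2 = ea 2" using cjx[OF ea tG(2)] by blast
        show ?thesis unfolding 2 l_def comm_def using ex_add[OF e(1) ex_neg[OF ea]] e(2) by (intro CollectI exI) auto
      next
        case 3
        have gi: "ex k (g k i) ((\<lambda>_. 0)(i := 1))" using ex_g 3 by simp
        obtain e where e: "ex k (cj (g k i) (g k 1)) e" "e 2 = ((\<lambda>_. 0)(i := 1)) 2" using cjx[OF gi g_in_G1] by blast
        have "ex k (g k i + - cj (g k i) (g k 1)) (\<lambda>j. ((\<lambda>_. 0)(i := 1)) j + - e j)"
          by (rule ex_add[OF ex_neg[OF e(1)] gi])
        then show ?thesis unfolding 3(1) cc_def using e(2) by (intro CollectI exI) auto
      qed
    qed
    ultimately have "D \<subseteq> {x. \<exists>e. ex k x e \<and> e 2 = 0}" unfolding D_def by (intro gen_least)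
    then show ?thesis using that by blast
  qed
  obtain J K0 where J: "J > 0" "K0 \<subseteq> K" "\<And>g. g \<in> G k \<Longrightarrow> mul J g \<in> K0"
    using gr_core[OF subgp_G K(1)] by metis
  have "mul J (g k 2) \<in> D" using J KD g_in_G[of 2 k] N2 by auto
  then obtain e where "ex k (mul J (g k 2)) e" "e 2 = 0" using exD by blast
  then show False using ex_unique[OF _ ex_mul[of 2 k J], of e 2] N2 J(1) by simp
qed

end

section \<open>The preperiodic case: rigid commutators and torsion\<close>

lemma gen_mod_normal:
  assumes M: "subgp M" and n: "\<And>x h. x \<in> M \<Longrightarrow> h \<in> gen S \<Longrightarrow> cj x h \<in> M" and T: "T \<subseteq> gen S \<union> M"
    and x: "x \<in> gen T"
  shows "\<exists>d\<in>gen S. \<exists>\<theta>\<in>M. x = d + \<theta>"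
proof -
  let ?D = "gen S"
  have sD: "subgp ?D" by (rule subgp_gen)
  let ?W = "{x. \<exists>d\<in>?D. \<exists>\<theta>\<in>M. x = d + \<theta>}"
  have "subgp ?W"
    unfolding subgp_def
  proof (intro conjI ballI)
    show "0 \<in> ?W" using subgpD(1)[OF sD] subgpD(1)[OF M] by force
    fix x assume "x \<in> ?W"
    then obtain d \<theta> where x: "d \<in> ?D" "\<theta> \<in> M" "x = d + \<theta>" by blast
    have "- x = - d + cj (- \<theta>) (- d)" using x(3) by (simp add: cj_def minus_add add.assoc diff_conv_add_uminus del: add_uminus_conv_diff)
    then show "- x \<in> ?W" using subgpD(3)[OF sD x(1)] n[OF subgpD(3)[OF M x(2)] subgpD(3)[OF sD x(1)]] by blast
    fix y assume "y \<in> ?W"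
    then obtain e \<phi> where y: "e \<in> ?D" "\<phi> \<in> M" "y = e + \<phi>" by blast
    have "x + y = (d + e) + (cj \<theta> e + \<phi>)" using x(3) y(3) by (simp add: cj_def add.assoc)
    then show "x + y \<in> ?W" using subgpD(2)[OF sD x(1) y(1)] subgpD(2)[OF M n[OF x(2) y(1)] y(2)] by blast
  qed
  moreover have "T \<subseteq> ?W"
  proof
    fix x assume "x \<in> T"
    then consider "x \<in> gen S" | "x \<in> M" using T by blast
    then show "x \<in> ?W"
    proof cases
      case 1
      then show ?thesis using subgpD(1)[OF M] by force
    next
      case 2
      then show ?thesis using subgpD(1)[OF sD] by force
    qed
  qed
  ultimately have "gen T \<subseteq> ?W" by (rule gen_least)
  then show ?thesis using x by blast
qed

locale preperiodic_kneading = kneading +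
  assumes npr: "\<not> per" and N3: "3 \<le> N"
begin

lemma r2: "2 \<le> r"
  using npr r1 unfolding per_def by simp

lemma h1_pre: "h1 k = 0"
  by (simp add: h1_def npr)

lemma g1_swap: "g k 1 = swap"
  unfolding g_one h1_pre node_zero by simp

lemma g_invol: "g k i + g k i = 0"
proof (rule taut_eqI)
  fix w
  have "app (g k i) (app (g k i) w) = w"
  proof (induction w arbitrary: k i)
    case (Cons b w)
    show ?case
    proof (cases "i = 1")
      case True
      then show ?thesis using g1_swap[of k] by (cases b) auto
    next
      case False
      have sib0: "app (sib k i) (app (sib k i) w) = w" unfolding sib_def using Cons.IH by simp
      show ?thesis using g_other[OF False, of k] sib0 Cons.IH[of "Suc k" "i - 1"] by simp
    qed
  qed simp
  then show "app (g k i + g k i) w = app 0 w" by simp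
qed

lemma Lam_invol: "x \<in> Lam k i \<Longrightarrow> x + x = 0"
  unfolding Lam_def using g_invol[of k i] cj_simps(1,3) by (metis (no_types, lifting) imageE)

lemma Lam_minus: "x \<in> Lam k i \<Longrightarrow> - x = x"
  using Lam_invol minus_unique by blast

lemma flip: "node a b \<in> Lam k i \<Longrightarrow> node b a \<in> Lam k i"
  using Lam_flip(1)[of a b k i] by (simp add: h1_pre cj_simps)

lemma cj_node_swap: "cj (node a b) (node x y + swap) = node (cj b y) (cj a x)"
  by (simp add: cj_def wreath diff_conv_add_uminus del: add_uminus_conv_diff)

text \<open>The excluded indices \<open>r - 1\<close> and \<open>N\<close> belong to the two
  preimages of \<open>p\<^sub>r\<close>, whose generators are lifted only together, as the
  coordinates of \<open>g k r\<close>. A free index lifts with a trivial other coordinate.\<close>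

definition free :: "nat \<Rightarrow> bool" where "free i \<longleftrightarrow> i \<noteq> r - 1 \<and> i \<noteq> N"

definition nx :: "nat \<Rightarrow> nat" where "nx i = (if i < N then Suc i else r)"

lemma push_Lam:
  assumes i: "1 \<le> i" "i \<le> N" and a: "a \<in> Lam (Suc k) i"
  shows "\<exists>\<nu>. node a \<nu> \<in> Lam k (nx i) \<and> (free i \<longrightarrow> \<nu> = 0) \<and> (i = r - 1 \<longrightarrow> \<nu> \<in> Lam (Suc k) N) \<and> (i = N \<longrightarrow> \<nu> \<in> Lam (Suc k) (r - 1))"
proof -
  have "\<exists>\<nu>. node (g (Suc k) i) \<nu> \<in> Lam k (nx i) \<and> (free i \<longrightarrow> \<nu> = 0) \<and> (i = r - 1 \<longrightarrow> \<nu> \<in> Lam (Suc k) N) \<and> (i = N \<longrightarrow> \<nu> \<in> Lam (Suc k) (r - 1))"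
  proof (cases "i = N")
    case True
    have "g k r = node (g (Suc k) N) (g (Suc k) (r - 1)) \<or> g k r = node (g (Suc k) (r - 1)) (g (Suc k) N)"
      using g_other[of r k] r2 by (simp add: sib_def)
    then have "node (g (Suc k) N) (g (Suc k) (r - 1)) \<in> Lam k r" using g_in_Lam[of k r] flip by metis
    moreover have "N \<noteq> r - 1" using rN r2 by simp
    ultimately show ?thesis using True g_in_Lam by (intro exI[of _ "g (Suc k) (r - 1)"]) (auto simp: nx_def free_def)
  next
    case False
    then have nxi: "nx i = Suc i" using i by (simp add: nx_def)
    have "g k (Suc i) = node (sib k (Suc i)) (g (Suc k) i) \<or> g k (Suc i) = node (g (Suc k) i) (sib k (Suc i))"
      using g_other[of "Suc i" k] i by simp
    then have "node (g (Suc k) i) (sib k (Suc i)) \<in> Lam k (Suc i)" using g_in_Lam[of k "Suc i"] flip by metis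
    moreover have "Suc i = r \<longleftrightarrow> i = r - 1" using r2 by auto
    ultimately show ?thesis using False g_in_Lam
      by (intro exI[of _ "sib k (Suc i)"]) (auto simp: nxi free_def sib_def)
  qed
  then obtain \<nu> where \<nu>: "node (g (Suc k) i) \<nu> \<in> Lam k (nx i)" "free i \<longrightarrow> \<nu> = 0" "i = r - 1 \<longrightarrow> \<nu> \<in> Lam (Suc k) N"
    "i = N \<longrightarrow> \<nu> \<in> Lam (Suc k) (r - 1)" by blast
  obtain h where h: "h \<in> G (Suc k)" "a = cj (g (Suc k) i) h" using a unfolding Lam_def by blast
  obtain h' where h': "node h h' \<in> G k" using lift1[OF h(1)] by blast
  have "h' \<in> G (Suc k)" using G_node[OF h'] by simp
  moreover have "node a (cj \<nu> h') \<in> Lam k (nx i)" using Lam_cj[OF \<nu>(1) h'] h(2) by (simp add: cj_node)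
  ultimately show ?thesis using \<nu> Lam_cj by (intro exI[of _ "cj \<nu> h'"]) (auto simp: cj_simps)
qed

lemma Lam_form:
  assumes \<mu>: "\<mu> \<in> Lam k i" and i: "2 \<le> i" "i \<le> N"
  shows "\<exists>\<alpha>\<in>Lam (Suc k) (i - 1). \<exists>\<beta>. (\<mu> = node \<alpha> \<beta> \<or> \<mu> = node \<beta> \<alpha>) \<and> (if i = r then \<beta> \<in> Lam (Suc k) N else \<beta> = 0)"
proof -
  obtain h where h: "h \<in> G k" "\<mu> = cj (g k i) h" using \<mu> unfolding Lam_def by blast
  obtain x y where xy: "x \<in> G (Suc k)" "y \<in> G (Suc k)" "h = node x y \<or> h = node x y + swap" using G_split[OF h(1)] by blast
  let ?u = "g (Suc k) (i - 1)" and ?s = "sib k i"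
  have gi: "g k i = node ?s ?u \<or> g k i = node ?u ?s" using g_other[of i k] i by auto
  have s: "\<And>z. z \<in> G (Suc k) \<Longrightarrow> if i = r then cj ?s z \<in> Lam (Suc k) N else cj ?s z = 0"
    unfolding sib_def Lam_def by (auto simp: cj_simps)
  have u: "\<And>z. z \<in> G (Suc k) \<Longrightarrow> cj ?u z \<in> Lam (Suc k) (i - 1)" unfolding Lam_def by blast
  have "\<mu> = node (cj ?s x) (cj ?u y) \<or> \<mu> = node (cj ?u x) (cj ?s y) \<or> \<mu> = node (cj ?u y) (cj ?s x) \<or> \<mu> = node (cj ?s y) (cj ?u x)"
    using gi xy(3) h(2) by (auto simp: cj_node cj_node_swap)
  then show ?thesis using s[OF xy(1)] s[OF xy(2)] u[OF xy(1)] u[OF xy(2)] by metis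
qed

text \<open>The normal closure of the generators of free index. It can be planted in either half,
  and modulo it only the involutions \<open>g k (r - 1)\<close> and \<open>g k N\<close> are left,
  which generate a dihedral group.\<close>

definition \<Theta> :: "nat \<Rightarrow> taut set" where "\<Theta> k = gen (\<Union>i\<in>{i. 1 \<le> i \<and> i \<le> N \<and> free i}. Lam k i)"

lemma subgp_\<Theta>: "subgp (\<Theta> k)" unfolding \<Theta>_def by (rule subgp_gen)

lemma gen_cj_closed:
  assumes "\<And>x h. x \<in> S \<Longrightarrow> h \<in> H \<Longrightarrow> cj x h \<in> S" "x \<in> gen S" "h \<in> H" shows "cj x h \<in> gen S"
  using assms(2) by induction (use assms(1,3) in \<open>auto simp: cj_simps intro: gen.intros\<close>)

lemma \<Theta>_cj: "x \<in> \<Theta> k \<Longrightarrow> h \<in> G k \<Longrightarrow> cj x h \<in> \<Theta> k"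
  unfolding \<Theta>_def by (rule gen_cj_closed) (auto intro: Lam_cj)

lemma \<Theta>_lift: "\<theta> \<in> \<Theta> (Suc k) \<Longrightarrow> node \<theta> 0 \<in> G k \<and> node 0 \<theta> \<in> G k"
proof -
  have "subgp {\<theta>. node \<theta> 0 \<in> G k \<and> node 0 \<theta> \<in> G k}"
    unfolding subgp_def
  proof (intro conjI ballI)
    show "0 \<in> {\<theta>. node \<theta> 0 \<in> G k \<and> node 0 \<theta> \<in> G k}" using G_intros(1) by (simp add: node_zero)
    fix x assume x: "x \<in> {\<theta>. node \<theta> 0 \<in> G k \<and> node 0 \<theta> \<in> G k}"
    then show "- x \<in> {\<theta>. node \<theta> 0 \<in> G k \<and> node 0 \<theta> \<in> G k}"
      using G_intros(3)[of "node x 0" k] G_intros(3)[of "node 0 x" k] by (simp add: node_minus)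
    fix y assume "y \<in> {\<theta>. node \<theta> 0 \<in> G k \<and> node 0 \<theta> \<in> G k}"
    then show "x + y \<in> {\<theta>. node \<theta> 0 \<in> G k \<and> node 0 \<theta> \<in> G k}"
      using x G_intros(2)[of "node x 0" k "node y 0"] G_intros(2)[of "node 0 x" k "node 0 y"] by (simp add: node_plus)
  qed
  moreover have "(\<Union>i\<in>{i. 1 \<le> i \<and> i \<le> N \<and> free i}. Lam (Suc k) i) \<subseteq> {\<theta>. node \<theta> 0 \<in> G k \<and> node 0 \<theta> \<in> G k}"
  proof clarify
    fix x i assume i: "1 \<le> i" "i \<le> N" "free i" and x: "x \<in> Lam (Suc k) i"
    have "node x 0 \<in> Lam k (nx i)" using push_Lam[OF i(1,2) x] i(3) by blast
    moreover have "1 \<le> nx i" "nx i \<le> N" using i r1 rN by (auto simp: nx_def)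
    ultimately show "node x 0 \<in> G k \<and> node 0 x \<in> G k" using flip Lam_in_G by blast
  qed
  ultimately have "\<Theta> (Suc k) \<subseteq> {\<theta>. node \<theta> 0 \<in> G k \<and> node 0 \<theta> \<in> G k}" unfolding \<Theta>_def by (rule gen_least)
  then show "\<theta> \<in> \<Theta> (Suc k) \<Longrightarrow> ?thesis" by blast
qed

lemma dihedral_decomp:
  assumes "x \<in> G k"
  shows "\<exists>d\<in>gen {g k (r - 1), g k N}. \<exists>\<theta>\<in>\<Theta> k. x = d + \<theta>"
proof (rule gen_mod_normal[OF subgp_\<Theta>])
  have "gen {g k (r - 1), g k N} \<subseteq> G k" by (rule gen_least[OF subgp_G]) (use r2 rN in \<open>auto intro!: g_in_G\<close>)
  then show "cj x h \<in> \<Theta> k" if "x \<in> \<Theta> k" "h \<in> gen {g k (r - 1), g k N}" for x h using \<Theta>_cj that by blast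
  show "x \<in> gen (g k ` {1..N})" using assms unfolding G_def .
  show "g k ` {1..N} \<subseteq> gen {g k (r - 1), g k N} \<union> \<Theta> k"
  proof clarify
    fix i assume i: "i \<in> {1..N}" "g k i \<notin> \<Theta> k"
    have "\<not> free i" using i g_in_Lam unfolding \<Theta>_def by (auto intro: gen_incl)
    then show "g k i \<in> gen {g k (r - 1), g k N}" unfolding free_def by (auto intro: gen_incl)
  qed
qed

text \<open>\<open>g k N\<close> acts on one half only, by an involution \<open>u\<close>, so with
  \<open>swap\<close> it generates a dihedral group of order at most eight; the only conjugates of
  \<open>swap\<close> there are \<open>swap\<close> and \<open>node u u + swap\<close>.\<close>

lemma comm_self_cj:
  assumes "N \<noteq> r" "d \<in> gen {swap, g k N}"
  shows "cj swap d = swap \<or> cj swap d = cj swap (g k N)"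
proof -
  define u where "u = g (Suc k) (N - 1)"
  have gN: "g k N = node 0 u \<or> g k N = node u 0"
    using g_other[of N k] N3 assms(1) by (auto simp: sib_def u_def)
  have u2: "- u = u" using g_invol[of "Suc k" "N - 1"] minus_unique unfolding u_def by blast
  have S: "cj swap (g k N) = node u u + swap"
    using gN by (auto simp: cj_def wreath u2)
  have gm: "- g k N = g k N" using g_invol minus_unique by blast
  have 1: "cj (node u u + swap) swap = node u u + swap" by (simp add: cj_def wreath)
  have 2: "cj (node u u + swap) (g k N) = swap"
    using S cj_cancel(1)[of swap "g k N"] gm by simp
  have closed: "cj x h \<in> {swap, node u u + swap}"
    if "x \<in> {swap, node u u + swap}" "h \<in> gen {swap, g k N}" for x h
    using that(2,1)
  proof (induction arbitrary: x)
    case gen_zero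
    then show ?case by (simp add: cj_simps)
  next
    case (gen_incl h)
    then show ?case using 1 2 S cj_simps(6) by auto
  next
    case (gen_add h h')
    then show ?case by (metis cj_simps(5))
  next
    case (gen_minus h)
    \<comment> \<open>Conjugation by \<open>h\<close> maps this set of at most two elements
      injectively into itself, so it permutes the set, and conjugation by \<open>- h\<close> does so
      too.\<close>
    have "cj swap h \<in> {swap, node u u + swap}" "cj (node u u + swap) h \<in> {swap, node u u + swap}"
      using gen_minus.IH by auto
    moreover have "cj swap h \<noteq> cj (node u u + swap) h \<or> swap = node u u + swap"
      by (metis cj_cancel(1))
    ultimately have "\<exists>y\<in>{swap, node u u + swap}. cj y h = x" using gen_minus.prems by auto
    then show ?case by (metis cj_cancel(1))
  qed
  show ?thesis using closed[of swap d] assms(2) S by auto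
qed

text \<open>For \<open>r > 2\<close> both elements act on one half only and \<open>swap\<close> lies
  in \<open>\<Theta> k\<close>, so one of them can be moved to the opposite half. For
  \<open>r = 2\<close> both are conjugates of \<open>swap\<close>; modulo \<open>\<Theta> k\<close>
  the conjugating elements differ by a member of the dihedral group of \<open>swap\<close> and
  \<open>g k N\<close>, where all conjugates of \<open>swap\<close> commute with it.\<close>

lemma commuting_conj:
  assumes "\<alpha> \<in> Lam k (r - 1)" "\<beta> \<in> Lam k (r - 1)"
  shows "\<exists>\<theta>\<in>\<Theta> k. comm \<alpha> (cj \<beta> \<theta>) = 0"
proof (cases "r = 2")
  case False
  then have r3: "3 \<le> r" using r2 by simp
  have sw: "swap \<in> \<Theta> k"
  proof -
    have "free 1" using r3 N3 by (simp add: free_def)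
    moreover have "swap \<in> Lam k 1" using g_in_Lam[of k 1] by (simp only: g1_swap)
    ultimately show ?thesis unfolding \<Theta>_def using N3 by (intro gen_incl UN_I[of 1]) auto
  qed
  have form: "\<exists>a. x = node a 0 \<or> x = node 0 a" if x: "x \<in> Lam k (r - 1)" for x
  proof -
    have "2 \<le> r - 1" "r - 1 \<le> N" "r - 1 \<noteq> r" using r3 rN by auto
    then show ?thesis using Lam_form[OF x] by metis
  qed
  obtain a b where ab: "\<alpha> = node a 0 \<or> \<alpha> = node 0 a" "\<beta> = node b 0 \<or> \<beta> = node 0 b" using form assms by metis
  have fl: "cj (node x y) swap = node y x" for x y by (simp add: cj_def wreath)
  have "comm \<alpha> (cj \<beta> 0) = 0 \<or> comm \<alpha> (cj \<beta> swap) = 0"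
    using ab by (auto simp: fl cj_simps comm_node node_zero)
  then show ?thesis using sw subgpD(1)[OF subgp_\<Theta>] by blast
next
  case True
  then have rr: "r - 1 = 1" "N \<noteq> r" using N3 by auto
  obtain h h' where h: "h \<in> G k" "h' \<in> G k" "\<alpha> = cj swap h" "\<beta> = cj swap h'"
    using assms unfolding Lam_def rr g1_swap by auto
  obtain d \<theta> where d: "d \<in> gen {swap, g k N}" "\<theta> \<in> \<Theta> k" "h' - h = d + \<theta>"
    using dihedral_decomp[OF G_intros(4)[OF h(2,1)]] unfolding rr g1_swap by blast
  have h': "h' = d + \<theta> + h" using d(3) by (metis diff_add_cancel)
  have comS: "comm swap (cj swap d) = 0"
  proof -
    have gm: "- g k N = g k N" using g_invol minus_unique by blast
    define u where "u = g (Suc k) (N - 1)"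
    have gN: "g k N = node 0 u \<or> g k N = node u 0"
      using g_other[of N k] N3 rr(2) by (auto simp: sib_def u_def)
    have u2: "- u = u" using g_invol[of "Suc k" "N - 1"] minus_unique unfolding u_def by blast
    have u3: "u + u = 0" using g_invol unfolding u_def .
    have S: "cj swap (g k N) = node u u + swap" using gN by (auto simp: cj_def wreath u2)
    have "comm swap (node u u + swap) = 0" by (simp add: comm_def cj_def wreath u2 u3)
    moreover have "comm swap swap = 0" by (simp add: comm_def cj_simps)
    ultimately show ?thesis using comm_self_cj[OF rr(2) d(1)] S by metis
  qed
  \<comment> \<open>Chosen so that \<open>h' + ?t = d + h\<close>: the part of \<open>h'\<close> in
    \<open>\<Theta> k\<close> disappears.\<close>
  let ?t = "cj (- \<theta>) h"
  have "?t \<in> \<Theta> k" using \<Theta>_cj[OF subgpD(3)[OF subgp_\<Theta> d(2)] h(1)] .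
  moreover have "cj \<beta> ?t = cj (cj swap d) h"
  proof -
    have "h' + ?t = d + h" unfolding h' cj_def by (simp add: add.assoc diff_conv_add_uminus del: add_uminus_conv_diff)
    then show ?thesis unfolding h(4) by (simp only: cj_simps(5))
  qed
  moreover have "comm \<alpha> (cj (cj swap d) h) = cj (comm swap (cj swap d)) h"
    unfolding h(3) comm_def by (simp add: cj_def minus_add add.assoc diff_conv_add_uminus del: add_uminus_conv_diff)
  ultimately show ?thesis using comS by (metis cj_simps(1))
qed

text \<open>No index from \<open>r\<close> on equals \<open>r - 1\<close>, so both lifts have a
  nontrivial other coordinate only if \<open>i = j = N\<close>. Those coordinates are then
  conjugates of the generator of index \<open>r - 1\<close>, and an element of
  \<open>\<Theta>\<close> planted in that half conjugates one of them so that the two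
  commute.\<close>

lemma push_comm:
  assumes i: "r \<le> i" "i \<le> N" and j: "r \<le> j" "j \<le> N" and a: "a \<in> Lam (Suc k) i" and b: "b \<in> Lam (Suc k) j"
  shows "\<exists>L\<in>Lam k (nx i). \<exists>M\<in>Lam k (nx j). rig [c] (comm a b) = comm L M"
proof -
  have ij: "1 \<le> i" "1 \<le> j" "i \<noteq> r - 1" "j \<noteq> r - 1" using i j r2 by auto
  obtain \<nu> where \<nu>: "node a \<nu> \<in> Lam k (nx i)" "free i \<longrightarrow> \<nu> = 0" "i = N \<longrightarrow> \<nu> \<in> Lam (Suc k) (r - 1)"
    using push_Lam[OF ij(1) i(2) a] by blast
  obtain \<mu> where \<mu>: "node b \<mu> \<in> Lam k (nx j)" "free j \<longrightarrow> \<mu> = 0" "j = N \<longrightarrow> \<mu> \<in> Lam (Suc k) (r - 1)"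
    using push_Lam[OF ij(2) j(2) b] by blast
  have "\<exists>\<mu>'. node b \<mu>' \<in> Lam k (nx j) \<and> comm \<nu> \<mu>' = 0"
  proof (cases "i = N \<and> j = N")
    case True
    then obtain \<theta> where \<theta>: "\<theta> \<in> \<Theta> (Suc k)" "comm \<nu> (cj \<mu> \<theta>) = 0" using commuting_conj \<nu>(3) \<mu>(3) by blast
    have "cj (node b \<mu>) (node 0 \<theta>) \<in> Lam k (nx j)" using Lam_cj[OF \<mu>(1)] \<Theta>_lift[OF \<theta>(1)] by blast
    then show ?thesis using \<theta>(2) by (auto simp: cj_node cj_simps)
  next
    case False
    then have "\<nu> = 0 \<or> \<mu> = 0" using \<nu>(2) \<mu>(2) ij unfolding free_def by blast
    then show ?thesis using \<mu>(1) by auto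
  qed
  then obtain \<mu>' where \<mu>': "node b \<mu>' \<in> Lam k (nx j)" "comm \<nu> \<mu>' = 0" by blast
  show ?thesis
  proof (cases c)
    case False
    have "rig [c] (comm a b) = comm (node a \<nu>) (node b \<mu>')" using \<mu>'(2) False by (simp add: comm_node)
    then show ?thesis using \<nu>(1) \<mu>'(1) by blast
  next
    case True
    have "rig [c] (comm a b) = comm (node \<nu> a) (node \<mu>' b)" using \<mu>'(2) True by (simp add: comm_node)
    then show ?thesis using flip[OF \<nu>(1)] flip[OF \<mu>'(1)] by blast
  qed
qed

lemma comm_rigid:
  assumes "r \<le> i" "i \<le> N" "r \<le> j" "j \<le> N" "a \<in> Lam (k + length y) i" "b \<in> Lam (k + length y) j"
  shows "rig y (comm a b) \<in> G k"
  using assms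
proof (induction y arbitrary: i j a b rule: rev_induct)
  case Nil
  then show ?case using Lam_in_G[of i a k] Lam_in_G[of j b k] comm_in_G r1 by simp
next
  case (snoc c y)
  obtain a' b' where *: "a' \<in> Lam (k + length y) (nx i)" "b' \<in> Lam (k + length y) (nx j)" "rig [c] (comm a b) = comm a' b'"
    using push_comm[of i j a "k + length y" b c] snoc.prems by auto
  have "r \<le> nx i" "nx i \<le> N" "r \<le> nx j" "nx j \<le> N" using snoc.prems rN by (auto simp: nx_def)
  then have "rig y (comm a' b') \<in> G k" using snoc.IH *(1,2) by blast
  then show ?case by (simp only: rig_append *(3))
qed

lemma comm_in_R:
  assumes "r \<le> i" "i \<le> N" "r \<le> j" "j \<le> N" "a \<in> Lam (k + m) i" "b \<in> Lam (k + m) j"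
  shows "comm a b \<in> R k m"
  unfolding R_def using comm_rigid assms by blast

text \<open>The commutator subgroup of \<open>R k m\<close> with \<open>G (k + m)\<close>. Planted
  at a suitable level it will be killed by every retraction onto the cyclic group of the
  odometer.\<close>

definition Y :: "nat \<Rightarrow> nat \<Rightarrow> taut set" where
  "Y k m = gen {- cj u w + u | u w. u \<in> R k m \<and> w \<in> G (k + m)}"

lemma subgp_Y: "subgp (Y k m)" unfolding Y_def by (rule subgp_gen)

lemma Y_incl: "u \<in> R k m \<Longrightarrow> w \<in> G (k + m) \<Longrightarrow> - cj u w + u \<in> Y k m"
  unfolding Y_def by (rule gen_incl) blast

lemma Y_cj: assumes "y \<in> Y k m" "h \<in> G (k + m)" shows "cj y h \<in> Y k m"
  unfolding Y_def
proof (rule gen_cj_closed[OF _ assms(1)[unfolded Y_def] assms(2)])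
  fix x h assume "x \<in> {- cj u w + u | u w. u \<in> R k m \<and> w \<in> G (k + m)}" and h: "h \<in> G (k + m)"
  then obtain u w where u: "u \<in> R k m" "w \<in> G (k + m)" "x = - cj u w + u" by blast
  have "cj x h = - cj (cj u h) (cj w h) + cj u h"
    unfolding u(3) by (simp add: cj_def minus_add add.assoc diff_conv_add_uminus del: add_uminus_conv_diff)
  then show "cj x h \<in> {- cj u w + u | u w. u \<in> R k m \<and> w \<in> G (k + m)}"
    using R_normal[OF u(1) h] G_intros(5)[OF u(2) h] by blast
qed

lemma Y_sub_R: "Y k m \<subseteq> R k m"
  unfolding Y_def by (rule gen_least[OF subgp_R]) (auto intro!: subgpD(2,3)[OF subgp_R] R_normal)

lemma Y_incl': assumes "u \<in> R k m" "w \<in> G (k + m)" shows "cj u w - u \<in> Y k m"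
proof -
  have "cj (- (- cj u w + u)) (- u) \<in> Y k m"
    using Y_cj[OF subgpD(3)[OF subgp_Y Y_incl[OF assms]]] G_intros(3)[OF R_sub_G[OF assms(1)]] by blast
  moreover have "cj (- (- cj u w + u)) (- u) = cj u w - u"
    by (simp add: cj_def[of _ "- u"] minus_add add.assoc diff_conv_add_uminus del: add_uminus_conv_diff)
  ultimately show ?thesis by simp
qed

text \<open>Elements of \<open>R\<close> are central modulo \<open>Y\<close>, so those of order at most two modulo \<open>Y\<close> form a subgroup.\<close>

definition Z :: "nat \<Rightarrow> nat \<Rightarrow> taut set" where "Z k m = {z \<in> R k m. z + z \<in> Y k m}"

lemma subgp_Z: "subgp (Z k m)"
  unfolding subgp_def
proof (intro conjI ballI)
  show "0 \<in> Z k m" unfolding Z_def using subgpD(1)[OF subgp_R] subgpD(1)[OF subgp_Y] by simp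
  fix x assume x: "x \<in> Z k m"
  then show "- x \<in> Z k m" unfolding Z_def
    using subgpD(3)[OF subgp_R] subgpD(3)[OF subgp_Y, of "x + x"] by (simp add: minus_add)
  fix y assume y: "y \<in> Z k m"
  have "x + y + (x + y) = (x + x) + ((cj y x - y) + (y + y))"
    by (simp add: cj_def add.assoc diff_conv_add_uminus del: add_uminus_conv_diff)
  moreover have "cj y x - y \<in> Y k m" using Y_incl' x y R_sub_G unfolding Z_def by blast
  ultimately have "x + y + (x + y) \<in> Y k m" using x y subgpD(2)[OF subgp_Y] unfolding Z_def by simp
  then show "x + y \<in> Z k m" using x y subgpD(2)[OF subgp_R] unfolding Z_def by simp
qed

lemma Z_cj: "z \<in> Z k m \<Longrightarrow> h \<in> G (k + m) \<Longrightarrow> cj z h \<in> Z k m"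
  unfolding Z_def using R_normal Y_cj[of "z + z" k m h] by (simp add: cj_simps)

text \<open>Conjugates of the generators at the periodic post-critical points, the indices that
  \<open>nx\<close> permutes; their commutators are rigid by \<open>comm_rigid\<close>.\<close>

definition P :: "nat \<Rightarrow> taut set" where "P n = (\<Union>i\<in>{r..N}. Lam n i)"

lemma P_in_G: "s \<in> P n \<Longrightarrow> s \<in> G n"
proof -
  assume "s \<in> P n"
  then obtain i where "r \<le> i" "i \<le> N" "s \<in> Lam n i" unfolding P_def by auto
  then show ?thesis using Lam_in_G[of i s n] r1 by simp
qed

lemma P_invol: "s \<in> P n \<Longrightarrow> s + s = 0" "s \<in> P n \<Longrightarrow> - s = s"
  unfolding P_def using Lam_invol Lam_minus by blast+

text \<open>Conjugation by the involution \<open>s\<close> inverts the commutator of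
  \<open>s\<close> and \<open>t\<close>, so twice this commutator is itself a commutator of an
  element of \<open>R\<close> with \<open>s\<close>.\<close>

lemma comm_P_in_Z:
  assumes "s \<in> P (k + m)" "t \<in> P (k + m)" shows "comm s t \<in> Z k m"
proof -
  have R: "comm s t \<in> R k m" using assms comm_in_R unfolding P_def by auto
  have st: "comm s t = s + t + s + t" unfolding comm_def cj_def using P_invol(2)[OF assms(1)] P_invol(2)[OF assms(2)] by (simp add: add.assoc)
  have ss: "s + (s + x) = x" for x using P_invol(1)[OF assms(1)] by (simp flip: add.assoc)
  have "- cj (comm s t) s + comm s t = comm s t + comm s t"
    unfolding cj_def st using P_invol(2)[OF assms(1)] P_invol(2)[OF assms(2)]
    by (simp add: minus_add add.assoc ss diff_conv_add_uminus del: add_uminus_conv_diff)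
  then show ?thesis using Y_incl[OF R P_in_G[OF assms(1)]] R unfolding Z_def by simp
qed

definition A :: "nat \<Rightarrow> taut set" where "A n = gen (P n)"

lemma A_cj: "x \<in> A n \<Longrightarrow> h \<in> G n \<Longrightarrow> cj x h \<in> A n"
  unfolding A_def by (rule gen_cj_closed) (auto simp: P_def intro: Lam_cj)

text \<open>The elements of \<open>P n\<close> are their own inverses, so \<open>A n\<close> is
  reached from \<open>0\<close> by adding them on the right. For the case of inverses the claim is
  strengthened to right translation by \<open>a\<close> and by \<open>- a\<close> together.\<close>

lemma A_induct [consumes 1, case_names zero add]:
  assumes "a \<in> A n" "Q 0" "\<And>a s. a \<in> A n \<Longrightarrow> Q a \<Longrightarrow> s \<in> P n \<Longrightarrow> Q (a + s)"
  shows "Q a"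
proof -
  have "(\<forall>b\<in>A n. Q b \<longrightarrow> Q (b + a)) \<and> (\<forall>b\<in>A n. Q b \<longrightarrow> Q (b - a)) \<and> a \<in> A n"
    using assms(1)[unfolded A_def]
  proof induction
    case gen_zero
    then show ?case by (auto simp: A_def intro: gen.gen_zero)
  next
    case (gen_incl x)
    have "- x = x" using P_invol(2)[OF gen_incl] .
    then have "b - x = b + x" for b by (metis diff_conv_add_uminus)
    then show ?case using assms(3) gen_incl by (auto simp: A_def intro: gen.gen_incl)
  next
    case (gen_add x y)
    have "b + x \<in> A n" "b - y \<in> A n" if "b \<in> A n" for b
      using that gen_add.IH subgpD(2,4)[OF subgp_gen[of "P n", folded A_def]] by auto
    then have "Q (b + x + y)" "Q (b - y - x)" if "b \<in> A n" "Q b" for b using that gen_add.IH by blast+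
    then show ?case using gen_add.IH subgpD(2)[OF subgp_gen[of "P n", folded A_def]]
      by (simp add: add.assoc diff_diff_eq2 diff_conv_add_uminus minus_add del: add_uminus_conv_diff)
  next
    case (gen_minus x)
    then show ?case using subgpD(3)[OF subgp_gen[of "P n", folded A_def]] by simp
  qed
  moreover have "0 \<in> A n" unfolding A_def by (rule gen.gen_zero)
  ultimately show ?thesis using assms(2) by force
qed

lemma cj_P_A:
  assumes "a \<in> A (k + m)" "s \<in> P (k + m)" shows "cj s a - s \<in> Z k m"
  using assms(1)
proof (induction rule: A_induct)
  case zero
  then show ?case using subgpD(1)[OF subgp_Z] by (simp add: cj_simps)
next
  case (add a t)
  have "cj s (a + t) - s = cj (cj s a - s) t + comm t s"
  proof -
    have "cj s (a + t) - s = cj (cj s a - s + s) t - s" by (simp add: cj_simps)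
    also have "\<dots> = cj (cj s a - s) t + (cj s t - s)" by (simp only: cj_simps(3) add_diff_eq)
    also have "cj s t - s = comm t s"
      unfolding comm_def cj_def using P_invol(2)[OF add.hyps(2)] P_invol(2)[OF assms(2)]
      by (simp add: add.assoc diff_conv_add_uminus del: add_uminus_conv_diff)
    finally show ?thesis .
  qed
  then show ?case using subgpD(2)[OF subgp_Z Z_cj[OF add.IH P_in_G[OF add.hyps(2)]] comm_P_in_Z[OF add.hyps(2) assms(2)]] by simp
qed

text \<open>Modulo \<open>Z\<close> the group \<open>A\<close> is generated by commuting
  involutions.\<close>

lemma double_A: assumes "a \<in> A (k + m)" shows "a + a \<in> Z k m"
  using assms
proof (induction rule: A_induct)
  case zero
  then show ?case using subgpD(1)[OF subgp_Z] by simp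
next
  case (add a s)
  have "a + s + (a + s) = (a + a) + (cj s a - s)"
    using P_invol(2)[OF add.hyps(2)] by (simp add: cj_def add.assoc diff_conv_add_uminus del: add_uminus_conv_diff)
  then show ?case using subgpD(2)[OF subgp_Z add.IH cj_P_A[OF add.hyps]] by simp
qed

lemma mul4: "mul 4 a = (a + a) + (a + a)" for a :: "'a::group_add"
  by (simp add: numeral_eq_Suc add.assoc)

lemma mul_node: "mul n (node a b) = node (mul n a) (mul n b)"
  by (induction n) (auto simp: node_zero node_plus)

lemma mul_two: "mul (2 ^ Suc s) x = mul (2 ^ s) (x + x)" for x :: "'a::group_add"
proof -
  have "mul 2 x = x + x" by (simp add: numeral_2_eq_2)
  then show ?thesis using mul_mult[of "2 ^ s" 2 x] by (simp add: mult.commute)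
qed

text \<open>Below index \<open>r\<close> every sibling is trivial, so the sections of the first
  \<open>Suc s\<close> generators involve only the first \<open>s\<close>. Doubling an element
  removes its swap and leaves two coordinates in the smaller group, which costs one factor two per
  index.\<close>

lemma head_torsion: "s < r \<Longrightarrow> x \<in> gen (g n ` {1..s}) \<Longrightarrow> mul (2 ^ s) x = 0"
proof (induction s arbitrary: n x)
  case 0
  have "gen {} \<subseteq> {0::taut}" by (rule gen_least) (auto simp: subgp_def)
  then show ?case using 0 by auto
next
  case (Suc s)
  let ?F = "gen (g (Suc n) ` {1..s})"
  have sF: "subgp ?F" by (rule subgp_gen)
  let ?W = "{x. \<exists>a\<in>?F. \<exists>b\<in>?F. x = node a b \<or> x = node a b + swap}"
  have "subgp ?W"
    unfolding subgp_def
  proof (intro conjI ballI)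
    show "0 \<in> ?W" using subgpD(1)[OF sF] node_zero by force
    fix x assume "x \<in> ?W"
    then obtain a b where x: "a \<in> ?F" "b \<in> ?F" "x = node a b \<or> x = node a b + swap" by auto
    have "- x = node (- a) (- b) \<or> - x = node (- b) (- a) + swap" using x(3) by (auto simp: wreath)
    then show "- x \<in> ?W" using x subgpD(3)[OF sF] by blast
    fix y assume "y \<in> ?W"
    then obtain c d where y: "c \<in> ?F" "d \<in> ?F" "y = node c d \<or> y = node c d + swap" by auto
    have "x + y = node (a + c) (b + d) \<or> x + y = node (a + d) (b + c) \<or> x + y = node (a + c) (b + d) + swap
      \<or> x + y = node (a + d) (b + c) + swap"
      using x(3) y(3) by (auto simp: wreath)
    then show "x + y \<in> ?W" using x y subgpD(2)[OF sF] by blast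
  qed
  moreover have "g n ` {1..Suc s} \<subseteq> ?W"
  proof clarify
    fix i assume i: "i \<in> {1..Suc s}"
    show "\<exists>a\<in>?F. \<exists>b\<in>?F. g n i = node a b \<or> g n i = node a b + swap"
    proof (cases "i = 1")
      case True
      then show ?thesis using g1_swap[of n] subgpD(1)[OF sF]
        by (intro bexI[of _ 0]) (auto simp: node_zero)
    next
      case False
      then have "i - 1 \<in> {1..s}" using i by auto
      then have u: "g (Suc n) (i - 1) \<in> ?F" by (intro gen_incl imageI)
      have "sib n i = 0" using i Suc.prems(1) by (simp add: sib_def)
      then show ?thesis using g_other[OF False, of n] u subgpD(1)[OF sF] by metis
    qed
  qed
  ultimately have "gen (g n ` {1..Suc s}) \<subseteq> ?W" by (rule gen_least)
  then obtain a b where ab: "a \<in> ?F" "b \<in> ?F" "x = node a b \<or> x = node a b + swap" using Suc.prems(2) by blast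
  have "\<exists>c\<in>?F. \<exists>d\<in>?F. x + x = node c d"
    using ab(3)
  proof
    assume "x = node a b"
    then have "x + x = node (a + a) (b + b)" by (simp add: node_plus)
    then show ?thesis using subgpD(2)[OF sF] ab(1,2) by blast
  next
    assume "x = node a b + swap"
    then have "x + x = node (a + b) (b + a)" by (simp add: wreath)
    then show ?thesis using subgpD(2)[OF sF] ab(1,2) by blast
  qed
  then obtain c d where cd: "c \<in> ?F" "d \<in> ?F" "x + x = node c d" by blast
  then show ?case using Suc.IH[of c "Suc n"] Suc.IH[of d "Suc n"] Suc.prems(1) by (simp only: mul_two mul_node) (simp add: node_zero)
qed

lemma mod_A:
  assumes "x \<in> G n" shows "\<exists>f\<in>gen (g n ` {1..r - 1}). \<exists>a\<in>A n. x = f + a"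
proof (rule gen_mod_normal)
  show "subgp (A n)" unfolding A_def by (rule subgp_gen)
  have "gen (g n ` {1..r - 1}) \<subseteq> G n" by (rule gen_least[OF subgp_G]) (use rN in \<open>auto intro!: g_in_G\<close>)
  then show "cj x h \<in> A n" if "x \<in> A n" "h \<in> gen (g n ` {1..r - 1})" for x h using A_cj that by blast
  show "x \<in> gen (g n ` {1..N})" using assms unfolding G_def .
  show "g n ` {1..N} \<subseteq> gen (g n ` {1..r - 1}) \<union> A n"
  proof clarify
    fix i assume i: "i \<in> {1..N}" "g n i \<notin> A n"
    have "\<not> r \<le> i"
    proof
      assume "r \<le> i"
      then have "g n i \<in> P n" unfolding P_def using i(1) g_in_Lam[of n i] by auto
      then show False using i(2) unfolding A_def by (auto intro: gen_incl)
    qed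
    then show "g n i \<in> gen (g n ` {1..r - 1})" using i(1) by (intro gen_incl imageI) auto
  qed
qed

lemma mul_mod_normal:
  assumes "subgp M" "f \<in> S" "\<And>x n. x \<in> M \<Longrightarrow> cj x f \<in> M" "a \<in> M"
  shows "\<exists>a'\<in>M. mul n (f + a) = mul n f + a'"
proof (induction n)
  case 0
  then show ?case using subgpD(1)[OF assms(1)] by auto
next
  case (Suc n)
  then obtain a' where a': "a' \<in> M" "mul n (f + a) = mul n f + a'" by blast
  have "mul (Suc n) (f + a) = mul (Suc n) f + (cj a' f + a)" using a' by (simp add: cj_def add.assoc)
  then show ?case using subgpD(2)[OF assms(1) assms(3)[OF a'(1)] assms(4)] by blast
qed

text \<open>The factor \<open>2 ^ (r - 1)\<close> annihilates the generators before the cycle and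
  leaves an element of \<open>A\<close>; doubling it leads into \<open>Z\<close>, and doubling once
  more into \<open>Y\<close>.\<close>

lemma torsion_mod_Y:
  assumes "x \<in> G (k + m)" shows "mul (4 * 2 ^ (r - 1)) x \<in> Y k m"
proof -
  let ?n = "k + m"
  obtain f a where fa: "f \<in> gen (g ?n ` {1..r - 1})" "a \<in> A ?n" "x = f + a" using mod_A[OF assms] by blast
  have "gen (g ?n ` {1..r - 1}) \<subseteq> G ?n" by (rule gen_least[OF subgp_G]) (use rN in \<open>auto intro!: g_in_G\<close>)
  then have fG: "f \<in> G ?n" using fa by blast
  have sA: "subgp (A ?n)" unfolding A_def by (rule subgp_gen)
  obtain a' where a': "a' \<in> A ?n" "mul (2 ^ (r - 1)) x = mul (2 ^ (r - 1)) f + a'"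
    using mul_mod_normal[OF sA fG A_cj[OF _ fG] fa(2)] fa(3) by blast
  have "mul (2 ^ (r - 1)) f = 0" by (rule head_torsion[OF _ fa(1)]) (use r1 in simp)
  then have "mul (2 ^ (r - 1)) x = a'" using a' by simp
  then have "mul (4 * 2 ^ (r - 1)) x = (a' + a') + (a' + a')" by (simp only: mul_mult mul4)
  then show ?thesis using double_A[OF a'(1)] unfolding Z_def by simp
qed

end

context preperiodic_kneading
begin

subsection \<open>The odometer\<close>

definition word :: "nat \<Rightarrow> nat list \<Rightarrow> taut" where "word n is = sum_list (map (g n) is)"

lemma word_append: "word n (xs @ ys) = word n xs + word n ys"
  by (simp add: word_def)

text \<open>All products in which each generator occurs exactly once. The order is left open because
  the sections of the square of such a product are again of this form, but with the factors
  permuted.\<close>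

definition odo :: "nat \<Rightarrow> taut set" where
  "odo n = {word n is | is. mset is = (\<Sum>i\<in>{1..N}. {#i#})}"

text \<open>The indices of the generators, at most one, that make up the section of
  \<open>g n i\<close> at \<open>c\<close> for \<open>i\<close> other than \<open>1\<close>.\<close>

definition ind :: "nat \<Rightarrow> bool \<Rightarrow> nat \<Rightarrow> nat list" where
  "ind n c i = (if \<epsilon> n i = c then [i - 1] else if i = r then [N] else [])"

lemma ind_word: "i \<noteq> 1 \<Longrightarrow> g n i = node (word (Suc n) (ind n False i)) (word (Suc n) (ind n True i))"
  using g_other[of i n] by (simp add: ind_def word_def sib_def)

lemma word_split: "1 \<notin> set xs \<Longrightarrow> word n xs = node (word (Suc n) (concat (map (ind n False) xs))) (word (Suc n) (concat (map (ind n True) xs)))"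
proof (induction xs)
  case Nil
  then show ?case by (simp add: word_def node_zero)
next
  case (Cons i xs)
  have "word n (i # xs) = g n i + word n xs" by (simp add: word_def)
  also have "g n i = node (word (Suc n) (ind n False i)) (word (Suc n) (ind n True i))"
    by (rule ind_word) (use Cons.prems in auto)
  finally show ?case using Cons by (simp add: node_plus word_append)
qed

lemma sum_singletons: "finite S \<Longrightarrow> sum_mset (image_mset f (\<Sum>i\<in>S. {#i#})) = (\<Sum>i\<in>S. f i)"
  by (induction S rule: finite_induct) auto

text \<open>The index \<open>1\<close> contributes the only swap. Every other \<open>i\<close>
  contributes \<open>i - 1\<close> to one of the halves and \<open>r\<close> contributes
  \<open>N\<close> to the opposite one, so altogether each index from \<open>1\<close> to
  \<open>N\<close> occurs once; the coordinates of the double collect both halves.\<close>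

lemma odo_split:
  assumes "\<beta> \<in> odo n"
  obtains a b where "\<beta> = node a b + swap" "\<beta> + \<beta> = node (a + b) (b + a)" "a + b \<in> odo (Suc n)" "b + a \<in> odo (Suc n)"
proof -
  obtain "is" where is_: "\<beta> = word n is" "mset is = (\<Sum>i\<in>{1..N}. {#i#})" using assms unfolding odo_def by blast
  have ins: "{1..N} = insert 1 {2..N}" using N3 by auto
  have ms: "mset is = {#1#} + (\<Sum>i\<in>{2..N}. {#i#})" unfolding is_(2) ins by simp
  have "1 \<in> set is" using ms by (metis in_multiset_in_set add_mset_add_single union_commute union_single_eq_member)
  then obtain xs ys where xy: "is = xs @ 1 # ys" by (meson split_list)
  have m: "mset (xs @ ys) = (\<Sum>i\<in>{2..N}. {#i#})" using ms unfolding xy by simp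
  have fin: "set_mset (\<Sum>i\<in>{2..N}. {#i#}) = {2..N}" by (simp add: set_mset_sum)
  have s: "set (xs @ ys) = {2..N}" using m fin by (metis set_mset_mset)
  have "1 \<notin> set (xs @ ys)" unfolding s by simp
  then have n1: "1 \<notin> set xs" "1 \<notin> set ys" by auto
  define F where "F zs = concat (map (ind n False) zs)" for zs
  define T where "T zs = concat (map (ind n True) zs)" for zs
  define a where "a = word (Suc n) (F xs @ T ys)"
  define b where "b = word (Suc n) (T xs @ F ys)"
  have bet: "\<beta> = node a b + swap"
  proof -
    have "\<beta> = word n xs + (swap + word n ys)" unfolding is_(1) xy by (simp add: word_def g1_swap[unfolded One_nat_def])
    then show ?thesis unfolding word_split[OF n1(1)] word_split[OF n1(2)] a_def b_def word_append F_def T_def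
      by (simp add: wreath)
  qed
  have count: "mset (F zs) + mset (T zs) = sum_mset (image_mset (\<lambda>i. {#i - 1#} + (if i = r then {#N#} else {#})) (mset zs))" for zs
  proof (induction zs)
    case (Cons i zs)
    have "mset (ind n False i) + mset (ind n True i) = {#i - 1#} + (if i = r then {#N#} else {#})"
      by (auto simp: ind_def)
    then show ?case using Cons by (simp add: F_def T_def ac_simps)
  qed (simp add: F_def T_def)
  have tot: "mset (F xs) + mset (T xs) + (mset (F ys) + mset (T ys)) = (\<Sum>i\<in>{1..N}. {#i#})"
  proof -
    have "mset (F xs) + mset (T xs) + (mset (F ys) + mset (T ys))
      = sum_mset (image_mset (\<lambda>i. {#i - 1#} + (if i = r then {#N#} else {#})) (mset (xs @ ys)))"
      by (simp add: count)
    also have "\<dots> = (\<Sum>i\<in>{2..N}. {#i - 1#} + (if i = r then {#N#} else {#}))" unfolding m by (rule sum_singletons) simp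
    also have "\<dots> = (\<Sum>i\<in>{2..N}. {#i - 1#}) + (\<Sum>i\<in>{2..N}. if i = r then {#N#} else {#})" by (rule sum.distrib)
    also have "(\<Sum>i\<in>{2..N}. if i = r then {#N#} else {#}) = {#N#}" using r2 rN by (simp add: sum.delta)
    also have "(\<Sum>i\<in>{2..N}. {#i - 1#}) = (\<Sum>i\<in>{1..N - 1}. {#i#})"
      by (rule sum.reindex_bij_witness[of _ Suc "\<lambda>i. i - 1"]) (use N3 in auto)
    also have "(\<Sum>i\<in>{1..N - 1}. {#i#}) + {#N#} = (\<Sum>i\<in>{1..N}. {#i#})"
      using N3 sum.cl_ivl_Suc[of "\<lambda>i. {#i#}" 1 "N - 1"] by simp
    finally show ?thesis .
  qed
  have ab: "a + b = word (Suc n) (F xs @ T ys @ T xs @ F ys)" "b + a = word (Suc n) (T xs @ F ys @ F xs @ T ys)"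
    by (simp_all add: a_def b_def word_append add.assoc)
  have "a + b \<in> odo (Suc n)" "b + a \<in> odo (Suc n)"
    unfolding ab odo_def using tot by (auto simp: ac_simps intro!: exI)
  moreover have "\<beta> + \<beta> = node (a + b) (b + a)" unfolding bet by (simp add: wreath)
  ultimately show ?thesis using that bet by blast
qed

lemma odo_exists: "\<exists>\<beta>. \<beta> \<in> odo n"
proof -
  have "mset [1..<Suc N] = (\<Sum>i\<in>{1..N}. {#i#})"
    by (simp add: mset_upt atLeastLessThanSuc_atLeastAtMost del: upt_Suc)
  then show ?thesis unfolding odo_def by blast
qed

lemma odo_in_G: "\<beta> \<in> odo n \<Longrightarrow> \<beta> \<in> G n"
proof -
  have "word n is \<in> G n" if "set is \<subseteq> {1..N}" for "is"
    using that by (induction "is") (auto simp: word_def G_intros(1) intro!: G_intros(2) g_in_G)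
  moreover have "set is = {1..N}" if "mset is = (\<Sum>i\<in>{1..N}. {#i#})" for "is"
  proof -
    have "set_mset (\<Sum>i\<in>{1..N}. {#i#}) = {1..N}" by (simp add: set_mset_sum)
    then show ?thesis using that by (metis set_mset_mset)
  qed
  ultimately show "\<beta> \<in> odo n \<Longrightarrow> ?thesis" unfolding odo_def by auto
qed

text \<open>Odd multiples exchange the halves. Even multiples have multiples of odometers with half
  the factor as coordinates, so the induction is on the multiplier.\<close>

lemma odo_infinite: "n > 0 \<Longrightarrow> \<beta> \<in> odo k \<Longrightarrow> mul n \<beta> \<noteq> 0"
proof (induction n arbitrary: \<beta> k rule: less_induct)
  case (less n)
  obtain a b where ab: "\<beta> = node a b + swap" "\<beta> + \<beta> = node (a + b) (b + a)" "a + b \<in> odo (Suc k)"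
    using odo_split[OF less.prems(2)] by metis
  have dbl: "mul (2 * m) \<beta> = node (mul m (a + b)) (mul m (b + a))" for m
    using mul_mult[of m 2 \<beta>] by (simp add: mult.commute numeral_2_eq_2 ab(2) mul_node)
  show ?case
  proof (cases "even n")
    case True
    then obtain m where m: "n = 2 * m" by blast
    then have "mul m (a + b) \<noteq> 0" using less.IH[OF _ _ ab(3), of m] less.prems(1) by simp
    then show ?thesis unfolding m dbl node_eq_zero by simp
  next
    case False
    then obtain m where m: "n = Suc (2 * m)" by (metis oddE Suc_eq_plus1)
    have "mul n \<beta> = node (mul m (a + b) + a) (mul m (b + a) + b) + swap"
      unfolding m mul.simps dbl by (simp add: ab(1) wreath)
    then show ?thesis using node_swap_neq[of _ _ 0 0] by (simp add: node_zero)
  qed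
qed

text \<open>Each doubling passes to two odometers one level down, so
  \<open>mul (2 ^ m) \<beta>\<close> acts below every vertex of level \<open>m\<close> as an
  odometer of that level.\<close>

lemma pow_odo_rigid:
  assumes S: "\<And>\<beta>. \<beta> \<in> odo (n + m) \<Longrightarrow> mul J \<beta> \<in> S" and \<beta>: "\<beta> \<in> odo n"
  shows "mul J (mul (2 ^ m) \<beta>) \<in> gen {rig y u | y u. length y = m \<and> u \<in> S}"
  using assms
proof (induction m arbitrary: n \<beta>)
  case 0
  then have "rig [] (mul J \<beta>) \<in> {rig y u | y u. length y = 0 \<and> u \<in> S}" by fastforce
  then show ?case by (auto intro: gen_incl)
next
  case (Suc m)
  let ?H = "gen {rig y u | y u. length y = Suc m \<and> u \<in> S}"
  obtain a b where ab: "\<beta> = node a b + swap" "\<beta> + \<beta> = node (a + b) (b + a)" "a + b \<in> odo (Suc n)" "b + a \<in> odo (Suc n)"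
    using odo_split[OF Suc.prems(2)] by metis
  have IH: "mul J (mul (2 ^ m) x) \<in> gen {rig y u | y u. length y = m \<and> u \<in> S}" if "x \<in> odo (Suc n)" for x
    by (rule Suc.IH[OF _ that]) (use Suc.prems(1) in simp)
  have up: "rig [c] x \<in> ?H" if "x \<in> gen {rig y u | y u. length y = m \<and> u \<in> S}" for x c
    using that
  proof induction
    case gen_zero
    then show ?case using gen.gen_zero by (simp add: node_zero)
  next
    case (gen_incl x)
    then obtain y u where "x = rig y u" "length y = m" "u \<in> S" by blast
    then have "rig [c] x = rig (c # y) u" "length (c # y) = Suc m" "u \<in> S" by auto
    then show ?case by (intro gen.gen_incl) blast
  next
    case (gen_add x y)
    then show ?case by (simp only: rig_plus gen.gen_add)
  next
    case (gen_minus x)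
    then show ?case by (simp only: rig_minus gen.gen_minus)
  qed
  have "mul J (mul (2 ^ Suc m) \<beta>) = node (mul J (mul (2 ^ m) (a + b))) (mul J (mul (2 ^ m) (b + a)))"
    by (simp only: mul_two ab(2) mul_node)
  also have "\<dots> = rig [False] (mul J (mul (2 ^ m) (a + b))) + rig [True] (mul J (mul (2 ^ m) (b + a)))"
    by (simp add: node_plus)
  finally show ?case using gen_add[OF up[OF IH[OF ab(3)], of False] up[OF IH[OF ab(4)], of True]] by simp
qed

text \<open>A multiple of an odometer lies in \<open>Y k m\<close> and hence in
  \<open>R k m\<close>; it is nonzero because odometers have infinite order.\<close>

lemma wb: "wb k"
  unfolding wb_def
proof
  fix m
  obtain \<beta> where \<beta>: "\<beta> \<in> odo (k + m)" using odo_exists by blast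
  have "mul (4 * 2 ^ (r - 1)) \<beta> \<in> R k m" using torsion_mod_Y[OF odo_in_G[OF \<beta>]] Y_sub_R by blast
  moreover have "mul (4 * 2 ^ (r - 1)) \<beta> \<noteq> 0" by (rule odo_infinite[OF _ \<beta>]) simp
  ultimately show "\<exists>u\<in>R k m. u \<noteq> 0" by blast
qed

theorem not_va: "\<not> virtually_abelian (gr (G k))"
proof -
  obtain \<beta> where \<beta>: "\<beta> \<in> odo k" using odo_exists by blast
  show ?thesis by (rule not_virtually_abelian[OF wb odo_in_G[OF \<beta>]]) (rule odo_infinite[OF _ \<beta>])
qed

subsection \<open>Sections of normal subgroups\<close>

definition down :: "taut set \<Rightarrow> taut set" where "down M = {a. \<exists>b. node a b \<in> M}"

lemma nrm_down: assumes "nrm k M" shows "nrm (Suc k) (down M)"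
proof -
  have M: "subgp M" "M \<subseteq> G k" "\<And>x h. x \<in> M \<Longrightarrow> h \<in> G k \<Longrightarrow> cj x h \<in> M" using assms unfolding nrm_def by auto
  have "subgp (down M)"
    unfolding subgp_def
  proof (intro conjI ballI)
    have "node 0 0 \<in> M" using subgpD(1)[OF M(1)] by (simp add: node_zero)
    then show "0 \<in> down M" unfolding down_def by blast
    fix x assume "x \<in> down M"
    then obtain b where x: "node x b \<in> M" unfolding down_def by blast
    show "- x \<in> down M" using subgpD(3)[OF M(1) x] unfolding down_def by (auto simp: node_minus)
    fix y assume "y \<in> down M"
    then obtain c where y: "node y c \<in> M" unfolding down_def by blast
    show "x + y \<in> down M" using subgpD(2)[OF M(1) x y] unfolding down_def by (auto simp: node_plus)
  qed
  moreover have "down M \<subseteq> G (Suc k)" unfolding down_def using M(2) G_node by blast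
  moreover have "cj x h \<in> down M" if x: "x \<in> down M" and h: "h \<in> G (Suc k)" for x h
  proof -
    obtain b where b: "node x b \<in> M" using x unfolding down_def by blast
    obtain h' where h': "node h h' \<in> G k" using lift1[OF h] by blast
    show ?thesis using M(3)[OF b h'] unfolding down_def cj_node by blast
  qed
  ultimately show ?thesis unfolding nrm_def by blast
qed

lemma down_flip: assumes "nrm k M" "node a b \<in> M" shows "a \<in> down M" "b \<in> down M"
proof -
  have "cj (node a b) swap \<in> M" using assms g_in_G1[of k] unfolding nrm_def g1_swap by blast
  then have "node b a \<in> M" by (simp add: cj_def wreath)
  then show "a \<in> down M" "b \<in> down M" using assms(2) unfolding down_def by blast+
qed

lemma Lam_nrm: assumes "nrm k M" "x \<in> Lam k i" "x \<in> M" shows "g k i \<in> M"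
proof -
  obtain h where h: "h \<in> G k" "x = cj (g k i) h" using assms(2) unfolding Lam_def by blast
  have "cj x (- h) \<in> M" using assms G_intros(3)[OF h(1)] unfolding nrm_def by blast
  then show ?thesis unfolding h(2) cj_cancel .
qed

text \<open>Conjugation by an element that exchanges the halves interchanges the coordinates of
  \<open>node x y\<close>, so its commutator with \<open>node x y\<close> combines both coordinates
  in each half.\<close>

lemma down_swap:
  assumes M: "nrm k M" and t: "node a b + swap \<in> M" and x: "node x y \<in> G k"
  shows "- x + cj y b \<in> down M" "b \<in> G (Suc k)"
proof -
  have Ms: "subgp M" using M unfolding nrm_def by blast
  have tG: "node a b + swap \<in> G k" using M t unfolding nrm_def by blast
  let ?t = "node a b + swap" and ?z = "node x y"
  have "cj (- ?t) ?z + ?t \<in> M"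
    using M subgpD(2)[OF Ms _ t] subgpD(3)[OF Ms t] x unfolding nrm_def by blast
  moreover have "cj (- ?t) ?z + ?t = node (- x + cj y b) (- y + cj x a)"
    by (simp add: cj_def wreath diff_conv_add_uminus del: add_uminus_conv_diff)
  ultimately show "- x + cj y b \<in> down M" unfolding down_def by auto
  show "b \<in> G (Suc k)" using G_sec1[OF tG, of True] by (simp add: sec_node_swap)
qed

lemma down_swap_free:
  assumes M: "nrm k M" and t: "node a b + swap \<in> M" and i: "1 \<le> i" "i \<le> N" "free i" and x: "x \<in> Lam (Suc k) i"
  shows "x \<in> down M"
proof -
  have "node x 0 \<in> Lam k (nx i)" using push_Lam[OF i(1,2) x] i(3) by blast
  moreover have "1 \<le> nx i" "nx i \<le> N" using i r1 rN by (auto simp: nx_def)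
  ultimately have "node x 0 \<in> G k" using Lam_in_G by blast
  from down_swap(1)[OF M t this] show ?thesis using Lam_minus[OF x] by (simp add: cj_simps)
qed

text \<open>Commutators with an element that exchanges the halves put all generators of free index
  into \<open>down M\<close>, but of the indices \<open>r - 1\<close> and \<open>N\<close> only a
  joint sum, since these two are lifted together. A second step down separates them.\<close>

lemma down_down:
  assumes M: "nrm k M" and t: "node a b + swap \<in> M"
  shows "G (Suc (Suc k)) \<subseteq> down (down M)"
proof -
  let ?D = "down M" and ?E = "down (down M)" and ?k = "Suc k"
  have D: "nrm ?k ?D" by (rule nrm_down[OF M])
  have E: "nrm (Suc ?k) ?E" by (rule nrm_down[OF D])
  have Ds: "subgp ?D" and Es: "subgp ?E" using D E unfolding nrm_def by auto
  have r1': "1 \<le> r - 1" "r - 1 \<le> N" using r2 rN by auto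
  obtain \<nu> where \<nu>: "node (g ?k (r - 1)) \<nu> \<in> Lam k (nx (r - 1))" "\<nu> \<in> Lam ?k N"
    using push_Lam[OF r1' g_in_Lam[of ?k "r - 1"]] by blast
  have nxr: "1 \<le> nx (r - 1)" "nx (r - 1) \<le> N" using r1' r1 rN by (auto simp: nx_def)
  have nG: "node (g ?k (r - 1)) \<nu> \<in> G k" by (rule Lam_in_G[OF nxr \<nu>(1)])
  define y where "y = cj \<nu> b"
  have y: "y \<in> Lam ?k N" unfolding y_def by (rule Lam_cj[OF \<nu>(2) down_swap(2)[OF M t nG]])
  have xy: "g ?k (r - 1) + y \<in> ?D"
    using down_swap(1)[OF M t nG] Lam_minus[OF g_in_Lam[of ?k "r - 1"]] unfolding y_def by simp
  have freeD: "x \<in> ?D" if "1 \<le> i" "i \<le> N" "free i" "x \<in> Lam ?k i" for x i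
    using down_swap_free[OF M t that] .
  \<comment> \<open>The second step calls for an element of \<open>down M\<close> that exchanges the
    halves: for \<open>r = 2\<close> the joint sum, whose first term is \<open>swap\<close>, and for
    \<open>r > 2\<close> the generator of the free index \<open>1\<close>.\<close>
  obtain a' b' where t': "node a' b' + swap \<in> ?D"
  proof (cases "r = 2")
    case True
    have "N \<noteq> r" using True N3 by simp
    then obtain \<alpha> \<beta> where "y = node \<alpha> \<beta>" using Lam_form[OF y, of] N3 by auto
    moreover have "g ?k (r - 1) = swap" using True g1_swap[of ?k] by simp
    ultimately have "g ?k (r - 1) + y = node \<beta> \<alpha> + swap" by (simp add: wreath)
    then show ?thesis using that xy by metis
  next
    case False
    then have "free 1" using r2 N3 by (simp add: free_def)
    then have "swap \<in> ?D" using freeD[of 1 "g ?k 1"] g_in_Lam[of ?k 1] N3 unfolding g1_swap by simp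
    then show ?thesis using that[of 0 0] by (simp add: node_zero)
  qed
  have freeE: "x \<in> ?E" if "1 \<le> i" "i \<le> N" "free i" "x \<in> Lam (Suc ?k) i" for x i
    using down_swap_free[OF D t' that] .
  \<comment> \<open>If \<open>r < N\<close>, then \<open>r\<close> is free and its generator has
    both wanted elements as coordinates. If \<open>r = N\<close>, the joint sum shows conjugates of
    both as coordinates, one with the extra term \<open>u\<close>; this has free index and can be
    cancelled.\<close>
  have both: "g (Suc ?k) (r - 1) \<in> ?E \<and> g (Suc ?k) N \<in> ?E"
  proof (cases "r = N")
    case False
    then have "free r" using r2 by (simp add: free_def)
    then have gr: "g ?k r \<in> ?D" using freeD[OF r1 rN _ g_in_Lam] by blast
    have "g ?k r = node (g (Suc ?k) N) (g (Suc ?k) (r - 1)) \<or> g ?k r = node (g (Suc ?k) (r - 1)) (g (Suc ?k) N)"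
      using g_other[of r ?k] r2 by (simp add: sib_def)
    then show ?thesis using down_flip[OF D] gr by metis
  next
    case True
    have N2: "2 \<le> r - 1" "r - 1 \<noteq> r" "r - 1 \<noteq> 1" using True N3 by auto
    define u where "u = g (Suc ?k) (r - 1 - 1)"
    have gx: "g ?k (r - 1) = node u 0 \<or> g ?k (r - 1) = node 0 u"
      using g_other[OF N2(3), of ?k] N2 unfolding u_def sib_def by auto
    have "1 \<le> r - 1 - 1" "r - 1 - 1 < r - 1" "r - 1 - 1 < N" using N2(1) True by linarith+
    moreover from this have "free (r - 1 - 1)" unfolding free_def by simp
    ultimately have uE: "u \<in> ?E" unfolding u_def by (intro freeE[OF _ _ _ g_in_Lam]) simp_all
    obtain \<alpha> \<beta> where ab: "\<alpha> \<in> Lam (Suc ?k) (r - 1)" "\<beta> \<in> Lam (Suc ?k) N" "y = node \<alpha> \<beta> \<or> y = node \<beta> \<alpha>"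
      using Lam_form[OF y] True N3 by auto
    have "g ?k (r - 1) + y = node (u + \<alpha>) \<beta> \<or> g ?k (r - 1) + y = node \<alpha> (u + \<beta>)
      \<or> g ?k (r - 1) + y = node (u + \<beta>) \<alpha> \<or> g ?k (r - 1) + y = node \<beta> (u + \<alpha>)"
      using gx ab(3) by (auto simp: node_plus)
    then have "(u + \<alpha> \<in> ?E \<or> \<alpha> \<in> ?E) \<and> (u + \<beta> \<in> ?E \<or> \<beta> \<in> ?E)" using down_flip[OF D] xy by metis
    moreover have "z \<in> ?E" if "u + z \<in> ?E" for z
    proof -
      have "- u + (u + z) \<in> ?E" using subgpD(2,3)[OF Es] uE that by blast
      then show ?thesis by simp
    qed
    ultimately have "\<alpha> \<in> ?E" "\<beta> \<in> ?E" by blast+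
    then show ?thesis using Lam_nrm[OF E] ab(1,2) by blast
  qed
  have "g (Suc ?k) i \<in> ?E" if "1 \<le> i" "i \<le> N" for i
    using freeE[OF that _ g_in_Lam] both unfolding free_def by metis
  then show ?thesis unfolding G_def by (intro gen_least[OF Es]) auto
qed

text \<open>A nonzero \<open>n\<close> fixes some vertex \<open>q\<close> and exchanges the halves
  below it. The sections at \<open>q\<close> of the elements of \<open>M\<close> fixing
  \<open>q\<close> form a normal subgroup to which \<open>down_down\<close> applies, which explains
  the depth \<open>length q + 2\<close>; conjugation carries the result to all vertices of that
  level.\<close>

lemma deep_sections:
  assumes M: "nrm k M" and n: "n \<in> M" "n \<noteq> 0"
  shows "\<exists>d. \<forall>v. length v = d \<longrightarrow> (\<forall>s\<in>G (k + d). \<exists>u\<in>M. app u v = v \<and> sec u v = s)"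
proof -
  have Ms: "subgp M" "M \<subseteq> G k" and Mc: "\<And>x h. x \<in> M \<Longrightarrow> h \<in> G k \<Longrightarrow> cj x h \<in> M" using M unfolding nrm_def by auto
  obtain y where "app n y \<noteq> y" using nonzero_moves[OF n(2)] by blast
  then obtain q c z where q: "app n q = q" "app n (q @ [c]) = q @ [\<not> c]" using first_swap by metis
  define L where "L = {a. \<exists>u\<in>M. app u q = q \<and> sec u q = a}"
  have sL: "subgp L"
    unfolding subgp_def
  proof (intro conjI ballI)
    show "0 \<in> L" unfolding L_def using subgpD(1)[OF Ms(1)] by (auto intro!: bexI[of _ 0])
    fix x assume "x \<in> L"
    then obtain u where u: "u \<in> M" "app u q = q" "sec u q = x" unfolding L_def by blast
    have "app (- u) q = q" "sec (- u) q = - x" using u sec_minus[of u q] by (metis app_uminus_app, simp)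
    then show "- x \<in> L" unfolding L_def using subgpD(3)[OF Ms(1) u(1)] by blast
    fix x' assume "x' \<in> L"
    then obtain u' where u': "u' \<in> M" "app u' q = q" "sec u' q = x'" unfolding L_def by blast
    have "app (u + u') q = q" "sec (u + u') q = x + x'" using u u' by (simp_all add: sec_plus)
    then show "x + x' \<in> L" unfolding L_def using subgpD(2)[OF Ms(1) u(1) u'(1)] by blast
  qed
  have "L \<subseteq> G (k + length q)" unfolding L_def using Ms(2) G_sec by blast
  moreover have "cj x h \<in> L" if x: "x \<in> L" and h: "h \<in> G (k + length q)" for x h
  proof -
    obtain u where u: "u \<in> M" "app u q = q" "sec u q = x" using x unfolding L_def by blast
    obtain h' where h': "h' \<in> G k" "app h' q = q" "sec h' q = h" using lift[OF h] by blast
    have m: "app (- h') q = q" "sec (- h') q = - h" using h' sec_minus[of h' q] by (metis app_uminus_app, simp)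
    have "app (cj u h') q = q" unfolding cj_def using u h' m by simp
    moreover have "sec (cj u h') q = cj x h" unfolding cj_def using u h' m by (simp add: sec_plus)
    ultimately show ?thesis unfolding L_def using Mc[OF u(1) h'(1)] by blast
  qed
  ultimately have nL: "nrm (k + length q) L" unfolding nrm_def using sL by blast
  have "sec n q \<in> L" unfolding L_def using n q by blast
  moreover have "\<exists>a b. sec n q = node a b + swap"
  proof (rule taut_cases[of "sec n q"])
    fix a b assume e: "sec n q = node a b"
    have "q @ [\<not> c] = q @ app (sec n q) [c]" using app_append[of n q "[c]"] q by simp
    then show ?thesis unfolding e by simp
  qed blast
  ultimately obtain a b where "node a b + swap \<in> L" by metis
  from down_down[OF nL this] have dd: "G (k + (length q + 2)) \<subseteq> down (down L)" by simp
  define v0 where "v0 = q @ [False, False]"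
  have base: "\<exists>u\<in>M. app u v0 = v0 \<and> sec u v0 = s" if s: "s \<in> G (k + (length q + 2))" for s
  proof -
    obtain b b' where "node (node s b) b' \<in> L" using dd s unfolding down_def by blast
    then obtain u where u: "u \<in> M" "app u q = q" "sec u q = node (node s b) b'" unfolding L_def by blast
    have "app u v0 = v0" unfolding v0_def app_append[of u q] u(2,3) by simp
    moreover have "sec u v0 = s" unfolding v0_def sec_append u(3) by (simp add: sec_node sec_Cons[of _ _ "[False]"])
    ultimately show ?thesis using u(1) by blast
  qed
  show ?thesis
  proof (intro exI[of _ "length q + 2"] allI impI ballI)
    fix v :: "bool list" and s assume v: "length v = length q + 2" and s: "s \<in> G (k + (length q + 2))"
    have "length v0 = length v" using v by (simp add: v0_def)
    then obtain x where x: "x \<in> G k" "app x v0 = v" "sec x v0 = 0" using mover[of v0 v 0 k] G_intros(1) by blast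
    obtain u where u: "u \<in> M" "app u v0 = v0" "sec u v0 = s" using base[OF s] by blast
    have m: "app (- x) v = v0" "sec (- x) v = 0" using x sec_minus[of x v0] by (metis app_uminus_app, simp)
    have "app (cj u x) v = v" unfolding cj_def using u x m by simp
    moreover have "sec (cj u x) v = s" unfolding cj_def using u x m by (simp add: sec_plus)
    ultimately show "\<exists>u\<in>M. app u v = v \<and> sec u v = s" using Mc[OF u(1) x(1)] by blast
  qed
qed

subsection \<open>The cyclic group of the odometer is not a virtual retract\<close>

lemma commute_minus: "u + v = v + u \<Longrightarrow> - u + v = v - u" for u v :: "'a::group_add"
proof -
  assume "u + v = v + u"
  then have "- u + v + u = v" by (simp add: add.assoc flip: \<open>u + v = v + u\<close>)
  then show ?thesis by (metis add_diff_cancel)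
qed

theorem not_LR: "\<not> has_LR (gr (G 0))"
proof
  assume LR: "has_LR (gr (G 0))"
  obtain \<beta> where \<beta>: "\<beta> \<in> odo 0" using odo_exists by blast
  have \<beta>G: "\<beta> \<in> G 0" by (rule odo_in_G[OF \<beta>])
  define C where "C = gen {\<beta>}"
  obtain K \<rho> where "retr (G 0) C K \<rho>" using gr_LR_retract[OF subgp_G LR, of "{\<beta>}"] \<beta>G unfolding C_def by blast
  note K = retrD[OF this]
  have Cmul: "\<exists>n. x = mul n \<beta> \<or> x = - mul n \<beta>" if "x \<in> C" for x
  proof -
    have "subgp {x. \<exists>n. x = mul n \<beta> \<or> x = - mul n \<beta>}"
    proof -
      have key: "\<exists>n. mul a \<beta> - mul b \<beta> = mul n \<beta> \<or> mul a \<beta> - mul b \<beta> = - mul n \<beta>" for a b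
      proof (cases "b \<le> a")
        case True
        have "mul a \<beta> = mul (a - b) \<beta> + mul b \<beta>" using mul_add[of "a - b" b \<beta>] True by simp
        then show ?thesis by (metis add_diff_cancel)
      next
        case False
        then have "mul b \<beta> = mul (b - a) \<beta> + mul a \<beta>" using mul_add[of "b - a" a \<beta>] by simp
        then have "mul a \<beta> - mul b \<beta> = - mul (b - a) \<beta>" by (simp add: minus_add add.assoc[symmetric] diff_conv_add_uminus del: add_uminus_conv_diff)
        then show ?thesis by blast
      qed
      have com: "- mul a \<beta> + mul b \<beta> = mul b \<beta> - mul a \<beta>" for a b
        using commute_minus[of "mul a \<beta>" "mul b \<beta>"] mul_add[of a b \<beta>] mul_add[of b a \<beta>] by (simp add: add.commute)
      have "x + y \<in> {x. \<exists>n. x = mul n \<beta> \<or> x = - mul n \<beta>}"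
        if xy: "x \<in> {x. \<exists>n. x = mul n \<beta> \<or> x = - mul n \<beta>}" "y \<in> {x. \<exists>n. x = mul n \<beta> \<or> x = - mul n \<beta>}" for x y
      proof -
        obtain a b where "x = mul a \<beta> \<or> x = - mul a \<beta>" "y = mul b \<beta> \<or> y = - mul b \<beta>" using xy by blast
        then consider "x + y = mul (a + b) \<beta>" | "x + y = mul a \<beta> - mul b \<beta>" | "x + y = mul b \<beta> - mul a \<beta>" | "x + y = - mul (b + a) \<beta>"
          using com[of a b] mul_add[of a b \<beta>] mul_add[of b a \<beta>] by (auto simp: minus_add diff_conv_add_uminus simp del: add_uminus_conv_diff)
        then show ?thesis unfolding mem_Collect_eq by cases (metis key)+
      qed
      moreover have "0 \<in> {x. \<exists>n. x = mul n \<beta> \<or> x = - mul n \<beta>}" by (intro CollectI exI[of _ 0]) simp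
      moreover have "- x \<in> {x. \<exists>n. x = mul n \<beta> \<or> x = - mul n \<beta>}" if "x \<in> {x. \<exists>n. x = mul n \<beta> \<or> x = - mul n \<beta>}" for x
        using that by force
      ultimately show ?thesis unfolding subgp_def by blast
    qed
    moreover have "\<beta> \<in> {x. \<exists>n. x = mul n \<beta> \<or> x = - mul n \<beta>}" by (intro CollectI exI[of _ 1]) simp
    ultimately have "C \<subseteq> {x. \<exists>n. x = mul n \<beta> \<or> x = - mul n \<beta>}" unfolding C_def by (intro gen_least) auto
    then show ?thesis using that by blast
  qed
  have tf: "x = 0" if xC: "x \<in> C" and x0: "mul n x = 0" and n0: "n > 0" for x n
  proof -
    obtain e where e: "x = mul e \<beta> \<or> x = - mul e \<beta>" using Cmul[OF xC] by blast
    then have "mul (n * e) \<beta> = 0" using x0 by (auto simp: mul_mult mul_minus)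
    then have "n * e = 0" using odo_infinite[OF _ \<beta>, of "n * e"] by fastforce
    then show ?thesis using e n0 by auto
  qed
  have Ccomm: "x + y = y + x" if xy: "x \<in> C" "y \<in> C" for x y
  proof -
    have 1: "mul a \<beta> + mul b \<beta> = mul b \<beta> + mul a \<beta>" for a b using mul_add[of a b \<beta>] mul_add[of b a \<beta>] by (simp add: add.commute)
    have neg: "u + - v = - v + u" if "u + v = v + u" for u v :: taut
      using commute_minus[of v u] that by simp
    obtain a b where "x = mul a \<beta> \<or> x = - mul a \<beta>" "y = mul b \<beta> \<or> y = - mul b \<beta>" using Cmul xy by metis
    then show ?thesis using 1 neg by metis
  qed
  obtain J K0 where K0: "J > 0" "K0 \<subseteq> K" "subgp K0" "\<And>k g. k \<in> K0 \<Longrightarrow> g \<in> G 0 \<Longrightarrow> cj k g \<in> K0"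
    "\<And>g. g \<in> G 0 \<Longrightarrow> mul J g \<in> K0" using gr_core[OF subgp_G K(1)] by metis
  have \<rho>mul: "\<rho> (mul n x) = mul n (\<rho> x)" if "x \<in> K" for x n
  proof (induction n)
    case 0
    have "0 \<in> C" unfolding C_def by (rule gen_zero)
    then show ?case using K(8) by simp
  next
    case (Suc n)
    then show ?case using K(5)[OF subgpD(6)[OF K(2) that] that] by simp
  qed
  have \<rho>cj: "\<rho> (cj x k) = \<rho> x" if "x \<in> K" "k \<in> K" for x k
  proof -
    have "\<rho> (cj x k) = - \<rho> k + \<rho> x + \<rho> k"
      unfolding cj_def using K(5,6) that subgpD(2,3)[OF K(2)] by simp
    also have "\<dots> = \<rho> x" using Ccomm[OF K(7)[OF that(1)] K(7)[OF that(2)]] by (simp add: add.assoc)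
    finally show ?thesis .
  qed
  text \<open>A commutator of an element with a disjoint conjugate of it is killed, because some power of the element lies in \<open>K\<close>.\<close>
  have kill: "- U + cj U k \<in> K0 \<and> \<rho> (- U + cj U k) = 0" if U: "U \<in> G 0" and k: "k \<in> K0" and c: "U + cj U k = cj U k + U" for U k
  proof -
    have "- U + cj U k = cj (- k) U + k" unfolding cj_def by (simp add: add.assoc diff_conv_add_uminus del: add_uminus_conv_diff)
    then have in0: "- U + cj U k \<in> K0" using subgpD(2)[OF K0(3) K0(4)[OF subgpD(3)[OF K0(3) k] U] k] by simp
    have c': "(- U) + cj U k = cj U k + (- U)" using commute_minus[OF c] by simp
    have "mul J (- U + cj U k) = - mul J U + cj (mul J U) k"
      using mul_distrib[OF c', of J] by (simp only: mul_minus cj_mul)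
    moreover have V: "mul J U \<in> K" "k \<in> K" using K0(2,5) U k by auto
    ultimately have "\<rho> (mul J (- U + cj U k)) = - \<rho> (mul J U) + \<rho> (cj (mul J U) k)"
      using K(5,6) subgpD(3,5)[OF K(2)] by simp
    then have "mul J (\<rho> (- U + cj U k)) = 0" using \<rho>mul in0 K0(2) \<rho>cj[OF V] by (metis left_minus subsetD)
    then show ?thesis using tf[OF K(7)] in0 K0(1,2) by blast
  qed
  have sW: "subgp {x \<in> K0. \<rho> x = 0}"
  proof -
    have "\<rho> 0 = 0" using K(8)[of 0] unfolding C_def by (simp add: gen_zero)
    then show ?thesis unfolding subgp_def using subgpD(1,2,3)[OF K0(3)] K(5,6) K0(2) by (simp add: subset_eq)
  qed
  \<comment> \<open>Both \<open>- U + cj U k\<close> and \<open>- cj U w + cj U k\<close> are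
    killed, the latter because conjugation by \<open>w\<close> leaves \<open>cj U k\<close>
    unchanged. Subtracting removes \<open>cj U k\<close>.\<close>
  have kill2: "- cj U w + U \<in> K0 \<and> \<rho> (- cj U w + U) = 0"
    if U: "U \<in> G 0" and k: "k \<in> K0" and c: "U + cj U k = cj U k + U" and w: "w \<in> G 0" and cw: "cj (cj U k) w = cj U k" for U k w
  proof -
    let ?kap = "- U + cj U k"
    have cjw: "cj ?kap w = - cj U w + cj U k" by (simp only: cj_simps(3,4) cw)
    have k': "cj k w \<in> K0" by (rule K0(4)[OF k w])
    have e: "cj (cj U w) (cj k w) = cj U k"
    proof -
      have "cj (cj U w) (cj k w) = cj (cj U k) w" unfolding cj_def by (simp add: add.assoc minus_add diff_conv_add_uminus del: add_uminus_conv_diff)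
      then show ?thesis using cw by simp
    qed
    have "cj (U + cj U k) w = cj (cj U k + U) w" using c by simp
    then have "cj U w + cj U k = cj U k + cj U w" by (simp only: cj_simps(3) cw)
    then have 1: "- cj U w + cj U k \<in> K0 \<and> \<rho> (- cj U w + cj U k) = 0"
      using kill[OF G_intros(5)[OF U w] k'] unfolding e by blast
    have 2: "?kap \<in> K0 \<and> \<rho> ?kap = 0" by (rule kill[OF U k c])
    have "- cj U w + U = (- cj U w + cj U k) + - ?kap"
      by (simp add: minus_add add.assoc diff_conv_add_uminus del: add_uminus_conv_diff)
    moreover have "(- cj U w + cj U k) + - ?kap \<in> {x \<in> K0. \<rho> x = 0}"
      by (rule subgpD(2)[OF sW _ subgpD(3)[OF sW]]) (use 1 2 in blast)+
    ultimately show ?thesis by (metis (mono_tags, lifting) mem_Collect_eq)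
  qed
  define n where "n = mul J \<beta>"
  have n: "n \<in> K0" "n \<noteq> 0" unfolding n_def using K0(5) \<beta>G odo_infinite[OF K0(1) \<beta>] by auto
  obtain y0 where "app n y0 \<noteq> y0" using nonzero_moves[OF n(2)] by blast
  then obtain q c z where q: "app n q = q" "app n (q @ [c]) = q @ [\<not> c]" using first_swap by metis
  \<comment> \<open>Conjugates of \<open>n\<close> lie in \<open>K0\<close> and move any prescribed
    vertex of level \<open>t\<close>. The depth \<open>d\<close> below is such that every section of
    level \<open>t + d\<close> is realised by an element planted at level \<open>t\<close>.\<close>
  define t where "t = Suc (length q)"
  have nR: "nrm t (R 0 t)" unfolding nrm_def using subgp_R R_sub_G[of _ 0 t] R_normal[of _ 0 t] by auto
  obtain \<nu> where \<nu>: "\<nu> \<in> R 0 t" "\<nu> \<noteq> 0" using wb unfolding wb_def by blast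
  obtain d where d: "\<And>v s. length v = d \<Longrightarrow> s \<in> G (t + d) \<Longrightarrow> \<exists>u\<in>R 0 t. app u v = v \<and> sec u v = s"
    using deep_sections[OF nR \<nu>] by blast
  define m where "m = t + d"
  \<comment> \<open>Let \<open>p\<close> be the prefix of \<open>y\<close> of length
    \<open>t\<close>. Some \<open>k\<close> in \<open>K0\<close> moves \<open>p\<close> and so makes
    the conjugate of \<open>rig y u\<close> disjoint from the subtree below \<open>p\<close>, and
    some \<open>w\<close> planted at \<open>p\<close> has section \<open>s\<close> at
    \<open>y\<close> without touching that conjugate.\<close>
  have rigid: "rig y (- cj u s + u) \<in> K0 \<and> \<rho> (rig y (- cj u s + u)) = 0"
    if y: "length y = m" and u: "u \<in> R 0 m" and s: "s \<in> G m" for y u s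
  proof -
    define p where "p = take t y"
    define v where "v = drop t y"
    have pv: "y = p @ v" "length p = t" "length v = d" using y unfolding p_def v_def m_def by auto
    have "length (q @ [c]) = length p" using pv by (simp add: t_def)
    then obtain x where x: "x \<in> G 0" "app x (q @ [c]) = p" using transitive by blast
    define k where "k = cj n x"
    have k: "k \<in> K0" unfolding k_def by (rule K0(4)[OF n(1) x(1)])
    have kp: "app k p \<noteq> p"
    proof
      assume "app k p = p"
      then have "app x (app n (q @ [c])) = app x (q @ [c])" unfolding k_def cj_def using x(2) by (metis app_plus app_uminus_app)
      then show False using q(2) by simp
    qed
    define U where "U = rig y u"
    have UG: "U \<in> G 0" unfolding U_def using R_D u y by blast
    define y' where "y' = app k y"
    define u' where "u' = cj u (sec k y)"
    have cU: "cj U k = rig y' u'" unfolding U_def y'_def u'_def by (rule cj_rig)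
    have y'len: "length y' = length y" unfolding y'_def by simp
    have tk: "take t y' = app k p" unfolding y'_def app_take p_def ..
    have yy': "y \<noteq> y'" using kp tk p_def by auto
    have com: "U + cj U k = cj U k + U" unfolding cU unfolding U_def using rig_commute[of y y'] y'len yy' by simp
    obtain h where h: "h \<in> R 0 t" "app h v = v" "sec h v = s" using d[OF pv(3), of s] s unfolding m_def by blast
    define w where "w = rig p h"
    have wG: "w \<in> G 0" unfolding w_def using R_D h(1) pv(2) by blast
    have "cj (cj U k) w = cj U k"
    proof -
      have "y' = app k p @ drop t y'" using tk by (metis append_take_drop_id)
      then have "rig y' u' = rig (app k p) (rig (drop t y') u')" by (metis rig_append)
      then have "rig y' u' + w = w + rig y' u'" unfolding w_def using rig_commute[of "app k p" p] kp by simp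
      then show ?thesis unfolding cU by (simp add: cj_eq_iff)
    qed
    then have *: "- cj U w + U \<in> K0 \<and> \<rho> (- cj U w + U) = 0" using kill2[OF UG k com wG] by blast
    have wy: "app w y = y" "sec w y = s" unfolding pv(1) w_def by (simp_all add: app_rig h sec_append sec_rig)
    have "- cj U w + U = rig y (- cj u s + u)" unfolding U_def by (simp add: cj_rig wy rig_plus rig_minus)
    then show ?thesis using * by simp
  qed
  have rigY: "rig y x \<in> {x \<in> K0. \<rho> x = 0}" if y: "length y = m" and x: "x \<in> Y 0 m" for y x
    using x unfolding Y_def
  proof induction
    case (gen_incl x)
    then show ?case using rigid[OF y] by auto
  next
    case (gen_add x x')
    then show ?case using subgpD(2)[OF sW] by (simp only: rig_plus)
  next
    case (gen_minus x)
    then show ?case using subgpD(3)[OF sW] by (simp only: rig_minus)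
  next
    case gen_zero
    then show ?case using subgpD(1)[OF sW] by simp
  qed
  \<comment> \<open>The exponent of \<open>torsion_mod_Y\<close>: it sends the odometers of level
    \<open>m\<close> into \<open>Y\<close>, whose planted copies are killed, although
    \<open>\<rho>\<close> fixes every multiple of \<open>\<beta>\<close>.\<close>
  let ?J = "4 * 2 ^ (r - 1) :: nat"
  have "mul ?J b \<in> Y 0 m" if "b \<in> odo (0 + m)" for b
    using torsion_mod_Y[of b 0 m] odo_in_G[OF that] by blast
  from pow_odo_rigid[OF this \<beta>] have "mul ?J (mul (2 ^ m) \<beta>) \<in> gen {rig y u | y u. length y = m \<and> u \<in> Y 0 m}" .
  also have "\<dots> \<subseteq> {x \<in> K0. \<rho> x = 0}" by (rule gen_least[OF sW]) (use rigY in blast)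
  finally have "\<rho> (mul ?J (mul (2 ^ m) \<beta>)) = 0" by blast
  moreover have "mul ?J (mul (2 ^ m) \<beta>) \<in> C"
    unfolding C_def by (intro subgpD(6)[OF subgp_gen] gen_incl) simp
  ultimately have "mul (?J * 2 ^ m) \<beta> = 0" using K(8) by (simp add: mul_mult)
  then show False using odo_infinite[OF _ \<beta>, of "?J * 2 ^ m"] by simp
qed

end

section \<open>Lifting paths through a quadratic polynomial\<close>

locale quad =
  fixes p :: "complex poly" and a c v :: complex
  assumes a0: "a \<noteq> 0" and poly_p: "\<And>w. poly p w = a * (w - c)\<^sup>2 + v"
begin

abbreviation f :: "complex \<Rightarrow> complex" where "f \<equiv> poly p"

abbreviation P :: "complex set" where "P \<equiv> postcrit p"

lemma f_c: "f c = v"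
  by (simp add: poly_p)

lemma f_eq_v: "f w = v \<longleftrightarrow> w = c"
  using a0 by (simp add: poly_p)

lemma f_eq: "f w = f u \<longleftrightarrow> w = u \<or> w = 2 * c - u"
proof -
  have "f w = f u \<longleftrightarrow> (w - c)\<^sup>2 = (u - c)\<^sup>2" using a0 by (simp add: poly_p)
  also have "\<dots> \<longleftrightarrow> w - c = u - c \<or> w - c = - (u - c)" by (rule power2_eq_iff)
  also have "\<dots> \<longleftrightarrow> w = u \<or> w = 2 * c - u" by (auto simp: algebra_simps)
  finally show ?thesis .
qed

lemma f_refl [simp]: "f (2 * c - w) = f w"
  using f_eq[of "2 * c - w" w] by simp

lemma crit: "crit_points p = {c}"
proof -
  have "poly p = poly [:a * c\<^sup>2 + v, - 2 * a * c, a:]"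
    by (rule ext) (simp add: poly_p power2_eq_square algebra_simps)
  then have "p = [:a * c\<^sup>2 + v, - 2 * a * c, a:]" by (simp only: poly_eq_poly_eq_iff)
  then have "poly (pderiv p) w = 2 * a * (w - c)" for w by (simp add: pderiv_pCons algebra_simps)
  then show ?thesis unfolding crit_points_def using a0 by auto
qed

lemma P_eq: "P = range (\<lambda>n. (f ^^ n) v)"
proof -
  have "(f ^^ n) c = (f ^^ (n - 1)) v" if "n \<ge> 1" for n
    using that f_c by (cases n) (simp_all add: funpow_swap1 del: funpow.simps(2), simp add: funpow_Suc_right del: funpow.simps(2))
  then have "P = (\<Union>n\<in>{1..}. {(f ^^ (n - 1)) v})" unfolding postcrit_def crit by auto
  also have "\<dots> = range (\<lambda>n. (f ^^ n) v)"
  proof (intro equalityI subsetI)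
    fix x assume "x \<in> range (\<lambda>n. (f ^^ n) v)"
    then obtain n where "x = (f ^^ n) v" by blast
    then have "x \<in> {(f ^^ (Suc n - 1)) v}" "Suc n \<in> {1..}" by auto
    then show "x \<in> (\<Union>n\<in>{1..}. {(f ^^ (n - 1)) v})" by blast
  qed blast
  finally show ?thesis .
qed

lemma v_in_P: "v \<in> P"
  unfolding P_eq by (rule image_eqI[of _ _ 0]) auto

lemma f_in_P: "q \<in> P \<Longrightarrow> f q \<in> P"
proof -
  assume "q \<in> P"
  then obtain n where "q = (f ^^ n) v" unfolding P_eq by blast
  then have "f q = (f ^^ Suc n) v" by simp
  then show ?thesis unfolding P_eq by blast
qed

lemma funpow_in_P: "q \<in> P \<Longrightarrow> (f ^^ n) q \<in> P"
  by (induction n) (auto simp: f_in_P)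

text \<open>A lift is \<open>c\<close> plus a square root of \<open>(E s - v) / a\<close>. Off the
  critical value this has no zero, so the root exists on a contractible set, and its sign is
  determined by the starting point.\<close>

lemma lift_ex:
  fixes S :: "'b::real_normed_vector set"
  assumes S: "contractible S" and E: "continuous_on S E" "\<And>s. s \<in> S \<Longrightarrow> E s \<noteq> v" and s0: "s0 \<in> S" "f x = E s0"
  obtains E' where "continuous_on S E'" "\<And>s. s \<in> S \<Longrightarrow> f (E' s) = E s" "E' s0 = x"
proof -
  have "continuous_on S (\<lambda>s. (E s - v) / a)" by (intro continuous_intros E) (use a0 in simp)
  moreover have "(E s - v) / a \<noteq> 0" if "s \<in> S" for s using E(2)[OF that] a0 by simp
  ultimately obtain h where h: "continuous_on S h" "\<And>s. s \<in> S \<Longrightarrow> (E s - v) / a = (h s)\<^sup>2"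
    using continuous_sqrt_on_contractible[OF _ S, of "\<lambda>s. (E s - v) / a"] by blast
  have E_eq: "E s = a * (h s)\<^sup>2 + v" if "s \<in> S" for s using h(2)[OF that] a0 by (simp add: field_simps)
  have fh: "f (c + h s) = E s" "f (c - h s) = E s" if "s \<in> S" for s using E_eq[OF that] by (simp_all add: poly_p)
  have cont: "continuous_on S (\<lambda>s. c + h s)" "continuous_on S (\<lambda>s. c - h s)" by (intro continuous_intros h(1))+
  have "f x = f (c + h s0)" using s0 fh by simp
  then have "x = c + h s0 \<or> x = c - h s0" unfolding f_eq by (simp add: algebra_simps)
  then show ?thesis
  proof
    assume "x = c + h s0"
    then show ?thesis using that[OF cont(1) fh(1)] by blast
  next
    assume "x = c - h s0"
    then show ?thesis using that[OF cont(2) fh(2)] by blast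
  qed
qed

text \<open>Two lifts differ by a sign around \<open>c\<close>; their quotient is continuous with
  values \<open>1\<close> and \<open>- 1\<close>, hence constant on a connected set.\<close>

lemma lift_unique:
  fixes S :: "'b::real_normed_vector set"
  assumes S: "connected S" and E: "continuous_on S E1" "continuous_on S E2"
    and eq: "\<And>s. s \<in> S \<Longrightarrow> f (E1 s) = f (E2 s)" "\<And>s. s \<in> S \<Longrightarrow> f (E2 s) \<noteq> v"
    and s0: "s0 \<in> S" "E1 s0 = E2 s0" and s: "s \<in> S"
  shows "E1 s = E2 s"
proof -
  have nz: "E2 s - c \<noteq> 0" if "s \<in> S" for s using eq(2)[OF that] f_c by auto
  define q where "q s = (E1 s - c) / (E2 s - c)" for s
  have "q s = 1 \<or> q s = - 1" if "s \<in> S" for s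
    using eq(1)[OF that] nz[OF that] unfolding f_eq q_def by (auto simp: field_simps)
  then have "q ` S \<subseteq> {1, - 1}" by blast
  then have "finite (q ` S)" using finite_subset by blast
  moreover have "continuous_on S q" unfolding q_def by (intro continuous_intros E ballI nz)
  ultimately obtain k where k: "\<And>s. s \<in> S \<Longrightarrow> q s = k"
    using continuous_finite_range_constant[OF S, of q] unfolding constant_on_def by blast
  have "q s0 = 1" unfolding q_def using s0 nz by simp
  then have "q s = 1" using k s s0 by metis
  then show ?thesis using nz[OF s] unfolding q_def by (simp add: field_simps)
qed

definition good :: "(real \<Rightarrow> complex) \<Rightarrow> bool" where
  "good \<gamma> \<longleftrightarrow> path \<gamma> \<and> path_image \<gamma> \<subseteq> - P"

definition flift :: "(real \<Rightarrow> complex) \<Rightarrow> (real \<Rightarrow> complex) \<Rightarrow> bool" where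
  "flift \<delta> \<gamma> \<longleftrightarrow> path \<delta> \<and> (\<forall>t\<in>{0..1}. f (\<delta> t) = \<gamma> t)"

lemma contractible_01: "contractible {0..1::real}"
  by (simp add: convex_imp_contractible)

lemma good_point: "good \<gamma> \<Longrightarrow> t \<in> {0..1} \<Longrightarrow> \<gamma> t \<notin> P"
  unfolding good_def path_image_def by blast

lemma good_neq_v: "good \<gamma> \<Longrightarrow> t \<in> {0..1} \<Longrightarrow> \<gamma> t \<noteq> v"
  using good_point v_in_P by metis

lemma flift_good: "flift \<delta> \<gamma> \<Longrightarrow> good \<gamma> \<Longrightarrow> good \<delta>"
proof -
  assume d: "flift \<delta> \<gamma>" and g: "good \<gamma>"
  have "\<delta> t \<notin> P" if "t \<in> {0..1}" for t
    using d good_point[OF g that] f_in_P[of "\<delta> t"] that unfolding flift_def by auto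
  then show "good \<delta>" using d unfolding good_def flift_def path_image_def by blast
qed

lemma flift_ex:
  assumes g: "good \<gamma>" and x: "f x = \<gamma> 0"
  obtains \<delta> where "flift \<delta> \<gamma>" "\<delta> 0 = x"
proof -
  have "continuous_on {0..1} \<gamma>" using g unfolding good_def path_def by blast
  then obtain \<delta> where "continuous_on {0..1} \<delta>" "\<And>t. t \<in> {0..1} \<Longrightarrow> f (\<delta> t) = \<gamma> t" "\<delta> 0 = x"
    using lift_ex[OF contractible_01, of \<gamma> 0 x] good_neq_v[OF g] x by auto
  then show ?thesis using that unfolding flift_def path_def by blast
qed

lemma flift_unique:
  assumes "flift \<delta> \<gamma>" "flift \<delta>' \<gamma>" "good \<gamma>" "\<delta> 0 = \<delta>' 0" "t \<in> {0..1}"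
  shows "\<delta> t = \<delta>' t"
proof (rule lift_unique[of "{0..1}" \<delta> \<delta>' 0])
  show "f (\<delta>' s) \<noteq> v" if "s \<in> {0..1}" for s
    using that assms(2) good_neq_v[OF assms(3)] unfolding flift_def by auto
qed (use assms in \<open>auto simp: flift_def path_def\<close>)

definition is_lift :: "nat \<Rightarrow> (real \<Rightarrow> complex) \<Rightarrow> complex \<Rightarrow> (real \<Rightarrow> complex) \<Rightarrow> bool" where
  "is_lift n \<gamma> x \<delta> \<longleftrightarrow> path \<delta> \<and> pathstart \<delta> = x \<and> (\<forall>t\<in>{0..1}. (f ^^ n) (\<delta> t) = \<gamma> t)"

lemma continuous_funpow: "continuous_on A (f ^^ n)"
proof (induction n)
  case (Suc n)
  have "continuous_on A (\<lambda>x. f ((f ^^ n) x))" by (intro continuous_intros Suc)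
  then show ?case by (simp add: o_def)
qed (simp add: id_def)

text \<open>Applying \<open>f ^^ n\<close> to a lift through \<open>Suc n\<close> iterates yields a
  lift through one iterate, which is \<open>\<delta>\<close> by uniqueness. So repeated lifting can
  be done one step at a time, starting from the base.\<close>

lemma is_lift_Suc:
  assumes g: "good \<gamma>" and d: "flift \<delta> \<gamma>" "\<delta> 0 = (f ^^ n) x"
  shows "is_lift (Suc n) \<gamma> x \<sigma> \<longleftrightarrow> is_lift n \<delta> x \<sigma>"
proof
  assume s: "is_lift (Suc n) \<gamma> x \<sigma>"
  have "path ((f ^^ n) \<circ> \<sigma>)" using s continuous_funpow unfolding is_lift_def by (intro path_continuous_image) auto
  then have "flift ((f ^^ n) \<circ> \<sigma>) \<gamma>" using s unfolding flift_def is_lift_def by simp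
  then have "((f ^^ n) \<circ> \<sigma>) t = \<delta> t" if "t \<in> {0..1}" for t
    by (rule flift_unique[OF _ d(1) g _ that]) (use s d in \<open>simp add: is_lift_def pathstart_def\<close>)
  then show "is_lift n \<delta> x \<sigma>" using s unfolding is_lift_def by simp
qed (use d in \<open>auto simp: is_lift_def flift_def\<close>)

lemma is_lift_ex: "good \<gamma> \<Longrightarrow> (f ^^ n) x = \<gamma> 0 \<Longrightarrow> \<exists>\<sigma>. is_lift n \<gamma> x \<sigma>"
proof (induction n arbitrary: \<gamma>)
  case 0
  then show ?case by (intro exI[of _ \<gamma>]) (simp add: is_lift_def good_def pathstart_def)
next
  case (Suc n)
  obtain \<delta> where d: "flift \<delta> \<gamma>" "\<delta> 0 = (f ^^ n) x" using flift_ex[OF Suc.prems(1), of "(f ^^ n) x"] Suc.prems(2) by auto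
  show ?case using Suc.IH[OF flift_good[OF d(1) Suc.prems(1)]] d(2) is_lift_Suc[OF Suc.prems(1) d] by simp
qed

lemma is_lift_unique: "good \<gamma> \<Longrightarrow> (f ^^ n) x = \<gamma> 0 \<Longrightarrow> is_lift n \<gamma> x \<sigma> \<Longrightarrow> is_lift n \<gamma> x \<sigma>' \<Longrightarrow> t \<in> {0..1} \<Longrightarrow> \<sigma> t = \<sigma>' t"
proof (induction n arbitrary: \<gamma>)
  case 0
  then show ?case by (simp add: is_lift_def)
next
  case (Suc n)
  obtain \<delta> where d: "flift \<delta> \<gamma>" "\<delta> 0 = (f ^^ n) x" using flift_ex[OF Suc.prems(1), of "(f ^^ n) x"] Suc.prems(2) by auto
  show ?case
    using Suc.IH[OF flift_good[OF d(1) Suc.prems(1)]] Suc.prems(3-5) d(2) is_lift_Suc[OF Suc.prems(1) d] by simp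
qed

definition act :: "nat \<Rightarrow> (real \<Rightarrow> complex) \<Rightarrow> complex \<Rightarrow> complex" where
  "act n \<gamma> x = lift_end p n \<gamma> x"

lemma act_eq:
  assumes "good \<gamma>" "(f ^^ n) x = \<gamma> 0" "is_lift n \<gamma> x \<sigma>" shows "act n \<gamma> x = \<sigma> 1"
  unfolding act_def lift_end_def
proof (rule the_equality)
  show "\<exists>\<delta>. path \<delta> \<and> pathstart \<delta> = x \<and> pathfinish \<delta> = \<sigma> 1 \<and> (\<forall>t\<in>{0..1}. (f ^^ n) (\<delta> t) = \<gamma> t)"
    using assms(3) unfolding is_lift_def pathfinish_def by blast
next
  fix y assume "\<exists>\<delta>. path \<delta> \<and> pathstart \<delta> = x \<and> pathfinish \<delta> = y \<and> (\<forall>t\<in>{0..1}. (f ^^ n) (\<delta> t) = \<gamma> t)"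
  then obtain \<delta> where "is_lift n \<gamma> x \<delta>" "\<delta> 1 = y" unfolding is_lift_def pathfinish_def by blast
  then show "y = \<sigma> 1" using is_lift_unique[OF assms(1,2) _ assms(3), of \<delta> 1] by simp
qed

lemma act_0: "good \<gamma> \<Longrightarrow> act 0 \<gamma> (\<gamma> 0) = \<gamma> 1"
  by (rule act_eq) (auto simp: is_lift_def good_def pathstart_def)

lemma act_Suc:
  assumes g: "good \<gamma>" and d: "flift \<delta> \<gamma>" "\<delta> 0 = (f ^^ n) x"
  shows "act (Suc n) \<gamma> x = act n \<delta> x"
proof -
  have "f (\<delta> 0) = \<gamma> 0" using d(1) unfolding flift_def by auto
  then have x: "(f ^^ Suc n) x = \<gamma> 0" using d(2) by simp
  obtain \<sigma> where s: "is_lift n \<delta> x \<sigma>" using is_lift_ex[OF flift_good[OF d(1) g]] d(2) by metis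
  then have "is_lift (Suc n) \<gamma> x \<sigma>" using is_lift_Suc[OF g d] by simp
  then show ?thesis using act_eq[OF g x] act_eq[OF flift_good[OF d(1) g] _ s] d(2) by simp
qed

lemma act_fibre: "good \<gamma> \<Longrightarrow> (f ^^ n) x = \<gamma> 0 \<Longrightarrow> (f ^^ n) (act n \<gamma> x) = \<gamma> 1"
  using is_lift_ex[of \<gamma> n x] act_eq[of \<gamma> n x] unfolding is_lift_def by fastforce

lemma good_join: "good \<gamma>1 \<Longrightarrow> good \<gamma>2 \<Longrightarrow> \<gamma>1 1 = \<gamma>2 0 \<Longrightarrow> good (\<gamma>1 +++ \<gamma>2)"
  unfolding good_def by (auto simp: pathfinish_def pathstart_def path_image_join)

lemma good_rev: "good \<gamma> \<Longrightarrow> good (reversepath \<gamma>)"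
  unfolding good_def by simp

lemma join_ends [simp]: "(\<gamma>1 +++ \<gamma>2) 0 = \<gamma>1 (0::real)" "(\<gamma>1 +++ \<gamma>2) 1 = \<gamma>2 (1::real)"
  by (simp_all add: joinpaths_def)

lemma rev_ends [simp]: "reversepath \<gamma> 0 = \<gamma> (1::real)" "reversepath \<gamma> 1 = \<gamma> (0::real)"
  by (simp_all add: reversepath_def)

lemma act_join:
  assumes g: "good \<gamma>1" "good \<gamma>2" "\<gamma>1 1 = \<gamma>2 0" and x: "(f ^^ n) x = \<gamma>1 0"
  shows "act n (\<gamma>1 +++ \<gamma>2) x = act n \<gamma>2 (act n \<gamma>1 x)"
proof -
  obtain \<sigma>1 where s1: "is_lift n \<gamma>1 x \<sigma>1" using is_lift_ex[OF g(1) x] by blast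
  have e1: "act n \<gamma>1 x = \<sigma>1 1" by (rule act_eq[OF g(1) x s1])
  have x2: "(f ^^ n) (\<sigma>1 1) = \<gamma>2 0" using s1 g(3) unfolding is_lift_def by simp
  obtain \<sigma>2 where s2: "is_lift n \<gamma>2 (\<sigma>1 1) \<sigma>2" using is_lift_ex[OF g(2) x2] by blast
  have e2: "act n \<gamma>2 (\<sigma>1 1) = \<sigma>2 1" by (rule act_eq[OF g(2) x2 s2])
  have "is_lift n (\<gamma>1 +++ \<gamma>2) x (\<sigma>1 +++ \<sigma>2)"
  proof -
    have "path (\<sigma>1 +++ \<sigma>2)" using s1 s2 unfolding is_lift_def by (intro path_join_imp) (auto simp: pathfinish_def)
    then show ?thesis using s1 s2 unfolding is_lift_def by (auto simp: pathstart_def joinpaths_def)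
  qed
  from act_eq[OF good_join[OF g] _ this] show ?thesis using x e1 e2 by simp
qed

lemma act_rev:
  assumes g: "good \<gamma>" and x: "(f ^^ n) x = \<gamma> 0"
  shows "act n (reversepath \<gamma>) (act n \<gamma> x) = x"
proof -
  obtain \<sigma> where s: "is_lift n \<gamma> x \<sigma>" using is_lift_ex[OF g x] by blast
  have e: "act n \<gamma> x = \<sigma> 1" by (rule act_eq[OF g x s])
  have "is_lift n (reversepath \<gamma>) (\<sigma> 1) (reversepath \<sigma>)"
  proof -
    have "path (reversepath \<sigma>)" using s unfolding is_lift_def by simp
    then show ?thesis using s unfolding is_lift_def by (auto simp: reversepath_def pathstart_def)
  qed
  from act_eq[OF good_rev[OF g] _ this] show ?thesis using s e unfolding is_lift_def by (simp add: pathstart_def)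
qed

lemma act_rev':
  assumes g: "good \<gamma>" and x: "(f ^^ n) x = \<gamma> 1"
  shows "act n \<gamma> (act n (reversepath \<gamma>) x) = x"
  using act_rev[OF good_rev[OF g], of n x] x by simp

lemma act_const: "x \<notin> P \<Longrightarrow> (f ^^ n) y = x \<Longrightarrow> act n (\<lambda>_. x) y = y"
  by (rule act_eq) (auto simp: good_def is_lift_def path_image_def pathstart_def path_def)

section \<open>The iterated monodromy group is a group\<close>

lemma loop_action_apply:
  "(f ^^ n) y = z \<Longrightarrow> loop_action p z \<gamma> (n, y) = (n, act n \<gamma> y)"
  "(f ^^ n) y \<noteq> z \<Longrightarrow> loop_action p z \<gamma> (n, y) = (n, y)"
  unfolding loop_action_def preimage_tree_def act_def by auto

lemma pc_loops_iff: "\<gamma> \<in> pc_loops p z \<longleftrightarrow> good \<gamma> \<and> \<gamma> 0 = z \<and> \<gamma> 1 = z"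
  unfolding pc_loops_def good_def pathstart_def pathfinish_def by auto

lemma loop_action_join:
  assumes "\<gamma>1 \<in> pc_loops p z" "\<gamma>2 \<in> pc_loops p z"
  shows "\<gamma>1 +++ \<gamma>2 \<in> pc_loops p z" "loop_action p z \<gamma>2 \<circ> loop_action p z \<gamma>1 = loop_action p z (\<gamma>1 +++ \<gamma>2)"
proof -
  have g: "good \<gamma>1" "good \<gamma>2" "\<gamma>1 0 = z" "\<gamma>1 1 = z" "\<gamma>2 0 = z" "\<gamma>2 1 = z" using assms unfolding pc_loops_iff by auto
  show "\<gamma>1 +++ \<gamma>2 \<in> pc_loops p z" unfolding pc_loops_iff using g good_join by auto
  show "loop_action p z \<gamma>2 \<circ> loop_action p z \<gamma>1 = loop_action p z (\<gamma>1 +++ \<gamma>2)"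
  proof
    fix w :: "nat \<times> complex"
    obtain n y where w: "w = (n, y)" by (cases w)
    show "(loop_action p z \<gamma>2 \<circ> loop_action p z \<gamma>1) w = loop_action p z (\<gamma>1 +++ \<gamma>2) w"
    proof (cases "(f ^^ n) y = z")
      case True
      have "(f ^^ n) (act n \<gamma>1 y) = z" using act_fibre[OF g(1)] True g by simp
      then show ?thesis using act_join[OF g(1,2)] True g w by (simp add: loop_action_apply)
    next
      case False
      then show ?thesis using w by (simp add: loop_action_apply)
    qed
  qed
qed

lemma loop_action_const:
  assumes "z \<notin> P" shows "(\<lambda>_. z) \<in> pc_loops p z" "loop_action p z (\<lambda>_. z) = id"
proof -
  show "(\<lambda>_. z) \<in> pc_loops p z" unfolding pc_loops_iff good_def using assms by (auto simp: path_def path_image_def)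
  show "loop_action p z (\<lambda>_. z) = id"
  proof
    fix w :: "nat \<times> complex"
    obtain n y where w: "w = (n, y)" by (cases w)
    show "loop_action p z (\<lambda>_. z) w = id w"
      using act_const[OF assms] w by (cases "(f ^^ n) y = z") (simp_all add: loop_action_apply)
  qed
qed

lemma loop_action_rev:
  assumes "\<gamma> \<in> pc_loops p z"
  shows "reversepath \<gamma> \<in> pc_loops p z" "loop_action p z \<gamma> \<circ> loop_action p z (reversepath \<gamma>) = id"
    "loop_action p z (reversepath \<gamma>) \<circ> loop_action p z \<gamma> = id"
proof -
  have g: "good \<gamma>" "\<gamma> 0 = z" "\<gamma> 1 = z" using assms unfolding pc_loops_iff by auto
  show "reversepath \<gamma> \<in> pc_loops p z" unfolding pc_loops_iff using g good_rev by auto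
  show "loop_action p z \<gamma> \<circ> loop_action p z (reversepath \<gamma>) = id"
  proof
    fix w :: "nat \<times> complex"
    obtain n y where w: "w = (n, y)" by (cases w)
    show "(loop_action p z \<gamma> \<circ> loop_action p z (reversepath \<gamma>)) w = id w"
    proof (cases "(f ^^ n) y = z")
      case True
      have "(f ^^ n) (act n (reversepath \<gamma>) y) = z" using act_fibre[OF good_rev[OF g(1)]] True g by simp
      then show ?thesis using act_rev'[OF g(1)] True g w by (simp add: loop_action_apply)
    qed (use w in \<open>simp add: loop_action_apply\<close>)
  qed
  show "loop_action p z (reversepath \<gamma>) \<circ> loop_action p z \<gamma> = id"
  proof
    fix w :: "nat \<times> complex"
    obtain n y where w: "w = (n, y)" by (cases w)
    show "(loop_action p z (reversepath \<gamma>) \<circ> loop_action p z \<gamma>) w = id w"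
    proof (cases "(f ^^ n) y = z")
      case True
      have "(f ^^ n) (act n \<gamma> y) = z" using act_fibre[OF g(1)] True g by simp
      then show ?thesis using act_rev[OF g(1)] True g w by (simp add: loop_action_apply)
    qed (use w in \<open>simp add: loop_action_apply\<close>)
  qed
qed

lemma IMG_simps: "carrier (IMG p z) = loop_action p z ` pc_loops p z" "x \<otimes>\<^bsub>IMG p z\<^esub> y = y \<circ> x" "\<one>\<^bsub>IMG p z\<^esub> = id"
  by (simp_all add: IMG_def)

lemma group_IMG: assumes "z \<notin> P" shows "group (IMG p z)"
proof (rule groupI)
  fix x y assume "x \<in> carrier (IMG p z)" "y \<in> carrier (IMG p z)"
  then obtain \<gamma>1 \<gamma>2 where g: "\<gamma>1 \<in> pc_loops p z" "x = loop_action p z \<gamma>1" "\<gamma>2 \<in> pc_loops p z" "y = loop_action p z \<gamma>2"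
    unfolding IMG_simps(1) by blast
  have "x \<otimes>\<^bsub>IMG p z\<^esub> y = loop_action p z (\<gamma>1 +++ \<gamma>2)"
    unfolding IMG_simps(2) g(2,4) by (rule loop_action_join(2)[OF g(1,3)])
  then show "x \<otimes>\<^bsub>IMG p z\<^esub> y \<in> carrier (IMG p z)"
    unfolding IMG_simps(1) using loop_action_join(1)[OF g(1,3)] by (rule image_eqI)
next
  show "\<one>\<^bsub>IMG p z\<^esub> \<in> carrier (IMG p z)" 
    unfolding IMG_simps(1,3) by (rule image_eqI, rule loop_action_const(2)[OF assms, symmetric], rule loop_action_const(1)[OF assms])
next
  fix x assume "x \<in> carrier (IMG p z)"
  then obtain \<gamma> where g: "\<gamma> \<in> pc_loops p z" "x = loop_action p z \<gamma>" unfolding IMG_simps by blast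
  show "\<exists>y\<in>carrier (IMG p z). y \<otimes>\<^bsub>IMG p z\<^esub> x = \<one>\<^bsub>IMG p z\<^esub>"
  proof (rule bexI)
    show "loop_action p z (reversepath \<gamma>) \<otimes>\<^bsub>IMG p z\<^esub> x = \<one>\<^bsub>IMG p z\<^esub>"
      unfolding IMG_simps g(2) by (rule loop_action_rev(2)[OF g(1)])
    show "loop_action p z (reversepath \<gamma>) \<in> carrier (IMG p z)"
      unfolding IMG_simps by (rule imageI[OF loop_action_rev(1)[OF g(1)]])
  qed
next
  fix x y u assume "x \<in> carrier (IMG p z)" "y \<in> carrier (IMG p z)" "u \<in> carrier (IMG p z)"
  show "x \<otimes>\<^bsub>IMG p z\<^esub> y \<otimes>\<^bsub>IMG p z\<^esub> u = x \<otimes>\<^bsub>IMG p z\<^esub> (y \<otimes>\<^bsub>IMG p z\<^esub> u)"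
    unfolding IMG_simps by (simp only: o_assoc)
next
  fix x assume "x \<in> carrier (IMG p z)"
  show "\<one>\<^bsub>IMG p z\<^esub> \<otimes>\<^bsub>IMG p z\<^esub> x = x" unfolding IMG_simps by (simp only: comp_id)
qed

end

section \<open>Lassos around post-critical points\<close>

context quad
begin

text \<open>Equality of the actions on all fibres is all that is needed of homotopy.\<close>

definition same :: "(real \<Rightarrow> complex) \<Rightarrow> (real \<Rightarrow> complex) \<Rightarrow> bool" where
  "same \<gamma> \<gamma>' \<longleftrightarrow> good \<gamma> \<and> good \<gamma>' \<and> \<gamma> 0 = \<gamma>' 0 \<and> \<gamma> 1 = \<gamma>' 1 \<and> (\<forall>n y. (f ^^ n) y = \<gamma> 0 \<longrightarrow> act n \<gamma> y = act n \<gamma>' y)"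

lemma same_refl: "good \<gamma> \<Longrightarrow> same \<gamma> \<gamma>"
  unfolding same_def by simp

lemma same_sym: "same \<gamma> \<gamma>' \<Longrightarrow> same \<gamma>' \<gamma>"
  unfolding same_def by simp

lemma same_trans: "same \<gamma> \<gamma>' \<Longrightarrow> same \<gamma>' \<gamma>'' \<Longrightarrow> same \<gamma> \<gamma>''"
  unfolding same_def by simp

lemma sameD: "same \<gamma> \<gamma>' \<Longrightarrow> (f ^^ n) y = \<gamma> 0 \<Longrightarrow> act n \<gamma> y = act n \<gamma>' y"
  unfolding same_def by blast

lemma same_join:
  assumes "same \<gamma>1 \<gamma>1'" "same \<gamma>2 \<gamma>2'" "\<gamma>1 1 = \<gamma>2 0"
  shows "same (\<gamma>1 +++ \<gamma>2) (\<gamma>1' +++ \<gamma>2')"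
proof -
  have g: "good \<gamma>1" "good \<gamma>2" "good \<gamma>1'" "good \<gamma>2'" and e: "\<gamma>1 0 = \<gamma>1' 0" "\<gamma>1 1 = \<gamma>1' 1" "\<gamma>2 0 = \<gamma>2' 0" "\<gamma>2 1 = \<gamma>2' 1" "\<gamma>1' 1 = \<gamma>2' 0"
    using assms unfolding same_def by simp_all
  have "act n (\<gamma>1 +++ \<gamma>2) y = act n (\<gamma>1' +++ \<gamma>2') y" if y: "(f ^^ n) y = \<gamma>1 0" for n y
  proof -
    have y2: "(f ^^ n) (act n \<gamma>1 y) = \<gamma>2 0" using act_fibre[OF g(1) y] assms(3) by simp
    show ?thesis
      using act_join[OF g(1,2) assms(3) y] act_join[OF g(3,4) e(5), of n y] y e(1) sameD[OF assms(1) y] sameD[OF assms(2) y2] by simp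
  qed
  then show ?thesis unfolding same_def using g e good_join[OF g(1,2) assms(3)] good_join[OF g(3,4) e(5)] by simp
qed

text \<open>Level \<open>n\<close> over a lift is level \<open>Suc n\<close> over the path below it.
  That the lifts end at the same point is the case \<open>n = 0\<close>.\<close>

lemma same_lift:
  assumes s: "same \<gamma> \<gamma>'" and d: "flift \<delta> \<gamma>" "flift \<delta>' \<gamma>'" "\<delta> 0 = \<delta>' 0"
  shows "same \<delta> \<delta>'"
proof -
  have g: "good \<gamma>" "good \<gamma>'" using s unfolding same_def by auto
  have gd: "good \<delta>" "good \<delta>'" using flift_good d g by auto
  have st: "f (\<delta> 0) = \<gamma> 0" using d(1) unfolding flift_def by auto
  have eq: "act n \<delta> y = act n \<delta>' y" if y: "(f ^^ n) y = \<delta> 0" for n y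
  proof -
    have "(f ^^ Suc n) y = \<gamma> 0" using y st by simp
    then have "act (Suc n) \<gamma> y = act (Suc n) \<gamma>' y" by (rule sameD[OF s])
    then show ?thesis using act_Suc[OF g(1) d(1), of n y] act_Suc[OF g(2) d(2), of n y] y d(3) by simp
  qed
  moreover have "\<delta> 1 = \<delta>' 1" using eq[of 0 "\<delta> 0"] act_0[OF gd(1)] act_0[OF gd(2)] d(3) by simp
  ultimately show ?thesis unfolding same_def using gd d(3) by simp
qed

lemma same_assoc:
  assumes g: "good \<gamma>1" "good \<gamma>2" "good \<gamma>3" and e: "\<gamma>1 1 = \<gamma>2 0" "\<gamma>2 1 = \<gamma>3 0"
  shows "same (\<gamma>1 +++ (\<gamma>2 +++ \<gamma>3)) ((\<gamma>1 +++ \<gamma>2) +++ \<gamma>3)"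
proof -
  have g23: "good (\<gamma>2 +++ \<gamma>3)" and g12: "good (\<gamma>1 +++ \<gamma>2)" using good_join g e by auto
  have "act n (\<gamma>1 +++ (\<gamma>2 +++ \<gamma>3)) y = act n ((\<gamma>1 +++ \<gamma>2) +++ \<gamma>3) y" if y: "(f ^^ n) y = \<gamma>1 0" for n y
  proof -
    have y2: "(f ^^ n) (act n \<gamma>1 y) = \<gamma>2 0" using act_fibre[OF g(1) y] e(1) by simp
    show ?thesis
      using act_join[OF g(1) g23, of n y] act_join[OF g(2,3) e(2) y2] act_join[OF g12 g(3), of n y] act_join[OF g(1,2) e(1) y] y e by simp
  qed
  then show ?thesis unfolding same_def using good_join[OF g(1) g23] good_join[OF g12 g(3)] e by simp
qed

text \<open>A disc around \<open>q\<close> punctured in \<open>q\<close> only; as \<open>h\<close> has no zero, small circles wind once around \<open>q\<close>.\<close>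

definition cusp :: "complex \<Rightarrow> (complex \<Rightarrow> complex) \<Rightarrow> bool" where
  "cusp q \<phi> \<longleftrightarrow> (\<exists>h. continuous_on (ball 0 1) h \<and> (\<forall>s\<in>ball 0 1. h s \<noteq> 0 \<and> \<phi> s = q + s * h s)) \<and>
     (\<forall>s\<in>ball 0 1. s \<noteq> 0 \<longrightarrow> \<phi> s \<notin> P)"

definition circ :: "(complex \<Rightarrow> complex) \<Rightarrow> complex \<Rightarrow> real \<Rightarrow> complex" where
  "circ \<phi> s t = \<phi> (s * exp (2 * of_real pi * \<i> * of_real t))"

text \<open>The circle is parametrised by a disc \<open>\<phi>\<close> that may be distorted, and
  the path is fixed only up to \<open>same\<close>; in this form the definition is stable under
  lifting. The point \<open>q\<close> may also lie outside \<open>P\<close>, which happens for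
  siblings.\<close>

definition lasso :: "complex \<Rightarrow> complex \<Rightarrow> (real \<Rightarrow> complex) \<Rightarrow> bool" where
  "lasso x q \<gamma> \<longleftrightarrow> (\<exists>\<phi> s \<tau>. cusp q \<phi> \<and> s \<in> ball 0 1 \<and> s \<noteq> 0 \<and> good \<tau> \<and> \<tau> 0 = x \<and> \<tau> 1 = \<phi> s \<and>
     same \<gamma> (\<tau> +++ (circ \<phi> s +++ reversepath \<tau>)))"

lemma lasso_ends: "lasso x q \<gamma> \<Longrightarrow> \<gamma> 0 = x \<and> \<gamma> 1 = x \<and> good \<gamma>"
  unfolding lasso_def same_def by auto

lemma cusp_cont: "cusp q \<phi> \<Longrightarrow> continuous_on (ball 0 1) \<phi>"
proof -
  assume "cusp q \<phi>"
  then obtain h where h: "continuous_on (ball 0 1) h" "\<And>s. s \<in> ball 0 1 \<Longrightarrow> \<phi> s = q + s * h s" unfolding cusp_def by blast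
  have "continuous_on (ball 0 1) (\<lambda>s. q + s * h s)" by (intro continuous_intros h(1))
  then show ?thesis using h(2) by (metis (no_types, lifting) continuous_on_cong)
qed

lemma cusp_zero: "cusp q \<phi> \<Longrightarrow> \<phi> 0 = q"
  unfolding cusp_def by fastforce

lemma good_arc:
  assumes \<phi>: "cusp q \<phi>" and s: "s \<in> ball 0 1" "s \<noteq> 0" and k: "continuous_on {0..1} k"
  shows "good (\<lambda>t::real. \<phi> (s * exp (\<i> * of_real (k t))))"
proof -
  have n: "norm (s * exp (\<i> * of_real (k t))) = norm s" for t by (simp add: norm_mult)
  have "continuous_on {0..1} (\<lambda>t. \<phi> (s * exp (\<i> * of_real (k t))))"
    by (rule continuous_on_compose2[OF cusp_cont[OF \<phi>]]) (use n s in \<open>auto intro!: continuous_intros k simp: norm_mult\<close>)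
  moreover have "\<phi> (s * exp (\<i> * of_real (k t))) \<notin> P" for t
    using \<phi> s n[of t] unfolding cusp_def by simp
  ultimately show ?thesis unfolding good_def path_def path_image_def by auto
qed

lemma circ_eq: "circ \<phi> s = (\<lambda>t. \<phi> (s * exp (\<i> * of_real (2 * pi * t))))"
  unfolding circ_def by (simp add: mult_ac)

lemma good_circ: "cusp q \<phi> \<Longrightarrow> s \<in> ball 0 1 \<Longrightarrow> s \<noteq> 0 \<Longrightarrow> good (circ \<phi> s)"
  unfolding circ_eq by (rule good_arc) (auto intro!: continuous_intros)

lemma circ_ends [simp]: "circ \<phi> s 0 = \<phi> s" "circ \<phi> s 1 = \<phi> s"
  by (simp_all add: circ_def)

lemma good_lasso:
  assumes "cusp q \<phi>" "s \<in> ball 0 1" "s \<noteq> 0" "good \<tau>" "\<tau> 1 = \<phi> s"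
  shows "good (circ \<phi> s +++ reversepath \<tau>)" "good (\<tau> +++ (circ \<phi> s +++ reversepath \<tau>))"
proof -
  show 1: "good (circ \<phi> s +++ reversepath \<tau>)"
    by (rule good_join[OF good_circ[OF assms(1-3)] good_rev[OF assms(4)]]) (simp add: assms)
  show "good (\<tau> +++ (circ \<phi> s +++ reversepath \<tau>))"
    by (rule good_join[OF assms(4) 1]) (simp add: assms)
qed

lemma lassoI:
  assumes "cusp q \<phi>" "s \<in> ball 0 1" "s \<noteq> 0" "good \<tau>" "\<tau> 1 = \<phi> s" "same \<gamma> (\<tau> +++ (circ \<phi> s +++ reversepath \<tau>))"
  shows "lasso (\<tau> 0) q \<gamma>"
  unfolding lasso_def using assms by blast

lemma lasso_conj:
  assumes \<eta>: "good \<eta>" "\<eta> 1 = x" and l: "lasso x q \<gamma>"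
  shows "lasso (\<eta> 0) q (\<eta> +++ (\<gamma> +++ reversepath \<eta>))"
proof -
  obtain \<phi> s \<tau> where *: "cusp q \<phi>" "s \<in> ball 0 1" "s \<noteq> 0" "good \<tau>" "\<tau> 0 = x" "\<tau> 1 = \<phi> s"
    "same \<gamma> (\<tau> +++ (circ \<phi> s +++ reversepath \<tau>))" using l unfolding lasso_def by blast
  have ge: "good \<gamma>" "\<gamma> 0 = x" "\<gamma> 1 = x" using lasso_ends[OF l] by auto
  have gt: "good (\<eta> +++ \<tau>)" using good_join[OF \<eta>(1) *(4)] \<eta>(2) *(5) by simp
  have gc: "good (circ \<phi> s)" by (rule good_circ[OF *(1-3)])
  note gr = good_rev[OF *(4)] good_rev[OF \<eta>(1)]
  note gl = good_lasso[OF *(1-4,6)]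
  have rj: "reversepath (\<eta> +++ \<tau>) = reversepath \<tau> +++ reversepath \<eta>"
    by (rule reversepath_joinpaths) (use \<eta> * in \<open>simp add: pathfinish_def pathstart_def\<close>)
  have "same (\<eta> +++ (\<gamma> +++ reversepath \<eta>)) ((\<eta> +++ \<tau>) +++ (circ \<phi> s +++ (reversepath \<tau> +++ reversepath \<eta>)))"
  proof -
    have 1: "same (\<gamma> +++ reversepath \<eta>) ((\<tau> +++ (circ \<phi> s +++ reversepath \<tau>)) +++ reversepath \<eta>)"
      by (rule same_join[OF *(7) same_refl[OF gr(2)]]) (use ge \<eta> in simp)
    have 2: "same ((\<tau> +++ (circ \<phi> s +++ reversepath \<tau>)) +++ reversepath \<eta>) (\<tau> +++ ((circ \<phi> s +++ reversepath \<tau>) +++ reversepath \<eta>))"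
      by (rule same_sym[OF same_assoc[OF *(4) gl(1) gr(2)]]) (use * \<eta> in simp_all)
    have 3: "same (\<tau> +++ ((circ \<phi> s +++ reversepath \<tau>) +++ reversepath \<eta>)) (\<tau> +++ (circ \<phi> s +++ (reversepath \<tau> +++ reversepath \<eta>)))"
      by (rule same_join[OF same_refl[OF *(4)] same_sym[OF same_assoc[OF gc gr]]]) (use * \<eta> in simp_all)
    note 123 = same_trans[OF same_trans[OF 1 2] 3]
    have 4: "same (\<eta> +++ (\<gamma> +++ reversepath \<eta>)) (\<eta> +++ (\<tau> +++ (circ \<phi> s +++ (reversepath \<tau> +++ reversepath \<eta>))))"
      by (rule same_join[OF same_refl[OF \<eta>(1)] 123]) (use ge \<eta> in simp)
    have g5: "good (circ \<phi> s +++ (reversepath \<tau> +++ reversepath \<eta>))"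
      by (rule good_join[OF gc good_join[OF gr]]) (use * \<eta> in simp_all)
    have 5: "same (\<eta> +++ (\<tau> +++ (circ \<phi> s +++ (reversepath \<tau> +++ reversepath \<eta>)))) ((\<eta> +++ \<tau>) +++ (circ \<phi> s +++ (reversepath \<tau> +++ reversepath \<eta>)))"
      by (rule same_assoc[OF \<eta>(1) *(4) g5]) (use * \<eta> in simp_all)
    show ?thesis by (rule same_trans[OF 4 5])
  qed
  then have "same (\<eta> +++ (\<gamma> +++ reversepath \<eta>)) ((\<eta> +++ \<tau>) +++ (circ \<phi> s +++ reversepath (\<eta> +++ \<tau>)))" unfolding rj .
  from lassoI[OF *(1-3) gt _ this] *(6) show ?thesis by simp
qed

section \<open>Lifting punctured discs and lassos\<close>

text \<open>The difference \<open>f (\<psi> s) - f (\<psi> 0)\<close> factors as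
  \<open>(\<psi> s - \<psi> 0) * d s\<close>. A zero of \<open>d\<close> would make
  \<open>\<psi> s\<close> the mirror image of \<open>\<psi> 0\<close>, forcing \<open>s = 0\<close>
  and \<open>\<psi> 0 = c\<close>, against \<open>q \<noteq> v\<close>; so division by
  \<open>d\<close> gives the nonvanishing factor of the lifted disc.\<close>

lemma cusp_lift:
  assumes \<phi>: "cusp q \<phi>" and q: "q \<noteq> v" and s0: "s0 \<in> ball 0 1" and w: "f w = \<phi> s0"
  obtains \<psi> where "cusp (\<psi> 0) \<psi>" "cusp (2 * c - \<psi> 0) (\<lambda>s. 2 * c - \<psi> s)" "f (\<psi> 0) = q"
    "\<And>s. s \<in> ball 0 1 \<Longrightarrow> f (\<psi> s) = \<phi> s" "\<psi> s0 = w"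
proof -
  obtain h where h: "continuous_on (ball 0 1) h" "\<And>s. s \<in> ball 0 1 \<Longrightarrow> h s \<noteq> 0 \<and> \<phi> s = q + s * h s"
    using \<phi> unfolding cusp_def by blast
  have outP: "\<phi> s \<notin> P" if "s \<in> ball 0 1" "s \<noteq> 0" for s using \<phi> that unfolding cusp_def by blast
  have nv: "\<phi> s \<noteq> v" if "s \<in> ball 0 1" for s
    using outP[OF that] v_in_P cusp_zero[OF \<phi>] q by (cases "s = 0") auto
  have con: "contractible (ball 0 1 :: complex set)" by (simp add: convex_imp_contractible)
  obtain \<psi> where \<psi>: "continuous_on (ball 0 1) \<psi>" "\<And>s. s \<in> ball 0 1 \<Longrightarrow> f (\<psi> s) = \<phi> s" "\<psi> s0 = w"
    using lift_ex[OF con cusp_cont[OF \<phi>] nv s0 w] by blast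
  have f0: "f (\<psi> 0) = q" using \<psi>(2)[of 0] cusp_zero[OF \<phi>] by simp
  define d where "d s = a * (\<psi> s + \<psi> 0 - 2 * c)" for s
  have dz: "d s \<noteq> 0" if "s \<in> ball 0 1" for s
  proof
    assume "d s = 0"
    then have "\<psi> s + \<psi> 0 - 2 * c = 0" using a0 unfolding d_def by (metis mult_eq_0_iff)
    then have e: "\<psi> s = 2 * c - \<psi> 0" by algebra
    then have "f (\<psi> s) = q" using f0 by simp
    then have "\<phi> s = q" using \<psi>(2)[OF that] by simp
    then have "s = 0" using h(2)[OF that] by simp
    then have "\<psi> 0 = c" using e by simp
    then show False using f0 f_c q by simp
  qed
  have diff: "\<psi> s = \<psi> 0 + s * (h s / d s)" if s: "s \<in> ball 0 1" for s
  proof -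
    have "f (\<psi> s) - f (\<psi> 0) = (\<psi> s - \<psi> 0) * d s" unfolding poly_p d_def by (simp add: power2_eq_square algebra_simps)
    moreover have "f (\<psi> s) - f (\<psi> 0) = s * h s" using \<psi>(2)[OF s] f0 h(2)[OF s] by simp
    ultimately show ?thesis using dz[OF s] by (simp add: field_simps)
  qed
  have cont: "continuous_on (ball 0 1) (\<lambda>s. h s / d s)" "continuous_on (ball 0 1) (\<lambda>s. - (h s / d s))"
    unfolding d_def by (intro continuous_intros h(1) \<psi>(1); use dz in \<open>simp add: d_def\<close>)+
  have oP: "\<psi> s \<notin> P" "2 * c - \<psi> s \<notin> P" if "s \<in> ball 0 1" "s \<noteq> 0" for s
    using outP[OF that] \<psi>(2)[OF that(1)] f_in_P[of "\<psi> s"] f_in_P[of "2 * c - \<psi> s"] by auto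
  have "cusp (\<psi> 0) \<psi>"
    unfolding cusp_def
  proof (intro conjI exI[of _ "\<lambda>s. h s / d s"] ballI impI)
    show "continuous_on (ball 0 1) (\<lambda>s. h s / d s)" by (rule cont(1))
    fix s :: complex assume s: "s \<in> ball 0 1"
    show "h s / d s \<noteq> 0" using h(2)[OF s] dz[OF s] by simp
    show "\<psi> s = \<psi> 0 + s * (h s / d s)" by (rule diff[OF s])
  qed (use oP in blast)
  moreover have "cusp (2 * c - \<psi> 0) (\<lambda>s. 2 * c - \<psi> s)"
    unfolding cusp_def
  proof (intro conjI exI[of _ "\<lambda>s. - (h s / d s)"] ballI impI)
    show "continuous_on (ball 0 1) (\<lambda>s. - (h s / d s))" by (rule cont(2))
    fix s :: complex assume s: "s \<in> ball 0 1"
    show "- (h s / d s) \<noteq> 0" using h(2)[OF s] dz[OF s] by simp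
    show "2 * c - \<psi> s = 2 * c - \<psi> 0 + s * - (h s / d s)" using diff[OF s] by simp
  qed (use oP in blast)
  ultimately show ?thesis using that f0 \<psi>(2,3) by blast
qed

text \<open>Over the critical value the disc is first pulled back along squaring, which turns
  \<open>s * h s\<close> into a square times a nonvanishing function. The root \<open>k\<close> of
  this function is even: \<open>k (- s) / k s\<close> is continuous with values \<open>1\<close> and
  \<open>- 1\<close>, and it is \<open>1\<close> at the centre. Evenness makes \<open>- s\<close>
  correspond to the mirror image in \<open>c\<close>.\<close>

lemma cusp_sqrt:
  assumes \<phi>: "cusp v \<phi>" and \<sigma>: "\<sigma> \<in> ball 0 1" "\<sigma> \<noteq> 0" and w: "f w = \<phi> (\<sigma>\<^sup>2)"
  obtains \<psi> where "cusp c \<psi>" "\<And>s. s \<in> ball 0 1 \<Longrightarrow> f (\<psi> s) = \<phi> (s\<^sup>2)" "\<psi> \<sigma> = w"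
    "\<And>s. s \<in> ball 0 1 \<Longrightarrow> \<psi> (- s) = 2 * c - \<psi> s"
proof -
  note goal_rule = that
  obtain h where h: "continuous_on (ball 0 1) h" "\<And>s. s \<in> ball 0 1 \<Longrightarrow> h s \<noteq> 0 \<and> \<phi> s = v + s * h s"
    using \<phi> unfolding cusp_def by blast
  have outP: "\<phi> s \<notin> P" if "s \<in> ball 0 1" "s \<noteq> 0" for s using \<phi> that unfolding cusp_def by blast
  have sq: "s\<^sup>2 \<in> ball 0 1" if "s \<in> ball 0 1" for s :: complex
    using that by (simp add: norm_power abs_square_less_1 power_less_one_iff)
  have con: "contractible (ball 0 1 :: complex set)" by (simp add: convex_imp_contractible)
  have "continuous_on (ball 0 1) (\<lambda>s. h (s\<^sup>2) / a)"
    by (intro continuous_intros continuous_on_compose2[OF h(1)]) (use sq a0 in auto)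
  moreover have "h (s\<^sup>2) / a \<noteq> 0" if "s \<in> ball 0 1" for s using h(2)[OF sq[OF that]] a0 by simp
  ultimately obtain k where k: "continuous_on (ball 0 1) k" "\<And>s. s \<in> ball 0 1 \<Longrightarrow> h (s\<^sup>2) / a = (k s)\<^sup>2"
    using continuous_sqrt_on_contractible[OF _ con, of "\<lambda>s. h (s\<^sup>2) / a"] by blast
  have knz: "k s \<noteq> 0" if "s \<in> ball 0 1" for s using k(2)[OF that] h(2)[OF sq[OF that]] a0 by auto
  have keven: "k (- s) = k s" if s: "s \<in> ball 0 1" for s
  proof -
    define q where "q s = k (- s) / k s" for s
    have "q s = 1 \<or> q s = - 1" if "s \<in> ball 0 1" for s
    proof -
      have "(k (- s))\<^sup>2 = (k s)\<^sup>2" using k(2)[OF that] k(2)[of "- s"] that by simp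
      then show ?thesis using knz[OF that] unfolding q_def power2_eq_iff by (auto simp: field_simps)
    qed
    then have "q ` ball 0 1 \<subseteq> {1, - 1}" by blast
    then have fin: "finite (q ` ball 0 1)" using finite_subset by blast
    have "continuous_on (ball 0 1) (\<lambda>s. k (- s))"
      by (rule continuous_on_compose2[OF k(1)]) (auto intro!: continuous_intros)
    then have "continuous_on (ball 0 1) q" unfolding q_def by (intro continuous_intros k(1) ballI knz)
    from continuous_finite_range_constant[OF _ this fin]
    obtain r where "\<And>s. s \<in> ball 0 1 \<Longrightarrow> q s = r" unfolding constant_on_def by (auto simp: convex_connected)
    then have "q s = q 0" using s by simp
    then show ?thesis using knz[OF s] knz[of 0] unfolding q_def by (simp add: field_simps)
  qed
  have main: ?thesis if e: "w = c + \<sigma> * K \<sigma>" and K: "continuous_on (ball 0 1) K" "\<And>s. s \<in> ball 0 1 \<Longrightarrow> K s \<noteq> 0"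
    "\<And>s. s \<in> ball 0 1 \<Longrightarrow> (K s)\<^sup>2 = h (s\<^sup>2) / a" "\<And>s. s \<in> ball 0 1 \<Longrightarrow> K (- s) = K s" for K
  proof (rule goal_rule)
    let ?\<psi> = "\<lambda>s. c + s * K s"
    show fp: "f (?\<psi> s) = \<phi> (s\<^sup>2)" if "s \<in> ball 0 1" for s
    proof -
      have "f (?\<psi> s) = a * (s\<^sup>2 * (K s)\<^sup>2) + v" by (simp add: poly_p power_mult_distrib)
      also have "\<dots> = v + s\<^sup>2 * h (s\<^sup>2)" unfolding K(3)[OF that] using a0 by simp
      also have "\<dots> = \<phi> (s\<^sup>2)" using h(2)[OF sq[OF that]] by simp
      finally show ?thesis .
    qed
    have "?\<psi> s \<notin> P" if "s \<in> ball 0 1" "s \<noteq> 0" for s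
      using fp[OF that(1)] outP[OF sq[OF that(1)]] that(2) f_in_P[of "?\<psi> s"] by auto
    then show "cusp c ?\<psi>" unfolding cusp_def using K(1,2) by blast
    show "?\<psi> \<sigma> = w" using e by simp
    show "?\<psi> (- s) = 2 * c - ?\<psi> s" if "s \<in> ball 0 1" for s using K(4)[OF that] by simp
  qed
  have "f w = a * (\<sigma> * k \<sigma>)\<^sup>2 + v"
    using w h(2)[OF sq[OF \<sigma>(1)]] k(2)[OF \<sigma>(1)] a0 by (simp add: power_mult_distrib field_simps)
  then have "f w = f (c + \<sigma> * k \<sigma>)" by (simp add: poly_p)
  then have "w = c + \<sigma> * k \<sigma> \<or> w = c + \<sigma> * (- k \<sigma>)" unfolding f_eq by (auto simp: algebra_simps)
  then show ?thesis
  proof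
    assume "w = c + \<sigma> * k \<sigma>"
    then show ?thesis using main[of k] k keven knz by simp
  next
    assume e: "w = c + \<sigma> * (- k \<sigma>)"
    show ?thesis
      by (rule main[of "\<lambda>s. - k s"]) (use e k keven knz in \<open>auto intro!: continuous_intros\<close>)
  qed
qed

lemma flift_mirror: "flift \<delta> \<gamma> \<Longrightarrow> flift (\<lambda>t. 2 * c - \<delta> t) \<gamma>"
  unfolding flift_def path_def by (auto intro!: continuous_intros)

lemma flift_join: "flift \<delta>1 \<gamma>1 \<Longrightarrow> flift \<delta>2 \<gamma>2 \<Longrightarrow> \<delta>1 1 = \<delta>2 0 \<Longrightarrow> flift (\<delta>1 +++ \<delta>2) (\<gamma>1 +++ \<gamma>2)"
  unfolding flift_def by (auto simp: pathfinish_def pathstart_def intro!: path_join_imp) (auto simp: joinpaths_def)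

lemma flift_rev: "flift \<delta> \<gamma> \<Longrightarrow> flift (reversepath \<delta>) (reversepath \<gamma>)"
  unfolding flift_def path_reversepath by (simp add: reversepath_def)

text \<open>Tail, circle and return are lifted separately; the circle stays closed because the whole
  disc lifts. The mirror image supplies the other lift, around the other preimage of
  \<open>q\<close>.\<close>

lemma lasso_lift_noncritical:
  assumes l: "lasso x q \<gamma>" and q: "q \<noteq> v" and d: "flift \<delta> \<gamma>"
  shows "\<exists>q'. f q' = q \<and> lasso (\<delta> 0) q' \<delta> \<and> lasso (2 * c - \<delta> 0) (2 * c - q') (\<lambda>t. 2 * c - \<delta> t)"
proof -
  obtain \<phi> s \<tau> where *: "cusp q \<phi>" "s \<in> ball 0 1" "s \<noteq> 0" "good \<tau>" "\<tau> 0 = x" "\<tau> 1 = \<phi> s"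
    "same \<gamma> (\<tau> +++ (circ \<phi> s +++ reversepath \<tau>))" using l unfolding lasso_def by blast
  have f0: "f (\<delta> 0) = \<tau> 0" using d lasso_ends[OF l] *(5) unfolding flift_def by auto
  obtain \<tau>' where t: "flift \<tau>' \<tau>" "\<tau>' 0 = \<delta> 0" using flift_ex[OF *(4) f0] by blast
  have "f (\<tau>' 1) = \<phi> s" using t(1) *(6) unfolding flift_def by auto
  from cusp_lift[OF *(1) q *(2) this] obtain \<psi> where \<psi>: "cusp (\<psi> 0) \<psi>" "cusp (2 * c - \<psi> 0) (\<lambda>s. 2 * c - \<psi> s)" "f (\<psi> 0) = q"
    "\<And>s. s \<in> ball 0 1 \<Longrightarrow> f (\<psi> s) = \<phi> s" "\<psi> s = \<tau>' 1" by blast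
  have in_ball: "s * exp (2 * of_real pi * \<i> * of_real t) \<in> ball 0 1" for t :: real
  proof -
    have "norm (exp (2 * of_real pi * \<i> * of_real t)) = 1" by simp
    then show ?thesis using *(2) by (simp add: norm_mult)
  qed
  have fc: "flift (circ \<psi> s) (circ \<phi> s)"
    unfolding flift_def using good_circ[OF \<psi>(1) *(2,3)] \<psi>(4)[OF in_ball] unfolding good_def by (simp add: circ_def)
  have "flift (\<tau>' +++ (circ \<psi> s +++ reversepath \<tau>')) (\<tau> +++ (circ \<phi> s +++ reversepath \<tau>))"
    by (intro flift_join flift_rev fc t(1)) (simp_all add: \<psi>(5))
  note s1 = same_lift[OF *(7) d this]
  have "lasso (\<tau>' 0) (\<psi> 0) \<delta>"
    by (rule lassoI[OF \<psi>(1) *(2,3) flift_good[OF t(1) *(4)]]) (use \<psi>(5) s1 t(2) in simp_all)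
  moreover have "lasso (2 * c - \<tau>' 0) (2 * c - \<psi> 0) (\<lambda>t. 2 * c - \<delta> t)"
  proof -
    let ?t = "\<lambda>t. 2 * c - \<tau>' t" and ?psi = "\<lambda>s. 2 * c - \<psi> s"
    have tm: "flift ?t \<tau>" by (rule flift_mirror[OF t(1)])
    have fc': "flift (circ ?psi s) (circ \<phi> s)"
      using flift_mirror[OF fc] by (simp add: circ_def[abs_def])
    have "flift (?t +++ (circ ?psi s +++ reversepath ?t)) (\<tau> +++ (circ \<phi> s +++ reversepath \<tau>))"
      by (intro flift_join flift_rev fc' tm) (simp_all add: \<psi>(5))
    note s2 = same_lift[OF *(7) flift_mirror[OF d] this]
    show ?thesis
      by (rule lassoI[OF \<psi>(2) *(2,3) flift_good[OF tm *(4)]]) (use \<psi>(5) s2 t(2) in simp_all)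
  qed
  ultimately show ?thesis using \<psi>(3) t(2) by auto
qed

text \<open>A circle around \<open>v\<close> lifts to half a circle around \<open>c\<close>, so the
  lift ends at the mirror image of its start, and its own mirror image completes the circle.\<close>

lemma lasso_lift_critical:
  assumes l: "lasso x v \<gamma>" and d: "flift \<delta> \<gamma>"
  shows "\<delta> 1 = 2 * c - \<delta> 0" "lasso (\<delta> 0) c (\<delta> +++ (\<lambda>t. 2 * c - \<delta> t))"
proof -
  obtain \<phi> s \<tau> where *: "cusp v \<phi>" "s \<in> ball 0 1" "s \<noteq> 0" "good \<tau>" "\<tau> 0 = x" "\<tau> 1 = \<phi> s"
    "same \<gamma> (\<tau> +++ (circ \<phi> s +++ reversepath \<tau>))" using l unfolding lasso_def by blast
  have f0: "f (\<delta> 0) = \<tau> 0" using d lasso_ends[OF l] *(5) unfolding flift_def by auto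
  obtain \<tau>' where t: "flift \<tau>' \<tau>" "\<tau>' 0 = \<delta> 0" using flift_ex[OF *(4) f0] by blast
  \<comment> \<open>The lifted disc is parametrised through squaring, so its base point is a square
    root of \<open>s\<close>.\<close>
  define \<sigma> where "\<sigma> = csqrt s"
  have \<sigma>2: "\<sigma>\<^sup>2 = s" by (simp add: \<sigma>_def)
  have \<sigma>: "\<sigma> \<in> ball 0 1" "\<sigma> \<noteq> 0"
  proof -
    have "(norm \<sigma>)\<^sup>2 < 1" using *(2) \<sigma>2 by (metis norm_power mem_ball_0)
    then show "\<sigma> \<in> ball 0 1" by (simp add: abs_square_less_1 power2_less_1_iff)
    show "\<sigma> \<noteq> 0" using \<sigma>2 *(3) by auto
  qed
  have "f (\<tau>' 1) = \<phi> (\<sigma>\<^sup>2)" using t(1) *(6) unfolding flift_def \<sigma>2 by auto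
  from cusp_sqrt[OF *(1) \<sigma> this] obtain \<psi> where \<psi>: "cusp c \<psi>" "\<And>s. s \<in> ball 0 1 \<Longrightarrow> f (\<psi> s) = \<phi> (s\<^sup>2)" "\<psi> \<sigma> = \<tau>' 1"
    "\<And>s. s \<in> ball 0 1 \<Longrightarrow> \<psi> (- s) = 2 * c - \<psi> s" by blast
  define half where "half = (\<lambda>t::real. \<psi> (\<sigma> * exp (\<i> * of_real (pi * t))))"
  let ?m = "\<lambda>\<beta> (t::real). 2 * c - \<beta> t"
  have in_ball: "\<sigma> * exp (\<i> * of_real u) \<in> ball 0 1" for u :: real
    using \<sigma>(1) by (simp add: norm_mult)
  have gh: "good half" unfolding half_def by (rule good_arc[OF \<psi>(1) \<sigma>]) (intro continuous_intros)
  have half_ends: "half 0 = \<tau>' 1" "half 1 = 2 * c - \<tau>' 1"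
    unfolding half_def using \<psi>(3) \<psi>(4)[OF \<sigma>(1)] by (simp_all add: exp_pi_i')
  have fh: "flift half (circ \<phi> s)"
  proof -
    have "f (half t) = circ \<phi> s t" for t
    proof -
      have "(\<sigma> * exp (\<i> * of_real (pi * t)))\<^sup>2 = s * exp (2 * of_real pi * \<i> * of_real t)"
        using \<sigma>2 by (simp add: power_mult_distrib exp_double[symmetric] mult_ac)
      then show ?thesis unfolding half_def circ_def using \<psi>(2)[OF in_ball[of "pi * t"]] by simp
    qed
    then show ?thesis using gh unfolding flift_def good_def by simp
  qed
  have tm: "flift (?m \<tau>') \<tau>" and hm: "flift (?m half) (circ \<phi> s)" by (rule flift_mirror[OF t(1)], rule flift_mirror[OF fh])
  \<comment> \<open>The lift of the model lasso from \<open>\<delta> 0\<close>, followed below by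
    its mirror image \<open>\<delta>m\<close>.\<close>
  define \<delta>e where "\<delta>e = \<tau>' +++ (half +++ reversepath (?m \<tau>'))"
  define \<delta>m where "\<delta>m = ?m \<tau>' +++ (?m half +++ reversepath \<tau>')"
  have fe: "flift \<delta>e (\<tau> +++ (circ \<phi> s +++ reversepath \<tau>))"
    unfolding \<delta>e_def by (intro flift_join flift_rev fh t(1) tm) (simp_all add: half_ends)
  have fm: "flift \<delta>m (\<tau> +++ (circ \<phi> s +++ reversepath \<tau>))"
    unfolding \<delta>m_def by (intro flift_join flift_rev hm t(1) tm) (simp_all add: half_ends)
  have se: "same \<delta> \<delta>e" by (rule same_lift[OF *(7) d fe]) (simp add: \<delta>e_def t(2))
  have sm: "same (?m \<delta>) \<delta>m" by (rule same_lift[OF *(7) flift_mirror[OF d] fm]) (simp add: \<delta>m_def t(2))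
  show end1: "\<delta> 1 = 2 * c - \<delta> 0" using se unfolding same_def \<delta>e_def by (simp add: t(2))
  have gt: "good \<tau>'" "good (?m \<tau>')" "good (?m half)" using flift_good[OF t(1) *(4)] flift_good[OF tm *(4)]
      flift_good[OF hm good_circ[OF *(1-3)]] by auto
  have full: "half +++ ?m half = circ \<psi> \<sigma>"
  proof
    fix u :: real
    show "(half +++ ?m half) u = circ \<psi> \<sigma> u"
    proof (cases "u \<le> 1/2")
      case True
      then show ?thesis by (simp add: joinpaths_def half_def circ_def mult_ac)
    next
      case False
      have "exp (\<i> * of_real (pi * (2 * u - 1))) = - exp (\<i> * of_real (2 * pi * u))"
      proof -
        have "\<i> * of_real (pi * (2 * u - 1)) = \<i> * of_real (2 * pi * u) - \<i> * of_real pi" by (simp add: algebra_simps)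
        then show ?thesis by (simp add: exp_diff exp_pi_i')
      qed
      then have "?m half (2 * u - 1) = 2 * c - \<psi> (- (\<sigma> * exp (\<i> * of_real (2 * pi * u))))" unfolding half_def by simp
      also have "\<dots> = \<psi> (\<sigma> * exp (\<i> * of_real (2 * pi * u)))" using \<psi>(4)[OF in_ball[of "2 * pi * u"]] by simp
      finally show ?thesis using False by (simp add: joinpaths_def circ_eq)
    qed
  qed
  have gr: "good (reversepath \<tau>')" "good (reversepath (?m \<tau>'))" by (rule good_rev[OF gt(1)], rule good_rev[OF gt(2)])
  have "same (\<delta> +++ ?m \<delta>) (\<tau>' +++ (circ \<psi> \<sigma> +++ reversepath \<tau>'))"
  proof -
    have 1: "same (\<delta> +++ ?m \<delta>) (\<delta>e +++ \<delta>m)" by (rule same_join[OF se sm]) (simp add: end1)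
    have gc: "good (circ \<psi> \<sigma>)" by (rule good_circ[OF \<psi>(1) \<sigma>])
    have gde: "good \<delta>e" "good \<delta>m"
      by (rule flift_good[OF fe good_lasso(2)[OF *(1-4,6)]], rule flift_good[OF fm good_lasso(2)[OF *(1-4,6)]])
    have "act n (\<delta>e +++ \<delta>m) y = act n (\<tau>' +++ (circ \<psi> \<sigma> +++ reversepath \<tau>')) y" if y: "(f ^^ n) y = \<tau>' 0" for n y
    proof -
      define y1 where "y1 = act n \<tau>' y"
      define y2 where "y2 = act n half y1"
      define y3 where "y3 = act n (?m half) y2"
      have f1: "(f ^^ n) y1 = half 0" unfolding y1_def using act_fibre[OF gt(1) y] half_ends by simp
      have f2: "(f ^^ n) y2 = 2 * c - \<tau>' 1" unfolding y2_def using act_fibre[OF gh f1] half_ends by simp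
      have f3: "(f ^^ n) y3 = \<tau>' 1" unfolding y3_def using act_fibre[OF gt(3), of n y2] f2 half_ends by simp
      have e1: "\<tau>' 1 = half 0" "half 1 = reversepath (?m \<tau>') 0" "\<tau>' 1 = (half +++ reversepath (?m \<tau>')) 0"
        using half_ends by simp_all
      have "act n \<delta>e y = act n (half +++ reversepath (?m \<tau>')) y1"
        unfolding \<delta>e_def y1_def by (rule act_join[OF gt(1) good_join[OF gh gr(2) e1(2)] e1(3) y])
      then have A: "act n \<delta>e y = act n (reversepath (?m \<tau>')) y2"
        unfolding y2_def by (simp only: act_join[OF gh gr(2) e1(2) f1])
      define y4 where "y4 = act n (reversepath (?m \<tau>')) y2"
      have f2': "(f ^^ n) y2 = reversepath (?m \<tau>') 0" "(f ^^ n) y2 = (?m half) 0" "(f ^^ n) y2 = (?m \<tau>') 1" using f2 half_ends by simp_all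
      have fA: "(f ^^ n) y4 = (?m \<tau>') 0" unfolding y4_def act_fibre[OF gr(2) f2'(1)] by simp
      \<comment> \<open>The mirrored tail with which \<open>\<delta>e\<close> returns is the one
        with which \<open>\<delta>m\<close> sets out; here the two cancel.\<close>
      have m4: "act n (?m \<tau>') y4 = y2" unfolding y4_def by (rule act_rev'[OF gt(2) f2'(3)])
      have e2: "(?m half) 1 = reversepath \<tau>' 0" "(?m \<tau>') 1 = (?m half +++ reversepath \<tau>') 0" using half_ends by simp_all
      have "act n \<delta>m y4 = act n (?m half +++ reversepath \<tau>') (act n (?m \<tau>') y4)"
        unfolding \<delta>m_def by (rule act_join[OF gt(2) good_join[OF gt(3) gr(1) e2(1)] e2(2) fA])
      then have B: "act n \<delta>m y4 = act n (reversepath \<tau>') y3"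
        unfolding m4 y3_def by (simp only: act_join[OF gt(3) gr(1) e2(1) f2'(2)])
      have e3: "half 1 = (?m half) 0" "circ \<psi> \<sigma> 1 = reversepath \<tau>' 0" "\<tau>' 1 = (circ \<psi> \<sigma> +++ reversepath \<tau>') 0"
        "(f ^^ n) y1 = circ \<psi> \<sigma> 0" "\<delta>e 1 = \<delta>m 0" "(f ^^ n) y = \<delta>e 0"
        using half_ends \<psi>(3) f1 y by (simp_all add: \<delta>e_def \<delta>m_def)
      have C: "act n (circ \<psi> \<sigma>) y1 = y3"
        unfolding full[symmetric] y3_def y2_def by (rule act_join[OF gh gt(3) e3(1) f1])
      have "act n (\<delta>e +++ \<delta>m) y = act n (reversepath \<tau>') y3"
        unfolding act_join[OF gde e3(5,6)] A B[unfolded y4_def] ..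
      moreover have "act n (\<tau>' +++ (circ \<psi> \<sigma> +++ reversepath \<tau>')) y = act n (reversepath \<tau>') y3"
        unfolding act_join[OF gt(1) good_lasso(1)[OF \<psi>(1) \<sigma> gt(1) \<psi>(3)[symmetric]] e3(3) y] y1_def[symmetric]
          act_join[OF gc gr(1) e3(2,4)] C ..
      ultimately show ?thesis by simp
    qed
    then have 2: "same (\<delta>e +++ \<delta>m) (\<tau>' +++ (circ \<psi> \<sigma> +++ reversepath \<tau>'))"
      unfolding same_def using good_join[OF gde]
        good_lasso(2)[OF \<psi>(1) \<sigma> gt(1)] \<psi>(3) by (simp add: \<delta>e_def \<delta>m_def)
    show ?thesis by (rule same_trans[OF 1 2])
  qed
  from lassoI[OF \<psi>(1) \<sigma> gt(1) _ this] \<psi>(3) t(2) show "lasso (\<delta> 0) c (\<delta> +++ ?m \<delta>)" by simp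
qed

text \<open>A point outside \<open>P\<close> is not the critical value, and its preimages are
  outside \<open>P\<close> as well, since \<open>P\<close> is forward invariant. So all successive
  lifts are lassos around such points and therefore closed.\<close>

lemma lasso_trivial: "lasso x q \<gamma> \<Longrightarrow> q \<notin> P \<Longrightarrow> (f ^^ n) y = x \<Longrightarrow> act n \<gamma> y = y"
proof (induction n arbitrary: x q \<gamma>)
  case 0
  then show ?case using act_0[of \<gamma>] lasso_ends[OF 0(1)] by simp
next
  case (Suc n)
  have e: "\<gamma> 0 = x" "good \<gamma>" using lasso_ends[OF Suc.prems(1)] by auto
  have "q \<noteq> v" using Suc.prems(2) v_in_P by auto
  have "f ((f ^^ n) y) = \<gamma> 0" using Suc.prems(3) e by simp
  from flift_ex[OF e(2) this] obtain \<delta> where d: "flift \<delta> \<gamma>" "\<delta> 0 = (f ^^ n) y" by blast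
  obtain q' where q': "f q' = q" "lasso (\<delta> 0) q' \<delta>" using lasso_lift_noncritical[OF Suc.prems(1) \<open>q \<noteq> v\<close> d(1)] by blast
  have "q' \<notin> P" using q'(1) f_in_P Suc.prems(2) by blast
  from Suc.IH[OF q'(2) this] d(2) show ?case using act_Suc[OF e(2) d] by simp
qed

lemma lasso_exists:
  assumes "finite P" "x \<notin> P" "q \<in> P"
  shows "\<exists>\<gamma>. lasso x q \<gamma>"
proof -
  have "open (- (P - {q}))" by (rule open_Compl[OF finite_imp_closed]) (use assms(1) in simp)
  moreover have "q \<in> - (P - {q})" by simp
  ultimately obtain e where e: "e > 0" "ball q e \<subseteq> - (P - {q})" using openE by blast
  define \<phi> where "\<phi> s = q + s * of_real e" for s :: complex
  have \<phi>: "cusp q \<phi>"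
    unfolding cusp_def
  proof (intro conjI exI[of _ "\<lambda>_. of_real e"] ballI impI)
    fix s :: complex assume s: "s \<in> ball 0 1"
    show "\<phi> s = q + s * of_real e" by (simp add: \<phi>_def)
    show "complex_of_real e \<noteq> 0" using e(1) by simp
    assume "s \<noteq> 0"
    have "norm (s * of_real e) < e" using s e(1) by (simp add: norm_mult)
    then have "\<phi> s \<in> ball q e" by (simp add: \<phi>_def dist_norm)
    moreover have "\<phi> s \<noteq> q" using \<open>s \<noteq> 0\<close> e(1) by (simp add: \<phi>_def)
    ultimately show "\<phi> s \<notin> P" using e(2) by blast
  qed simp
  let ?s = "1 / 2 :: complex"
  have s: "?s \<in> ball 0 1" "?s \<noteq> 0" by (simp_all add: norm_divide)
  have "\<phi> ?s \<notin> P" using \<phi> s unfolding cusp_def by blast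
  moreover have "path_connected (- P)" using path_connected_complement_countable[OF _ countable_finite[OF assms(1)]] by simp
  ultimately obtain \<tau> where t: "path \<tau>" "path_image \<tau> \<subseteq> - P" "pathstart \<tau> = x" "pathfinish \<tau> = \<phi> ?s"
    using assms(2) unfolding path_connected_def by (metis ComplI)
  then have "good \<tau>" "\<tau> 0 = x" "\<tau> 1 = \<phi> ?s" unfolding good_def pathstart_def pathfinish_def by auto
  then show ?thesis using lassoI[OF \<phi> s _ _ same_refl[OF good_lasso(2)[OF \<phi> s]]] by metis
qed

end

section \<open>The wreath recursion of the iterated monodromy group\<close>

locale pcf_quad = quad +
  fixes N r :: nat
  assumes r1: "1 \<le> r" and rN: "r \<le> N"
    and inj_pc: "inj_on (\<lambda>i. (poly p ^^ (i - 1)) v) {1..N}"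
    and P_pc: "postcrit p = (\<lambda>i. (poly p ^^ (i - 1)) v) ` {1..N}"
    and pc_rN: "poly p ((poly p ^^ (N - 1)) v) = (poly p ^^ (r - 1)) v"
begin

definition pc :: "nat \<Rightarrow> complex" where "pc i = (f ^^ (i - 1)) v"

lemma pc_1: "pc 1 = v" "pc (Suc 0) = v"
  by (simp_all add: pc_def)

lemma pc_Suc: "1 \<le> i \<Longrightarrow> pc (Suc i) = f (pc i)"
  by (cases i) (simp_all add: pc_def)

lemma pc_step: "j \<in> {2..N} \<Longrightarrow> f (pc (j - 1)) = pc j"
  using pc_Suc[of "j - 1"] by (cases j) auto

lemma pc_N: "f (pc N) = pc r"
  using pc_rN by (simp add: pc_def)

lemma P_pc': "P = pc ` {1..N}"
  using P_pc by (simp add: pc_def[abs_def])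

lemma pc_inj: "i \<in> {1..N} \<Longrightarrow> j \<in> {1..N} \<Longrightarrow> pc i = pc j \<Longrightarrow> i = j"
  using inj_pc unfolding inj_on_def pc_def by blast

lemma pc_neq_v: "j \<in> {2..N} \<Longrightarrow> pc j \<noteq> v"
  using pc_inj[of j 1] pc_1 by fastforce

lemma pc_in_P: "i \<in> {1..N} \<Longrightarrow> pc i \<in> P"
  unfolding P_pc' by blast

lemma pc_last: "r = 1 \<Longrightarrow> pc N = c"
  using pc_N pc_1 f_eq_v by simp

lemma c_notin_P: "r \<noteq> 1 \<Longrightarrow> c \<notin> P"
proof
  assume r: "r \<noteq> 1" and "c \<in> P"
  then obtain m where m: "m \<in> {1..N}" "c = pc m" unfolding P_pc' by blast
  show False
  proof (cases "m = N")
    case True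
    then have "pc r = pc 1" using m pc_N f_c pc_1 by simp
    then show False using pc_inj[of r 1] r r1 rN by simp
  next
    case False
    then have "pc (Suc m) = pc 1" using m pc_Suc[of m] f_c pc_1 by simp
    then show False using pc_inj[of "Suc m" 1] m False by simp
  qed
qed

text \<open>The image of the sibling is \<open>pc j\<close>. If the sibling were \<open>pc m\<close>
  with \<open>m < N\<close>, injectivity would give \<open>m = j - 1\<close>, making it its own
  sibling and equal to \<open>c\<close>, which is excluded by \<open>pc j \<noteq> v\<close>. Only
  \<open>m = N\<close> remains, and this means \<open>j = r\<close>.\<close>

lemma pc_sibling:
  assumes j: "j \<in> {2..N}"
  shows "if j = r then 2 * c - pc (j - 1) = pc N else 2 * c - pc (j - 1) \<notin> P"
proof (cases "j = r")
  case True
  have "f (pc N) = f (pc (j - 1))" using pc_N True pc_step[OF j] by simp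
  then have "pc N = pc (j - 1) \<or> pc N = 2 * c - pc (j - 1)" unfolding f_eq .
  moreover have "pc N \<noteq> pc (j - 1)" using pc_inj[of N "j - 1"] j by fastforce
  ultimately show ?thesis using True by simp
next
  case False
  have "2 * c - pc (j - 1) \<notin> P"
  proof
    assume "2 * c - pc (j - 1) \<in> P"
    then obtain m where m: "m \<in> {1..N}" "2 * c - pc (j - 1) = pc m" unfolding P_pc' by blast
    have fm: "f (pc m) = pc j" using m(2)[symmetric] pc_step[OF j] by simp
    show False
    proof (cases "m = N")
      case True
      then have "pc r = pc j" using fm pc_N by simp
      then show False using pc_inj[of r j] False j r1 rN by simp
    next
      case F: False
      then have "pc (Suc m) = pc j" using m(1) pc_Suc[of m] fm by simp
      then have "Suc m = j" using pc_inj[of "Suc m" j] m(1) F j by simp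
      then have "pc m = c" using m(2) by force
      then have "pc j = v" using fm f_c by simp
      then show False using pc_neq_v[OF j] by simp
    qed
  qed
  then show ?thesis using False by simp
qed

text \<open>Transport to the second half of the tree: \<open>\<eta>\<close> runs from one preimage
  of the base point to the other and identifies the fibres over them.\<close>

definition ch :: "nat \<Rightarrow> (real \<Rightarrow> complex) \<Rightarrow> bool \<Rightarrow> complex \<Rightarrow> complex" where
  "ch n \<eta> b y = (if b then act n \<eta> y else y)"

definition lassos :: "complex \<Rightarrow> (nat \<Rightarrow> real \<Rightarrow> complex) \<Rightarrow> bool" where
  "lassos x \<Gamma> \<longleftrightarrow> x \<notin> P \<and> (\<forall>i\<in>{1..N}. lasso x (pc i) (\<Gamma> i))"

text \<open>The clauses of \<open>knead\<close> expressed by actions on fibres, so that no labelling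
  of the tree has to be fixed beforehand. \<open>e j\<close> records in which half the predecessor
  of \<open>pc j\<close> is encircled.\<close>

definition recursion :: "complex \<Rightarrow> (nat \<Rightarrow> real \<Rightarrow> complex) \<Rightarrow> complex \<Rightarrow> (real \<Rightarrow> complex) \<Rightarrow> (nat \<Rightarrow> bool) \<Rightarrow>
    (nat \<Rightarrow> real \<Rightarrow> complex) \<Rightarrow> bool" where
  "recursion x \<Gamma> x' \<eta> e \<Gamma>' \<longleftrightarrow> f x' = x \<and> good \<eta> \<and> \<eta> 0 = x' \<and> \<eta> 1 = 2 * c - x' \<and>
     (\<forall>n y. (f ^^ n) y = x' \<longrightarrow>
        act (Suc n) (\<Gamma> 1) y = act n \<eta> y \<and>
        act (Suc n) (\<Gamma> 1) (act n \<eta> y) = (if r = 1 then act n (\<Gamma>' N) y else y) \<and>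
        (\<forall>j\<in>{2..N}. \<forall>b. act (Suc n) (\<Gamma> j) (ch n \<eta> b y) =
           ch n \<eta> b (if b = e j then act n (\<Gamma>' (j - 1)) y else if j = r then act n (\<Gamma>' N) y else y)))"

lemma recursion_noncritical:
  assumes l: "lasso x (pc j) \<gamma>" and j: "j \<in> {2..N}" and x': "f x' = x"
    and \<eta>: "good \<eta>" "\<eta> 0 = x'" "\<eta> 1 = 2 * c - x'"
  shows "\<exists>e A B. lasso x' (pc (j - 1)) A \<and> lasso x' (2 * c - pc (j - 1)) B \<and>
    (\<forall>n y b. (f ^^ n) y = x' \<longrightarrow> act (Suc n) \<gamma> (ch n \<eta> b y) = ch n \<eta> b (if b = e then act n A y else act n B y))"
proof -
  have g: "good \<gamma>" "\<gamma> 0 = x" "\<gamma> 1 = x" using lasso_ends[OF l] by auto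
  obtain \<delta> where d: "flift \<delta> \<gamma>" "\<delta> 0 = x'" using flift_ex[OF g(1), of x'] x' g by auto
  obtain q' where q': "f q' = pc j" "lasso x' q' \<delta>" "lasso (2 * c - x') (2 * c - q') (\<lambda>t. 2 * c - \<delta> t)"
    using lasso_lift_noncritical[OF l pc_neq_v[OF j] d(1)] d(2) by blast
  let ?m = "\<lambda>t. 2 * c - \<delta> t"
  \<comment> \<open>The second lift is based at the mirror image of \<open>x'\<close>; conjugation
    by \<open>\<eta>\<close> makes it a lasso based at \<open>x'\<close>.\<close>
  define D where "D = \<eta> +++ (?m +++ reversepath \<eta>)"
  have lD: "lasso x' (2 * c - q') D"
    unfolding D_def using lasso_conj[OF \<eta>(1,3) q'(3)] \<eta>(2) by simp
  note dm = flift_mirror[OF d(1)]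
  have ed: "\<delta> 0 = x'" "\<delta> 1 = x'" "good \<delta>" using lasso_ends[OF q'(2)] by auto
  have gm: "good ?m" using lasso_ends[OF q'(3)] by blast
  have a0: "act (Suc n) \<gamma> y = act n \<delta> y" if y: "(f ^^ n) y = x'" for n y
    by (rule act_Suc[OF g(1) d(1)]) (simp add: d y)
  have a1: "act (Suc n) \<gamma> (act n \<eta> y) = act n \<eta> (act n D y)" if y: "(f ^^ n) y = x'" for n y
  proof -
    have y1: "(f ^^ n) (act n \<eta> y) = 2 * c - x'" using act_fibre[OF \<eta>(1), of n y] y \<eta> by simp
    have A: "act (Suc n) \<gamma> (act n \<eta> y) = act n ?m (act n \<eta> y)"
      by (rule act_Suc[OF g(1) dm]) (simp add: d y1)
    have y0: "(f ^^ n) y = \<eta> 0" "(f ^^ n) (act n \<eta> y) = ?m 0" using y y1 \<eta> ed by simp_all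
    have gr: "good (reversepath \<eta>)" by (rule good_rev[OF \<eta>(1)])
    have e1: "?m 1 = reversepath \<eta> 0" "\<eta> 1 = (?m +++ reversepath \<eta>) 0" using \<eta> ed by simp_all
    have "act n D y = act n (?m +++ reversepath \<eta>) (act n \<eta> y)"
      unfolding D_def by (rule act_join[OF \<eta>(1) good_join[OF gm gr e1(1)] e1(2) y0(1)])
    also have "\<dots> = act n (reversepath \<eta>) (act n ?m (act n \<eta> y))"
      by (rule act_join[OF gm gr e1(1) y0(2)])
    finally have B: "act n D y = act n (reversepath \<eta>) (act n ?m (act n \<eta> y))" .
    have "(f ^^ n) (act n ?m (act n \<eta> y)) = \<eta> 1" using act_fibre[OF gm y0(2)] \<eta> ed by simp
    from act_rev'[OF \<eta>(1) this] show ?thesis unfolding A B by simp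
  qed
  \<comment> \<open>Which preimage of \<open>pc j\<close> the lift at \<open>x'\<close> encircles
    depends on the chosen lasso; the bit \<open>e\<close> stores the answer.\<close>
  have "q' = pc (j - 1) \<or> q' = 2 * c - pc (j - 1)" using q'(1) pc_step[OF j] f_eq by metis
  then show ?thesis
  proof
    assume "q' = pc (j - 1)"
    then show ?thesis using q'(2) lD a0 a1 by (intro exI[of _ False] exI[of _ \<delta>] exI[of _ D]) (simp add: ch_def)
  next
    assume "q' = 2 * c - pc (j - 1)"
    then show ?thesis using q'(2) lD a0 a1 by (intro exI[of _ True] exI[of _ D] exI[of _ \<delta>]) (simp add: ch_def)
  qed
qed

lemma f_surj: "\<exists>y. f y = x"
proof
  show "f (c + csqrt ((x - v) / a)) = x" by (simp add: poly_p a0)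
qed

lemma recursion_exists:
  assumes \<Gamma>: "lassos x \<Gamma>"
  shows "\<exists>x' \<eta> e \<Gamma>'. recursion x \<Gamma> x' \<eta> e \<Gamma>' \<and> lassos x' \<Gamma>'"
proof -
  obtain x' where x': "f x' = x" using f_surj by blast
  have xP: "x' \<notin> P" using x' f_in_P \<Gamma> unfolding lassos_def by blast
  have l1: "lasso x v (\<Gamma> 1)" using \<Gamma> r1 rN pc_1 unfolding lassos_def by force
  have g1: "good (\<Gamma> 1)" "\<Gamma> 1 0 = x" using lasso_ends[OF l1] by auto
  obtain \<eta> where \<eta>: "flift \<eta> (\<Gamma> 1)" "\<eta> 0 = x'" using flift_ex[OF g1(1), of x'] x' g1 by auto
  have \<eta>1: "\<eta> 1 = 2 * c - x'" using lasso_lift_critical(1)[OF l1 \<eta>(1)] \<eta>(2) by simp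
  have g\<eta>: "good \<eta>" by (rule flift_good[OF \<eta>(1) g1(1)])
  let ?m = "\<lambda>t. 2 * c - \<eta> t"
  have lc: "lasso x' c (\<eta> +++ ?m)" using lasso_lift_critical(2)[OF l1 \<eta>(1)] \<eta>(2) by simp
  have gm: "good ?m" by (rule flift_good[OF flift_mirror[OF \<eta>(1)] g1(1)])
  have "\<forall>j\<in>{2..N}. \<exists>e A B. lasso x' (pc (j - 1)) A \<and> lasso x' (2 * c - pc (j - 1)) B \<and>
    (\<forall>n y b. (f ^^ n) y = x' \<longrightarrow> act (Suc n) (\<Gamma> j) (ch n \<eta> b y) = ch n \<eta> b (if b = e then act n A y else act n B y))"
    using recursion_noncritical[OF _ _ x' g\<eta> \<eta>(2) \<eta>1] \<Gamma> unfolding lassos_def by auto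
  then obtain e A B where AB: "\<And>j. j \<in> {2..N} \<Longrightarrow> lasso x' (pc (j - 1)) (A j)" "\<And>j. j \<in> {2..N} \<Longrightarrow> lasso x' (2 * c - pc (j - 1)) (B j)"
    "\<And>j n y b. j \<in> {2..N} \<Longrightarrow> (f ^^ n) y = x' \<Longrightarrow>
        act (Suc n) (\<Gamma> j) (ch n \<eta> b y) = ch n \<eta> b (if b = e j then act n (A j) y else act n (B j) y)"
    by metis
  \<comment> \<open>For \<open>i < N\<close> the new lasso comes from the successor. For
    \<open>N\<close> it is the completed circle around \<open>c\<close> in the periodic case, and
    otherwise the sibling lift at index \<open>r\<close>.\<close>
  define \<Gamma>' where "\<Gamma>' i = (if i < N then A (Suc i) else if r = 1 then \<eta> +++ ?m else B r)" for i
  have "lassos x' \<Gamma>'"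
    unfolding lassos_def
  proof (intro conjI ballI xP)
    fix i assume i: "i \<in> {1..N}"
    consider "i < N" | "i = N" "r = 1" | "i = N" "r \<noteq> 1" using i by fastforce
    then show "lasso x' (pc i) (\<Gamma>' i)"
    proof cases
      case 1
      then show ?thesis using AB(1)[of "Suc i"] i by (simp add: \<Gamma>'_def)
    next
      case 2
      then show ?thesis using lc pc_last by (simp add: \<Gamma>'_def)
    next
      case 3
      then have "r \<in> {2..N}" using r1 rN by auto
      then show ?thesis using 3 AB(2)[of r] pc_sibling[of r] by (simp add: \<Gamma>'_def)
    qed
  qed
  moreover have "recursion x \<Gamma> x' \<eta> e \<Gamma>'"
    unfolding recursion_def
  proof (intro conjI allI impI ballI x' g\<eta> \<eta>(2) \<eta>1)
    fix n y assume y: "(f ^^ n) y = x'"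
    show "act (Suc n) (\<Gamma> 1) y = act n \<eta> y" by (rule act_Suc[OF g1(1) \<eta>(1)]) (simp add: \<eta> y)
    have y0: "(f ^^ n) y = \<eta> 0" using y \<eta> by simp
    have y1: "(f ^^ n) (act n \<eta> y) = 2 * c - x'" using act_fibre[OF g\<eta> y0] \<eta>1 by simp
    have "act (Suc n) (\<Gamma> 1) (act n \<eta> y) = act n ?m (act n \<eta> y)"
      by (rule act_Suc[OF g1(1) flift_mirror[OF \<eta>(1)]]) (simp add: \<eta> y1)
    also have "\<dots> = act n (\<eta> +++ ?m) y"
      by (rule act_join[OF g\<eta> gm _ y0, symmetric]) (simp add: \<eta> \<eta>1)
    also have "\<dots> = (if r = 1 then act n (\<Gamma>' N) y else y)"
      using lasso_trivial[OF lc c_notin_P y] by (simp add: \<Gamma>'_def)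
    finally show "act (Suc n) (\<Gamma> 1) (act n \<eta> y) = (if r = 1 then act n (\<Gamma>' N) y else y)" .
    fix j b assume j: "j \<in> {2..N}"
    have "act n (B j) y = (if j = r then act n (\<Gamma>' N) y else y)"
      using lasso_trivial[OF AB(2)[OF j] _ y] pc_sibling[OF j] j by (auto simp: \<Gamma>'_def)
    moreover have "\<Gamma>' (j - 1) = A j" using j by (cases j) (simp_all add: \<Gamma>'_def)
    ultimately show "act (Suc n) (\<Gamma> j) (ch n \<eta> b y) =
           ch n \<eta> b (if b = e j then act n (\<Gamma>' (j - 1)) y else if j = r then act n (\<Gamma>' N) y else y)"
      using AB(3)[OF j y, of b] by simp
  qed
  ultimately show ?thesis by blast
qed

text \<open>The lassos of each level depend on the choices made at the previous one, so the whole
  sequence is obtained by dependent choice.\<close>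

lemma tower_exists:
  assumes z: "z \<notin> P"
  shows "\<exists>x \<Gamma> \<eta> e. x 0 = z \<and> (\<forall>k. lassos (x k) (\<Gamma> k) \<and> recursion (x k) (\<Gamma> k) (x (Suc k)) (\<eta> k) (e k) (\<Gamma> (Suc k)))"
proof -
  have fin: "finite P" unfolding P_pc' by simp
  have "\<forall>i\<in>{1..N}. \<exists>\<gamma>. lasso z (pc i) \<gamma>" using lasso_exists[OF fin z pc_in_P] by blast
  then obtain \<Gamma>0 where \<Gamma>0: "lassos z \<Gamma>0" unfolding lassos_def using z by metis
  have "\<exists>X. \<forall>k. (lassos (fst (X k)) (snd (X k)) \<and> (k = 0 \<longrightarrow> X k = (z, \<Gamma>0))) \<and>
     (\<exists>\<eta> e. recursion (fst (X k)) (snd (X k)) (fst (X (Suc k))) \<eta> e (snd (X (Suc k))))"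
  proof (rule dependent_nat_choice[of "\<lambda>k X. lassos (fst X) (snd X) \<and> (k = 0 \<longrightarrow> X = (z, \<Gamma>0))"
      "\<lambda>k X Y. \<exists>\<eta> e. recursion (fst X) (snd X) (fst Y) \<eta> e (snd Y)"])
    show "\<exists>X. lassos (fst X) (snd X) \<and> (0 = (0::nat) \<longrightarrow> X = (z, \<Gamma>0))" using \<Gamma>0 by auto
    fix X and k :: nat assume "lassos (fst X) (snd X) \<and> (k = 0 \<longrightarrow> X = (z, \<Gamma>0))"
    then obtain x' \<eta> e \<Gamma>' where "recursion (fst X) (snd X) x' \<eta> e \<Gamma>'" "lassos x' \<Gamma>'"
      using recursion_exists by blast
    then show "\<exists>Y. (lassos (fst Y) (snd Y) \<and> (Suc k = 0 \<longrightarrow> Y = (z, \<Gamma>0))) \<and>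
        (\<exists>\<eta> e. recursion (fst X) (snd X) (fst Y) \<eta> e (snd Y))"
      by (intro exI[of _ "(x', \<Gamma>')"]) auto
  qed
  then obtain X where X: "\<And>k. lassos (fst (X k)) (snd (X k))" "X 0 = (z, \<Gamma>0)"
     "\<forall>k. \<exists>\<eta> e. recursion (fst (X k)) (snd (X k)) (fst (X (Suc k))) \<eta> e (snd (X (Suc k)))" by blast
  from X(3) obtain \<eta> e where "\<And>k. recursion (fst (X k)) (snd (X k)) (fst (X (Suc k))) (\<eta> k) (e k) (snd (X (Suc k)))"
    by metis
  then show ?thesis
    using X(1,2) by (intro exI[of _ "\<lambda>k. fst (X k)"] exI[of _ "\<lambda>k. snd (X k)"] exI[of _ \<eta>] exI[of _ e]) simp
qed

end

section \<open>Labelling the tree of preimages by binary words\<close>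

locale tower = pcf_quad +
  fixes x :: "nat \<Rightarrow> complex" and \<Gamma> :: "nat \<Rightarrow> nat \<Rightarrow> real \<Rightarrow> complex"
    and \<eta> :: "nat \<Rightarrow> real \<Rightarrow> complex" and e :: "nat \<Rightarrow> nat \<Rightarrow> bool"
  assumes lassos: "lassos (x k) (\<Gamma> k)"
    and recursion: "recursion (x k) (\<Gamma> k) (x (Suc k)) (\<eta> k) (e k) (\<Gamma> (Suc k))"
begin

sublocale kneading N r e
  by unfold_locales (rule r1, rule rN)

lemma x_Suc: "f (x (Suc k)) = x k" and good_\<eta>: "good (\<eta> k)" and \<eta>_0: "\<eta> k 0 = x (Suc k)"
  and \<eta>_1: "\<eta> k 1 = 2 * c - x (Suc k)"
  using recursion[of k] unfolding recursion_def by blast+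

lemma \<Gamma>_1_False: "(f ^^ n) y = x (Suc k) \<Longrightarrow> act (Suc n) (\<Gamma> k 1) y = act n (\<eta> k) y"
  and \<Gamma>_1_True: "(f ^^ n) y = x (Suc k) \<Longrightarrow> act (Suc n) (\<Gamma> k 1) (act n (\<eta> k) y) = (if r = 1 then act n (\<Gamma> (Suc k) N) y else y)"
  and \<Gamma>_other: "(f ^^ n) y = x (Suc k) \<Longrightarrow> j \<in> {2..N} \<Longrightarrow> act (Suc n) (\<Gamma> k j) (ch n (\<eta> k) b y) =
     ch n (\<eta> k) b (if b = e k j then act n (\<Gamma> (Suc k) (j - 1)) y else if j = r then act n (\<Gamma> (Suc k) N) y else y)"
  using recursion[of k] unfolding recursion_def by blast+

text \<open>The first letter selects a preimage of the base point, the remaining ones address a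
  vertex over \<open>x (Suc k)\<close>, and vertices over the second preimage are named by transport
  along \<open>\<eta> k\<close>.\<close>

primrec lab :: "bool list \<Rightarrow> nat \<Rightarrow> complex" where
  "lab [] k = x k"
| "lab (b # w) k = ch (length w) (\<eta> k) b (lab w (Suc k))"

lemma lab_fibre_ch:
  assumes "(f ^^ n) y = x (Suc k)"
  shows "(f ^^ n) (ch n (\<eta> k) b y) = (if b then 2 * c - x (Suc k) else x (Suc k))"
  using assms act_fibre[OF good_\<eta>, of n y k] by (simp add: ch_def \<eta>_0 \<eta>_1)

lemma lab_fibre: "(f ^^ length w) (lab w k) = x k"
proof (induction w arbitrary: k)
  case (Cons b w)
  show ?case using lab_fibre_ch[OF Cons.IH[of "Suc k"], of b] x_Suc by simp
qed simp

lemma x_neq_c: "x (Suc k) \<noteq> 2 * c - x (Suc k)"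
proof
  assume "x (Suc k) = 2 * c - x (Suc k)"
  then have "x (Suc k) = c" by force
  then have "x k = v" using x_Suc[of k] f_c by simp
  then show False using lassos[of k] v_in_P unfolding lassos_def by simp
qed

text \<open>Iterating \<open>f\<close> down to the first level tells the halves apart, because
  \<open>x (Suc k)\<close> differs from its mirror image; within the second half the transport is
  undone along the reversed path.\<close>

lemma lab_inject: "length w = length w' \<Longrightarrow> lab w k = lab w' k \<Longrightarrow> w = w'"
proof (induction w arbitrary: w' k)
  case (Cons b w)
  obtain b' u where w': "w' = b' # u" "length w = length u" using Cons.prems(1) by (cases w') auto
  let ?n = "length u"
  have f: "(f ^^ ?n) (lab w (Suc k)) = x (Suc k)" "(f ^^ ?n) (lab u (Suc k)) = x (Suc k)"
    using lab_fibre[of w "Suc k"] lab_fibre[of u "Suc k"] w'(2) by simp_all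
  have eq: "ch ?n (\<eta> k) b (lab w (Suc k)) = ch ?n (\<eta> k) b' (lab u (Suc k))" using Cons.prems(2) w' by simp
  then have b: "b = b'" using lab_fibre_ch[OF f(1), of b] lab_fibre_ch[OF f(2), of b'] x_neq_c[of k]
    by (metis (full_types))
  have "lab w (Suc k) = lab u (Suc k)"
    using eq b act_rev[OF good_\<eta>, of ?n _ k] f by (metis \<eta>_0 ch_def)
  then show ?case using Cons.IH[OF w'(2)] b w' by simp
qed simp

lemma lab_surj: "(f ^^ n) y = x k \<Longrightarrow> \<exists>w. length w = n \<and> lab w k = y"
proof (induction n arbitrary: y k)
  case (Suc n)
  have "f ((f ^^ n) y) = f (x (Suc k))" using Suc.prems x_Suc by simp
  then consider "(f ^^ n) y = x (Suc k)" | "(f ^^ n) y = 2 * c - x (Suc k)" unfolding f_eq by blast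
  then show ?case
  proof cases
    case 1
    then obtain w where "length w = n" "lab w (Suc k) = y" using Suc.IH by blast
    then show ?thesis by (intro exI[of _ "False # w"]) (simp add: ch_def)
  next
    case 2
    then have y1: "(f ^^ n) y = \<eta> k 1" by (simp add: \<eta>_1)
    let ?y = "act n (reversepath (\<eta> k)) y"
    have "(f ^^ n) ?y = x (Suc k)" using act_fibre[OF good_rev[OF good_\<eta>], of n y k] y1 by (simp add: \<eta>_0)
    then obtain w where "length w = n" "lab w (Suc k) = ?y" using Suc.IH by blast
    then show ?thesis using act_rev'[OF good_\<eta> y1] by (intro exI[of _ "True # w"]) (simp add: ch_def)
  qed
qed simp

lemma act_lab: "i \<in> {1..N} \<Longrightarrow> act (length w) (\<Gamma> k i) (lab w k) = lab (knead N r e k i w) k"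
proof (induction w arbitrary: k i)
  case Nil
  have "lasso (x k) (pc i) (\<Gamma> k i)" using lassos[of k] Nil unfolding lassos_def by blast
  from lasso_ends[OF this] show ?case using act_0[of "\<Gamma> k i"] by simp
next
  case (Cons b w)
  let ?n = "length w" and ?y = "lab w (Suc k)"
  have y: "(f ^^ ?n) ?y = x (Suc k)" by (rule lab_fibre)
  have IN: "act ?n (\<Gamma> (Suc k) N) ?y = lab (knead N r e (Suc k) N w) (Suc k)"
    by (rule Cons.IH) (use r1 rN in simp)
  show ?case
  proof (cases "i = 1")
    case True
    show ?thesis
    proof (cases b)
      case b: True
      show ?thesis using \<Gamma>_1_True[OF y] IN b by (simp add: True ch_def)
    next
      case b: False
      show ?thesis using \<Gamma>_1_False[OF y] b by (simp add: True ch_def)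
    qed
  next
    case False
    then have j: "i \<in> {2..N}" "i - 1 \<in> {1..N}" using Cons.prems by auto
    show ?thesis using \<Gamma>_other[OF y j(1), of b] Cons.IH[OF j(2), of "Suc k"] IN False by simp
  qed
qed

definition emb :: "taut \<Rightarrow> nat \<times> complex \<Rightarrow> nat \<times> complex" where
  "emb t u = (if u \<in> preimage_tree p (x 0)
     then (fst u, lab (app t (THE w. length w = fst u \<and> lab w 0 = snd u)) 0) else u)"

lemma emb_lab: "emb t (length w, lab w 0) = (length w, lab (app t w) 0)"
proof -
  have "(THE w'. length w' = length w \<and> lab w' 0 = lab w 0) = w"
    using lab_inject by (intro the_equality) auto
  then show ?thesis by (simp add: emb_def preimage_tree_def lab_fibre)
qed

lemma emb_off: "u \<notin> preimage_tree p (x 0) \<Longrightarrow> emb t u = u"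
  by (simp add: emb_def)

lemma tree_cases: "u \<in> preimage_tree p (x 0) \<Longrightarrow> \<exists>w. u = (length w, lab w 0)"
  using lab_surj[of "fst u" "snd u" 0] unfolding preimage_tree_def by (cases u) auto

lemma emb_plus: "emb (s + t) = emb t \<circ> emb s"
proof
  fix u
  show "emb (s + t) u = (emb t \<circ> emb s) u"
  proof (cases "u \<in> preimage_tree p (x 0)")
    case True
    then obtain w where u: "u = (length w, lab w 0)" using tree_cases by blast
    show ?thesis using emb_lab[of t "app s w"] unfolding u by (simp add: emb_lab)
  qed (simp add: emb_off)
qed

lemma emb_zero: "emb 0 = id"
proof
  fix u
  show "emb 0 u = id u"
    by (cases "u \<in> preimage_tree p (x 0)") (auto simp: emb_off emb_lab dest!: tree_cases)
qed

lemma emb_inj: "emb s = emb t \<Longrightarrow> s = t"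
proof (rule taut_eqI)
  fix w assume "emb s = emb t"
  then have "lab (app s w) 0 = lab (app t w) 0" using emb_lab[of s w] emb_lab[of t w] by simp
  then show "app s w = app t w" by (rule lab_inject[rotated]) simp
qed

lemma emb_g: "i \<in> {1..N} \<Longrightarrow> emb (g 0 i) = loop_action p (x 0) (\<Gamma> 0 i)"
proof
  fix u assume i: "i \<in> {1..N}"
  show "emb (g 0 i) u = loop_action p (x 0) (\<Gamma> 0 i) u"
  proof (cases "u \<in> preimage_tree p (x 0)")
    case True
    then obtain w where u: "u = (length w, lab w 0)" using tree_cases by blast
    show ?thesis using loop_action_apply(1)[OF lab_fibre[of w 0]] act_lab[OF i] unfolding u by (simp add: emb_lab app_g)
  qed (simp add: emb_off loop_action_def)
qed

lemma x0_P: "x 0 \<notin> P"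
  using lassos[of 0] unfolding lassos_def by blast

lemma emb_in_IMG: "t \<in> G 0 \<Longrightarrow> emb t \<in> carrier (IMG p (x 0))"
proof -
  interpret I: group "IMG p (x 0)" by (rule group_IMG[OF x0_P])
  let ?T = "{t. emb t \<in> carrier (IMG p (x 0))}"
  have "subgp ?T"
    unfolding subgp_def
  proof (intro conjI ballI)
    show "0 \<in> ?T" using I.one_closed by (simp add: emb_zero IMG_simps(3))
    fix s assume s: "s \<in> ?T"
    then have ic: "inv\<^bsub>IMG p (x 0)\<^esub> (emb s) \<in> carrier (IMG p (x 0))" by simp
    have "inv\<^bsub>IMG p (x 0)\<^esub> (emb s) \<otimes>\<^bsub>IMG p (x 0)\<^esub> emb s = \<one>\<^bsub>IMG p (x 0)\<^esub>" using s by simp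
    then have i1: "emb s \<circ> inv\<^bsub>IMG p (x 0)\<^esub> (emb s) = id" unfolding IMG_simps .
    have i2: "emb (- s) \<circ> emb s = id" using emb_plus[of s "- s"] emb_zero by simp
    have "emb (- s) = emb (- s) \<circ> (emb s \<circ> inv\<^bsub>IMG p (x 0)\<^esub> (emb s))" unfolding i1 by simp
    also have "\<dots> = inv\<^bsub>IMG p (x 0)\<^esub> (emb s)" unfolding o_assoc i2 by simp
    finally show "- s \<in> ?T" using ic by simp
    fix t assume t: "t \<in> ?T"
    show "s + t \<in> ?T" using I.m_closed[of "emb s" "emb t"] s t by (simp add: IMG_simps(2) emb_plus)
  qed
  moreover have "g 0 ` {1..N} \<subseteq> ?T"
  proof clarify
    fix i assume i: "i \<in> {1..N}"
    have "lasso (x 0) (pc i) (\<Gamma> 0 i)" using lassos[of 0] i unfolding lassos_def by blast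
    from lasso_ends[OF this] show "emb (g 0 i) \<in> carrier (IMG p (x 0))"
      unfolding emb_g[OF i] IMG_simps(1) by (simp add: pc_loops_iff)
  qed
  ultimately have "G 0 \<subseteq> ?T" unfolding G_def by (rule gen_least)
  then show "t \<in> G 0 \<Longrightarrow> ?thesis" by blast
qed

lemma emb_hom: "emb \<in> hom (gr (G 0)) (IMG p (x 0))"
  by (intro homI) (auto simp: gr_simps IMG_simps(2) emb_plus emb_in_IMG)

lemma IMG_negative:
  assumes "r = 1 \<and> 2 \<le> N \<or> r \<noteq> 1 \<and> 3 \<le> N"
  shows "\<not> has_LR (IMG p (x 0))" "\<not> virtually_abelian (IMG p (x 0))"
proof -
  have inj: "inj_on emb (carrier (gr (G 0)))" using emb_inj by (auto intro: inj_onI)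
  note * = group_IMG[OF x0_P] group_gr[OF subgp_G[of 0]] emb_hom inj
  have "\<not> has_LR (gr (G 0)) \<and> \<not> virtually_abelian (gr (G 0))"
  proof (cases "r = 1")
    case True
    interpret pk: periodic_kneading N r e by unfold_locales (use True assms per_def in auto)
    show ?thesis using pk.not_LR pk.not_va by blast
  next
    case False
    interpret pk: preperiodic_kneading N r e by unfold_locales (use False assms per_def in auto)
    show ?thesis using pk.not_LR pk.not_va by blast
  qed
  then show "\<not> has_LR (IMG p (x 0))" "\<not> virtually_abelian (IMG p (x 0))"
    using has_LR_inj_hom[OF *] virtually_abelian_inj_hom[OF *] by blast+
qed

end

context pcf_quad
begin

lemma negative:
  assumes z: "z \<notin> P" and rN': "r = 1 \<and> 2 \<le> N \<or> r \<noteq> 1 \<and> 3 \<le> N"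
  shows "\<not> has_LR (IMG p z)" "\<not> virtually_abelian (IMG p z)"
proof -
  obtain x \<Gamma> \<eta> e where *: "x 0 = z" "\<forall>k. lassos (x k) (\<Gamma> k) \<and> recursion (x k) (\<Gamma> k) (x (Suc k)) (\<eta> k) (e k) (\<Gamma> (Suc k))"
    using tower_exists[OF z] by blast
  interpret tower p a c v N r x \<Gamma> \<eta> e by unfold_locales (use * in blast)+
  show "\<not> has_LR (IMG p z)" "\<not> virtually_abelian (IMG p z)" using IMG_negative[OF rN'] *(1) by simp_all
qed

end

section \<open>Quadratic polynomials uniformised by the exponential or the cosine\<close>

text \<open>\<open>E\<close> is \<open>exp\<close> or \<open>cos\<close> up to an affine change of
  coordinates, \<open>\<omega>\<close> its period and \<open>ev\<close> says whether it is even.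
  Lifts are demanded for paths off \<open>P\<close>: \<open>cos\<close> is branched over
  \<open>1\<close> and \<open>- 1\<close>, which correspond to the post-critical points.\<close>

locale uniformised = quad +
  fixes E :: "complex \<Rightarrow> complex" and \<omega> :: complex and ev :: bool
  assumes E_cont: "continuous_on UNIV E"
    and E_double: "f (E t) = E (2 * t)"
    and E_eq: "E s = E t \<longleftrightarrow> (\<exists>j::int. s = t + of_int j * \<omega> \<or> ev \<and> s = - t + of_int j * \<omega>)"
    and E_lift: "good \<gamma> \<Longrightarrow> \<exists>\<delta>. path \<delta> \<and> (\<forall>t\<in>{0..1}. E (\<delta> t) = \<gamma> t)"
begin

lemma E_lift_from:
  assumes "good \<gamma>" "E t0 = \<gamma> 0"
  shows "\<exists>\<delta>. path \<delta> \<and> \<delta> 0 = t0 \<and> (\<forall>t\<in>{0..1}. E (\<delta> t) = \<gamma> t)"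
proof -
  obtain \<delta> where d: "path \<delta>" "\<And>t. t \<in> {0..1} \<Longrightarrow> E (\<delta> t) = \<gamma> t" using E_lift[OF assms(1)] by blast
  then have "E t0 = E (\<delta> 0)" using assms(2) by simp
  then obtain j :: int where "t0 = \<delta> 0 + of_int j * \<omega> \<or> ev \<and> t0 = - \<delta> 0 + of_int j * \<omega>" unfolding E_eq by blast
  then show ?thesis
  proof
    assume t0: "t0 = \<delta> 0 + of_int j * \<omega>"
    have "path (\<lambda>t. \<delta> t + of_int j * \<omega>)" using d(1) unfolding path_def by (intro continuous_intros)
    moreover have "E (\<delta> t + of_int j * \<omega>) = E (\<delta> t)" for t unfolding E_eq by blast
    ultimately show ?thesis using d(2) t0 by (intro exI[of _ "\<lambda>t. \<delta> t + of_int j * \<omega>"]) simp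
  next
    assume t0: "ev \<and> t0 = - \<delta> 0 + of_int j * \<omega>"
    have "path (\<lambda>t. - \<delta> t + of_int j * \<omega>)" using d(1) unfolding path_def by (intro continuous_intros)
    moreover have "E (- \<delta> t + of_int j * \<omega>) = E (\<delta> t)" for t unfolding E_eq using t0 by blast
    ultimately show ?thesis using d(2) t0 by (intro exI[of _ "\<lambda>t. - \<delta> t + of_int j * \<omega>"]) simp
  qed
qed

lemma E_surj: "z \<notin> P \<Longrightarrow> \<exists>t. E t = z"
proof -
  assume "z \<notin> P"
  then have "good (\<lambda>_. z)" unfolding good_def path_def path_image_def by auto
  then show ?thesis using E_lift[of "\<lambda>_. z"] by force
qed

lemma funpow_E: "(f ^^ n) (E (t / 2 ^ n)) = E t"
proof (induction n arbitrary: t)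
  case (Suc n)
  have "(f ^^ n) (E (t / 2 / 2 ^ n)) = E (t / 2)" by (rule Suc.IH)
  then show ?case using E_double[of "t / 2"] by (simp add: mult.commute)
qed simp

lemma act_E:
  assumes \<gamma>: "good \<gamma>" and d: "path \<delta>" "\<And>t. t \<in> {0..1} \<Longrightarrow> E (\<delta> t) = \<gamma> t"
  shows "act n \<gamma> (E (\<delta> 0 / 2 ^ n)) = E (\<delta> 1 / 2 ^ n)"
proof (rule act_eq[OF \<gamma>])
  show "(f ^^ n) (E (\<delta> 0 / 2 ^ n)) = \<gamma> 0" using funpow_E d(2) by simp
  have "continuous_on {0..1} (\<lambda>t. E (\<delta> t / 2 ^ n))"
    by (rule continuous_on_compose2[OF E_cont]) (use d(1) in \<open>auto simp: path_def intro!: continuous_intros\<close>)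
  then show "is_lift n \<gamma> (E (\<delta> 0 / 2 ^ n)) (\<lambda>t. E (\<delta> t / 2 ^ n))"
    unfolding is_lift_def path_def pathstart_def using funpow_E d(2) by simp
qed

text \<open>The indexing by all integers is redundant, as \<open>j\<close> and
  \<open>j + 2 ^ n\<close> give the same vertex. In exchange a single integer describes the action
  of a loop on all levels at once.\<close>

definition vert :: "complex \<Rightarrow> nat \<Rightarrow> int \<Rightarrow> nat \<times> complex" where
  "vert \<theta> n j = (n, E ((\<theta> + of_int j * \<omega>) / 2 ^ n))"

lemma vert_in: "(f ^^ n) (E ((\<theta> + of_int j * \<omega>) / 2 ^ n)) = E \<theta>"
  unfolding funpow_E E_eq by blast

lemma vert_ex:
  assumes "E \<theta> \<notin> P" and y: "(f ^^ n) y = E \<theta>"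
  shows "\<exists>j. (n, y) = vert \<theta> n j"
proof -
  have "y \<notin> P" using assms funpow_in_P by metis
  then obtain s where s: "E s = y" using E_surj by blast
  have ss: "s = 2 ^ n * s / 2 ^ n" by simp
  have "E (2 ^ n * s) = E \<theta>" using funpow_E[of n "2 ^ n * s"] y s by simp
  then obtain j :: int where "2 ^ n * s = \<theta> + of_int j * \<omega> \<or> ev \<and> 2 ^ n * s = - \<theta> + of_int j * \<omega>" unfolding E_eq by blast
  then show ?thesis
  proof
    assume "2 ^ n * s = \<theta> + of_int j * \<omega>"
    then have "s = (\<theta> + of_int j * \<omega>) / 2 ^ n" using ss by metis
    then show ?thesis using s unfolding vert_def by blast
  next
    assume h: "ev \<and> 2 ^ n * s = - \<theta> + of_int j * \<omega>"
    then have "- s = (\<theta> + of_int (- j) * \<omega>) / 2 ^ n" by (simp add: field_simps)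
    moreover have "E (- s) = E s" unfolding E_eq using h by (intro exI[of _ 0]) simp
    ultimately show ?thesis using s unfolding vert_def by metis
  qed
qed

text \<open>The lift of the loop from \<open>\<theta>\<close> ends at \<open>\<theta>\<close> or
  \<open>- \<theta>\<close> up to a multiple of the period. Shifting it by \<open>j\<close> periods
  gives the lifts for all vertices; in the second case evenness of \<open>E\<close> turns the end
  points into those of a reflection.\<close>

lemma loop_translation_or_reflection:
  assumes \<gamma>: "\<gamma> \<in> pc_loops p (E \<theta>)"
  shows "(\<exists>m. \<forall>n j. loop_action p (E \<theta>) \<gamma> (vert \<theta> n j) = vert \<theta> n (j + m)) \<or>
    (\<exists>m. \<forall>n j. loop_action p (E \<theta>) \<gamma> (vert \<theta> n j) = vert \<theta> n (- j - m))"
proof -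
  have g: "good \<gamma>" "E \<theta> = \<gamma> 0" "\<gamma> 1 = E \<theta>" using \<gamma> unfolding pc_loops_iff by auto
  obtain \<delta> where d: "path \<delta>" "\<delta> 0 = \<theta>" "\<And>t. t \<in> {0..1} \<Longrightarrow> E (\<delta> t) = \<gamma> t" using E_lift_from[OF g(1,2)] by blast
  have A: "loop_action p (E \<theta>) \<gamma> (vert \<theta> n j) = (n, E ((\<delta> 1 + of_int j * \<omega>) / 2 ^ n))" for n j
  proof -
    let ?d = "\<lambda>t. \<delta> t + of_int j * \<omega>"
    have "path ?d" using d(1) unfolding path_def by (intro continuous_intros)
    moreover have "E (?d t) = \<gamma> t" if "t \<in> {0..1}" for t
    proof -
      have "E (?d t) = E (\<delta> t)" unfolding E_eq by blast
      then show ?thesis using d(3)[OF that] by simp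
    qed
    ultimately have "act n \<gamma> (E (?d 0 / 2 ^ n)) = E (?d 1 / 2 ^ n)" by (rule act_E[OF g(1)])
    then show ?thesis unfolding vert_def using loop_action_apply(1)[OF vert_in] d(2) by simp
  qed
  have "E (\<delta> 1) = E \<theta>" using d(3)[of 1] g(3) by simp
  then obtain m :: int where "\<delta> 1 = \<theta> + of_int m * \<omega> \<or> ev \<and> \<delta> 1 = - \<theta> + of_int m * \<omega>" unfolding E_eq by blast
  then show ?thesis
  proof
    assume d1: "\<delta> 1 = \<theta> + of_int m * \<omega>"
    have "loop_action p (E \<theta>) \<gamma> (vert \<theta> n j) = vert \<theta> n (j + m)" for n j
      unfolding A unfolding vert_def d1 by (simp add: algebra_simps)
    then show ?thesis by blast
  next
    assume d1: "ev \<and> \<delta> 1 = - \<theta> + of_int m * \<omega>"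
    have "loop_action p (E \<theta>) \<gamma> (vert \<theta> n j) = vert \<theta> n (- j - m)" for n j
    proof -
      have "E ((\<delta> 1 + of_int j * \<omega>) / 2 ^ n) = E ((\<theta> + of_int (- j - m) * \<omega>) / 2 ^ n)"
      proof -
        have "(\<delta> 1 + of_int j * \<omega>) / 2 ^ n = - ((\<theta> + of_int (- j - m) * \<omega>) / 2 ^ n)"
          using d1 by (simp add: minus_divide_left algebra_simps)
        then show ?thesis unfolding E_eq using d1 by (intro exI[of _ 0]) simp
      qed
      then show ?thesis unfolding A unfolding vert_def by simp
    qed
    then show ?thesis by blast
  qed
qed

lemma positive:
  assumes z: "z \<notin> P"
  shows "has_LR (IMG p z)" "virtually_abelian (IMG p z)"
proof -
  obtain \<theta> where \<theta>: "z = E \<theta>" using E_surj[OF z] by blast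
  let ?G = "IMG p z" and ?X = "vert \<theta>"
  interpret group ?G by (rule group_IMG[OF z])
  define T where "T g m \<longleftrightarrow> (\<forall>n j. g (?X n j) = ?X n (j + m))" for g and m :: int
  define R where "R g m \<longleftrightarrow> (\<forall>n j. g (?X n j) = ?X n (- j - m))" for g and m :: int
  have TR: "(\<exists>m. T g m) \<or> (\<exists>m. R g m)" if "g \<in> carrier ?G" for g
    using that loop_translation_or_reflection unfolding IMG_simps(1) \<theta> T_def R_def by blast
  interpret dihedral_like ?G T
  proof
    show "T \<one>\<^bsub>?G\<^esub> 0" unfolding T_def IMG_simps by simp
    fix g h m n assume gh: "g \<in> carrier ?G" "h \<in> carrier ?G"
    show "T g m \<Longrightarrow> T h n \<Longrightarrow> T (g \<otimes>\<^bsub>?G\<^esub> h) (m + n)" unfolding T_def IMG_simps by (simp add: add.assoc)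
    show "T g m \<Longrightarrow> T (inv\<^bsub>?G\<^esub> g) (- m)"
    proof -
      assume t: "T g m"
      have "g \<otimes>\<^bsub>?G\<^esub> inv\<^bsub>?G\<^esub> g = \<one>\<^bsub>?G\<^esub>" using gh by simp
      then have i: "(inv\<^bsub>?G\<^esub> g) (g u) = u" for u unfolding IMG_simps by (metis comp_apply id_apply)
      have "(inv\<^bsub>?G\<^esub> g) (?X n j) = ?X n (j + - m)" for n j
        using i[of "?X n (j + - m)"] t unfolding T_def by simp
      then show ?thesis unfolding T_def by blast
    qed
    show "g = h" if t: "T g m" "T h m"
    proof
      fix u :: "nat \<times> complex"
      obtain n y where u: "u = (n, y)" by fastforce
      obtain \<gamma> \<gamma>' where l: "g = loop_action p z \<gamma>" "h = loop_action p z \<gamma>'" using gh unfolding IMG_simps by blast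
      show "g u = h u"
      proof (cases "(f ^^ n) y = z")
        case True
        then obtain j where "u = ?X n j" using vert_ex[of \<theta> n y] z unfolding \<theta> u by blast
        then show ?thesis using t unfolding T_def by simp
      next
        case False
        then show ?thesis unfolding l u by (simp add: loop_action_apply(2))
      qed
    qed
    assume "\<nexists>m. T g m" "\<nexists>m. T h m"
    then obtain k l where "R g k" "R h l" using TR gh by blast
    then have "T (g \<otimes>\<^bsub>?G\<^esub> h) (k - l)" unfolding T_def R_def IMG_simps by (simp add: algebra_simps)
    then show "\<exists>m. T (g \<otimes>\<^bsub>?G\<^esub> h) m" by blast
  qed
  show "has_LR ?G" "virtually_abelian ?G" by (rule has_LR, rule virtually_abelian)
qed

end

section \<open>The powering map and the Chebyshev map\<close>

context quad
begin

text \<open>\<open>f\<close> takes equal values at \<open>c + 1\<close> and \<open>c - 1\<close>,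
  and so does the model at the corresponding points; as the model is symmetric about
  \<open>0\<close>, its critical point is the image of \<open>c\<close>.\<close>

lemma conj_critical:
  assumes A: "A \<noteq> 0" and conj: "\<And>w. A * f w + B = k * (A * w + B)\<^sup>2 + l" and k: "k \<noteq> 0"
  shows "A * c + B = 0" "A * v + B = l"
proof -
  have "k * (A * (c + 1) + B)\<^sup>2 + l = k * (A * (c - 1) + B)\<^sup>2 + l"
    unfolding conj[symmetric] by (simp add: poly_p)
  then have "(A * (c + 1) + B)\<^sup>2 = (A * (c - 1) + B)\<^sup>2" using k by simp
  then have "4 * A * (A * c + B) = 0" by algebra
  then show "A * c + B = 0" using A by simp
  then show "A * v + B = l" using conj[of c] f_c by simp
qed

text \<open>The value \<open>0\<close> omitted by \<open>exp\<close> corresponds to the critical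
  value \<open>v\<close>, so every path off \<open>P\<close> has a logarithm in the new
  coordinate.\<close>

lemma power_positive:
  assumes A: "A \<noteq> 0" and conj: "\<And>w. A * f w + B = (A * w + B)\<^sup>2" and z: "z \<notin> P"
  shows "has_LR (IMG p z)" "virtually_abelian (IMG p z)"
proof -
  have v: "A * v + B = 0" using conj_critical[OF A, of B 1 0] conj by simp
  interpret uniformised p a c v "\<lambda>t. (exp t - B) / A" "2 * of_real pi * \<i>" False
  proof
    show "continuous_on UNIV (\<lambda>t. (exp t - B) / A)" by (intro continuous_intros) (use A in simp)
    fix t :: complex
    have "A * f ((exp t - B) / A) + B = exp (2 * t)" unfolding conj exp_double using A by simp
    then show "f ((exp t - B) / A) = (exp (2 * t) - B) / A" using A by (simp add: field_simps)
    fix s :: complex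
    have "((exp s - B) / A = (exp t - B) / A) = (exp s = exp t)" using A by (simp add: divide_cancel_right)
    then show "((exp s - B) / A = (exp t - B) / A) =
        (\<exists>j::int. s = t + of_int j * (2 * of_real pi * \<i>) \<or> False \<and> s = - t + of_int j * (2 * of_real pi * \<i>))"
      unfolding exp_eq by (simp add: mult_ac)
  next
    fix \<gamma> assume \<gamma>: "good \<gamma>"
    have "continuous_on {0..1} (\<lambda>t. A * \<gamma> t + B)" using \<gamma> unfolding good_def path_def by (intro continuous_intros) auto
    moreover have "A * \<gamma> t + B \<noteq> 0" if "t \<in> {0..1}" for t
    proof
      assume "A * \<gamma> t + B = 0"
      then have "A * \<gamma> t = A * v" using v by (metis add_right_cancel)
      then show False using good_neq_v[OF \<gamma> that] A by simp
    qed
    ultimately obtain \<delta> where d: "continuous_on {0..1} \<delta>" "\<And>t. t \<in> {0..1} \<Longrightarrow> A * \<gamma> t + B = exp (\<delta> t)"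
      using continuous_logarithm_on_contractible[OF _ contractible_01, of "\<lambda>t. A * \<gamma> t + B"] by blast
    have "(exp (\<delta> t) - B) / A = \<gamma> t" if "t \<in> {0..1}" for t using d(2)[OF that, symmetric] A by simp
    then show "\<exists>\<delta>. path \<delta> \<and> (\<forall>t\<in>{0..1}. (exp (\<delta> t) - B) / A = \<gamma> t)" using d(1) unfolding path_def by blast
  qed
  show "has_LR (IMG p z)" "virtually_abelian (IMG p z)" by (rule positive[OF z])+
qed

lemma chebyshev_positive:
  assumes A: "A \<noteq> 0" and conj: "\<And>w. A * f w + B = 2 * (A * w + B)\<^sup>2 - 1" and z: "z \<notin> P"
  shows "has_LR (IMG p z)" "virtually_abelian (IMG p z)"
proof -
  have v: "A * v + B = - 1" using conj_critical[OF A, of B 2 "- 1"] conj by simp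
  then have fv: "A * f v + B = 1" unfolding conj by simp
  interpret uniformised p a c v "\<lambda>t. (cos t - B) / A" "2 * of_real pi" True
  proof
    show "continuous_on UNIV (\<lambda>t. (cos t - B) / A)" by (intro continuous_intros) (use A in simp)
    fix t :: complex
    have "A * f ((cos t - B) / A) + B = cos (2 * t)" unfolding conj cos_double_cos using A by simp
    then show "f ((cos t - B) / A) = (cos (2 * t) - B) / A" using A by (simp add: field_simps)
    fix s :: complex
    have e: "((cos s - B) / A = (cos t - B) / A) = (cos s = cos t)" using A by (simp add: divide_cancel_right)
    show "((cos s - B) / A = (cos t - B) / A) =
        (\<exists>j::int. s = t + of_int j * (2 * of_real pi) \<or> True \<and> s = - t + of_int j * (2 * of_real pi))"
      unfolding e complex_cos_eq
    proof
      assume "\<exists>n\<in>\<int>. s = t + of_real (2 * n * pi) \<or> s = - t + of_real (2 * n * pi)"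
      then obtain n where n: "n \<in> \<int>" "s = t + of_real (2 * n * pi) \<or> s = - t + of_real (2 * n * pi)" by blast
      from n(1) obtain j where "n = of_int j" by (rule Ints_cases)
      then have "s = t + of_real (2 * of_int j * pi) \<or> s = - t + of_real (2 * of_int j * pi)" using n(2) by simp
      then show "\<exists>j::int. s = t + of_int j * (2 * of_real pi) \<or> True \<and> s = - t + of_int j * (2 * of_real pi)"
        by (intro exI[of _ j]) (simp add: mult_ac)
    next
      assume "\<exists>j::int. s = t + of_int j * (2 * of_real pi) \<or> True \<and> s = - t + of_int j * (2 * of_real pi)"
      then obtain j :: int where "s = t + of_int j * (2 * of_real pi) \<or> s = - t + of_int j * (2 * of_real pi)" by blast
      then show "\<exists>n\<in>\<int>. s = t + of_real (2 * n * pi) \<or> s = - t + of_real (2 * n * pi)"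
        by (intro bexI[of _ "of_int j"]) (simp_all add: mult_ac)
    qed
  next
    fix \<gamma> assume \<gamma>: "good \<gamma>"
    define u where "u t = A * \<gamma> t + B" for t
    have cu: "continuous_on {0..1} u" using \<gamma> unfolding u_def good_def path_def by (intro continuous_intros) auto
    have nz: "(u t)\<^sup>2 - 1 \<noteq> 0" if t: "t \<in> {0..1}" for t
    proof
      assume "(u t)\<^sup>2 - 1 = 0"
      then have "u t = 1 \<or> u t = - 1" by (simp add: power2_eq_1_iff)
      then have "A * \<gamma> t + B = A * f v + B \<or> A * \<gamma> t + B = A * v + B" using v fv unfolding u_def by simp
      then have "\<gamma> t = f v \<or> \<gamma> t = v" using A by simp
      then show False using good_point[OF \<gamma> t] v_in_P f_in_P by auto
    qed
    have "continuous_on {0..1} (\<lambda>t. (u t)\<^sup>2 - 1)" by (intro continuous_intros cu)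
    \<comment> \<open>An inverse cosine is found by solving \<open>u + h = exp l\<close>: the
      product of \<open>u + h\<close> and \<open>u - h\<close> is \<open>1\<close>, so neither
      vanishes, a logarithm \<open>l\<close> exists, and \<open>u\<close> is the mean of
      \<open>exp l\<close> and \<open>exp (- l)\<close>.\<close>
    then obtain h where h: "continuous_on {0..1} h" "\<And>t. t \<in> {0..1} \<Longrightarrow> (u t)\<^sup>2 - 1 = (h t)\<^sup>2"
      using continuous_sqrt_on_contractible[OF _ contractible_01, of "\<lambda>t. (u t)\<^sup>2 - 1"] nz by blast
    have prod: "(u t + h t) * (u t - h t) = 1" if "t \<in> {0..1}" for t
      using h(2)[OF that] by algebra
    then have "u t + h t \<noteq> 0" if "t \<in> {0..1}" for t using that by force
    moreover have "continuous_on {0..1} (\<lambda>t. u t + h t)" by (intro continuous_intros cu h(1))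
    ultimately obtain l where l: "continuous_on {0..1} l" "\<And>t. t \<in> {0..1} \<Longrightarrow> u t + h t = exp (l t)"
      using continuous_logarithm_on_contractible[OF _ contractible_01, of "\<lambda>t. u t + h t"] by blast
    have cosl: "cos (- \<i> * l t) = u t" if t: "t \<in> {0..1}" for t
    proof -
      have "exp (l t) * (u t - h t) = 1" using prod[OF t] l(2)[OF t] by simp
      then have "exp (- l t) = u t - h t" by (simp add: exp_minus inverse_unique)
      moreover have "cos (- \<i> * l t) = (exp (l t) + exp (- l t)) / 2"
        by (simp add: cos_exp_eq mult.assoc[symmetric])
      ultimately show ?thesis using l(2)[OF t, symmetric] by simp
    qed
    have "path (\<lambda>t. - \<i> * l t)" unfolding path_def by (intro continuous_intros l(1))
    moreover have "(cos (- \<i> * l t) - B) / A = \<gamma> t" if "t \<in> {0..1}" for t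
      unfolding cosl[OF that] u_def using A by simp
    ultimately show "\<exists>\<delta>. path \<delta> \<and> (\<forall>t\<in>{0..1}. (cos (\<delta> t) - B) / A = \<gamma> t)" by blast
  qed
  show "has_LR (IMG p z)" "virtually_abelian (IMG p z)" by (rule positive[OF z])+
qed

text \<open>For an even model the sign is absorbed into the change of coordinates by negating both
  of its coefficients.\<close>

lemma lin_conj_even:
  assumes "lin_conj_up_to_sign f g" and even: "\<And>w. g (- w) = g w"
  obtains A B where "A \<noteq> 0" "\<And>w. A * f w + B = g (A * w + B)"
proof -
  obtain A B s where *: "A \<noteq> 0" "s = 1 \<or> s = -1" "\<And>w. A * f w + B = s * g (A * w + B)"
    using assms(1) unfolding lin_conj_up_to_sign_def by blast
  show ?thesis
  proof (cases "s = 1")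
    case True
    then show ?thesis using * that[of A B] by simp
  next
    case False
    have "- A * f w + - B = g (- A * w + - B)" for w
    proof -
      have "- A * f w + - B = - (A * f w + B)" by simp
      also have "\<dots> = g (- (A * w + B))" unfolding *(3) even using False *(2) by simp
      finally show ?thesis by simp
    qed
    then show ?thesis using that[of "- A" "- B"] *(1) by simp
  qed
qed

lemma positive_case:
  assumes z: "z \<notin> P"
    and conj: "lin_conj_up_to_sign f (\<lambda>w. w ^ 2) \<or> lin_conj_up_to_sign f (\<lambda>w. 2 * w ^ 2 - 1)"
  shows "has_LR (IMG p z) \<and> virtually_abelian (IMG p z)"
  using conj
proof
  assume "lin_conj_up_to_sign f (\<lambda>w. w ^ 2)"
  then obtain A B where "A \<noteq> 0" "\<And>w. A * f w + B = (A * w + B) ^ 2" by (rule lin_conj_even) auto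
  then show ?thesis using power_positive[OF _ _ z] by blast
next
  assume "lin_conj_up_to_sign f (\<lambda>w. 2 * w ^ 2 - 1)"
  then obtain A B where "A \<noteq> 0" "\<And>w. A * f w + B = 2 * (A * w + B) ^ 2 - 1" by (rule lin_conj_even) auto
  then show ?thesis using chebyshev_positive[OF _ _ z] by blast
qed

text \<open>\<open>N\<close> is the least index whose successor in the critical orbit repeats an
  earlier point. Minimality gives injectivity up to \<open>N\<close>, and the repetition makes this
  initial part closed under \<open>f\<close>.\<close>

lemma portrait_exists:
  assumes "finite P"
  obtains N r where "pcf_quad p a c v N r"
proof -
  define q where "q i = (f ^^ (i - 1)) v" for i
  have qS: "q (Suc i) = f (q i)" if "1 \<le> i" for i using that by (cases i) (simp_all add: q_def)
  have qP: "q i \<in> P" for i unfolding q_def by (rule funpow_in_P[OF v_in_P])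
  have "\<exists>n\<ge>1. q (Suc n) \<in> q ` {1..n}"
  proof (rule ccontr)
    assume "\<not> ?thesis"
    then have new: "q (Suc n) \<notin> q ` {1..n}" if "1 \<le> n" for n using that by blast
    have "inj_on q {1..}"
    proof (rule linorder_inj_onI')
      fix i j :: nat assume ij: "i \<in> {1..}" "i < j"
      then obtain n where n: "j = Suc n" "1 \<le> n" "i \<le> n" by (cases j) auto
      show "q i \<noteq> q j"
      proof
        assume "q i = q j"
        then have "q (Suc n) = q i" using n by simp
        then have "q (Suc n) \<in> q ` {1..n}" using ij n by auto
        then show False using new[OF n(2)] by blast
      qed
    qed
    moreover have "finite (q ` {1..})" using finite_subset[OF _ assms, of "q ` {1..}"] qP by blast
    ultimately have "finite {1::nat..}" by (rule finite_imageD[rotated])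
    then show False using infinite_Ici by blast
  qed
  then obtain N where N: "1 \<le> N" "q (Suc N) \<in> q ` {1..N}" "\<And>n. 1 \<le> n \<Longrightarrow> n < N \<Longrightarrow> q (Suc n) \<notin> q ` {1..n}"
    using exists_least_iff[of "\<lambda>n. 1 \<le> n \<and> q (Suc n) \<in> q ` {1..n}"] by blast
  from N(2) obtain r where r: "q (Suc N) = q r" "r \<in> {1..N}" by blast
  have inj: "inj_on q {1..N}"
  proof (rule linorder_inj_onI')
    fix i j :: nat assume ij: "i \<in> {1..N}" "j \<in> {1..N}" "i < j"
    then obtain n where n: "j = Suc n" "1 \<le> n" "i \<le> n" "n < N" by (cases j) auto
    show "q i \<noteq> q j"
    proof
      assume "q i = q j"
      then have "q (Suc n) = q i" using n by simp
      then have "q (Suc n) \<in> q ` {1..n}" using ij n by auto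
      then show False using N(3)[OF n(2,4)] by blast
    qed
  qed
  have im: "q (Suc n) \<in> q ` {1..N}" for n
  proof (induction n)
    case 0
    then show ?case using N(1) by auto
  next
    case (Suc n)
    then obtain i where i: "i \<in> {1..N}" "q (Suc n) = q i" by blast
    have "q (Suc (Suc n)) = q (Suc i)" using qS[of "Suc n"] qS[of i] i by simp
    moreover have "q (Suc i) \<in> q ` {1..N}"
    proof (cases "i = N")
      case False
      then have "Suc i \<in> {1..N}" using i(1) by auto
      then show ?thesis by (rule imageI)
    qed (use N(2) in simp)
    ultimately show ?case by simp
  qed
  have "P = q ` {1..N}"
  proof
    show "P \<subseteq> q ` {1..N}" unfolding P_eq using im by (auto simp: q_def)
  qed (use qP in blast)
  then have "pcf_quad p a c v N r"
    using r inj qS[OF N(1)] unfolding q_def by unfold_locales auto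
  then show ?thesis by (rule that)
qed

end

context pcf_quad
begin

text \<open>Only two portraits remain. For \<open>r = N = 1\<close> the critical point is its own
  value; for \<open>r = N = 2\<close> the sibling of \<open>v\<close> is the fixed point
  \<open>f v\<close>.\<close>

lemma small_portrait:
  assumes "\<not> (r = 1 \<and> 2 \<le> N \<or> r \<noteq> 1 \<and> 3 \<le> N)"
  shows "lin_conj_up_to_sign f (\<lambda>w. w ^ 2) \<or> lin_conj_up_to_sign f (\<lambda>w. 2 * w ^ 2 - 1)"
proof -
  consider "r = 1" "N = 1" | "r = 2" "N = 2" using assms r1 rN by linarith
  then show ?thesis
  proof cases
    case 1
    then have "v = c" using pc_last pc_1 by simp
    then have "lin_conj_up_to_sign f (\<lambda>w. w ^ 2)"
      unfolding lin_conj_up_to_sign_def using a0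
      by (intro exI[of _ a] exI[of _ "- a * c"] exI[of _ 1]) (simp add: poly_p power2_eq_square algebra_simps)
    then show ?thesis by blast
  next
    case 2
    have pc2: "pc 2 = f v" using pc_Suc[of 1] pc_1 by (simp add: numeral_2_eq_2)
    have "2 * c - v = pc 2" using pc_sibling[of 2] 2 pc_1 by simp
    then have fv: "f v = 2 * c - v" using pc2 by simp
    \<comment> \<open>\<open>v\<close> and \<open>f v\<close> are mirror images in \<open>c\<close>;
      with \<open>c\<close> as origin and \<open>d\<close> as unit they become \<open>- 1\<close>
      and \<open>1\<close>, and this normalisation forces \<open>a * d = 2\<close>.\<close>
    define d where "d = c - v"
    have d0: "d \<noteq> 0"
    proof
      assume "d = 0"
      then have "pc 2 = pc 1" using fv pc2 pc_1 f_c by (simp add: d_def)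
      then show False using pc_inj[of 2 1] 2 by simp
    qed
    have "a * d\<^sup>2 = 2 * d" using fv unfolding poly_p d_def by (simp add: algebra_simps power2_eq_square)
    then have ad: "a * d = 2" using d0 by (simp add: power2_eq_square)
    have "(1 / d) * f w + - c / d = 1 * (2 * ((1 / d) * w + - c / d) ^ 2 - 1)" for w
    proof -
      have "(1 / d) * w + - c / d = (w - c) / d" by (simp add: diff_divide_distrib)
      moreover have "(1 / d) * f w + - c / d = (a * (w - c)\<^sup>2 + v - c) / d" by (simp add: poly_p diff_divide_distrib)
      moreover have "(a * (w - c)\<^sup>2 + v - c) / d = 2 * ((w - c) / d)\<^sup>2 - 1"
      proof -
        have s1: "a * (w - c)\<^sup>2 + v - c = 2 / d * (w - c)\<^sup>2 - d" 
        proof -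
          have "a = 2 / d" using ad d0 by (simp add: field_simps)
          then show ?thesis by (simp add: d_def)
        qed
        show ?thesis unfolding s1 using d0 by (simp add: field_simps power2_eq_square)
      qed
      ultimately show ?thesis by simp
    qed
    then have "lin_conj_up_to_sign f (\<lambda>w. 2 * w ^ 2 - 1)"
      unfolding lin_conj_up_to_sign_def using d0
      by (intro exI[of _ "1 / d"] exI[of _ "- c / d"] exI[of _ 1]) simp
    then show ?thesis by blast
  qed
qed

end

lemma quad_exists:
  fixes p :: "complex poly"
  assumes "degree p = 2"
  obtains a c v where "quad p a c v"
proof -
  let ?a = "coeff p 2" and ?b = "coeff p 1" and ?c = "coeff p 0"
  have a: "?a \<noteq> 0" using assms leading_coeff_neq_0[of p] by fastforce
  have "poly p w = ?a * (w - - ?b / (2 * ?a))\<^sup>2 + (?c - ?b\<^sup>2 / (4 * ?a))" for w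
  proof -
    have "poly p w = ?c + ?b * w + ?a * w\<^sup>2"
      unfolding poly_altdef assms by (simp add: numeral_2_eq_2)
    also have "\<dots> = ?a * (w - - ?b / (2 * ?a))\<^sup>2 + (?c - ?b\<^sup>2 / (4 * ?a))"
      using a by (simp add: field_simps power2_eq_square)
    finally show ?thesis .
  qed
  then have "quad p ?a (- ?b / (2 * ?a)) (?c - ?b\<^sup>2 / (4 * ?a))" using a by unfold_locales auto
  then show ?thesis by (rule that)
qed

theorem theoremB:
  fixes p :: "complex poly" and z :: complex
  assumes "degree p = 2" and "pcf p" and "z \<notin> postcrit p"
  shows "(has_LR (IMG p z) \<longleftrightarrow> virtually_abelian (IMG p z)) \<and>
         (virtually_abelian (IMG p z) \<longleftrightarrow>
            (lin_conj_up_to_sign (poly p) (\<lambda>w. w ^ 2) \<or>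
             lin_conj_up_to_sign (poly p) (\<lambda>w. 2 * w ^ 2 - 1)))"
proof -
  obtain a c v where "quad p a c v" using quad_exists[OF assms(1)] by blast
  then interpret quad p a c v .
  have "finite (postcrit p)" using assms(2) unfolding pcf_def .
  then obtain N r where "pcf_quad p a c v N r" by (rule portrait_exists)
  then interpret pcf_quad p a c v N r .
  show ?thesis
  proof (cases "r = 1 \<and> 2 \<le> N \<or> r \<noteq> 1 \<and> 3 \<le> N")
    case True
    then show ?thesis using negative[OF assms(3) True] positive_case[OF assms(3)] by blast
  next
    case False
    then show ?thesis using small_portrait[OF False] positive_case[OF assms(3)] by blast
  qed
qed

end
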